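(* Let $\beta>1$ and let $\Gamma$ be a geodesic in the standard chessboard structure from the origin to a light vertex $\xi=(x,y)$ with $0\le y\le x$. Then: (i) if $\beta\ge\beta^c_0$, then $\mathcal{L}_\beta(\Gamma)=x+(\sqrt2-1)y$; (ii) if $\sqrt{3/2}\le\beta\le\beta^c_0$, then \[ \mathcal{L}_\beta(\Gamma)=\begin{cases} x+(\Lambda_3-3)y, & \text{if } 0\le y\le x/3,\\[2pt] \dfrac{\Lambda_3-\sqrt2}{2}\,x+\dfrac{3\sqrt2-\Lambda_3}{2}\,y, & \text{if } x/3\le y\le x.\end{cases} \]
   Context: Standard chessboard structure: for $\beta>1$ let $a_\beta:\mathbb{R}^2\to\{1,\beta\}$ be $2$-periodic in each variable with, on $[0,2)\times[0,2)$, $a_\beta=\beta$ on $((0,1)\times(1,2))\cup((1,2)\times(0,1))$ and $a_\beta=1$ otherwise. The optical length of a curve parametrized by $u\in AC([0,1];\mathbb{R}^2)$ is $\mathcal{L}_\beta(u)=\int_0^1a_\beta(u(t))|u'(t)|\,dt$; a geodesic from $P$ to $Q$ is a curve minimizing $\mathcal{L}_\beta$ among all absolutely continuous curves from $P$ to $Q$. A light vertex is a point $(2n+j,j)$ with $n,j\in\mathbb{Z}$. Normalized length: for $t\ge 0$ let $q(t)=\lfloor t+1\rfloor/2$ if $\lfloor t\rfloor$ is odd and $q(t)=t-\lfloor t\rfloor/2$ if $\lfloor t\rfloor$ is even, $p(t)=t+1-q(t)$; let $\hat\sigma(t,\beta)\in(0,1)$ be the unique solution $\sigma$ of $\frac{p(t)\sigma}{\sqrt{1-\sigma^2}}+\frac{q(t)\sigma}{\sqrt{\beta^2-\sigma^2}}=1$,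 and $l(t,\beta)=\frac{p(t)}{\sqrt{1-\hat\sigma^2}}+\frac{\beta^2q(t)}{\sqrt{\beta^2-\hat\sigma^2}}-t-\sqrt2$. $\beta^c_0$ is the unique $\beta\in(1,\sqrt2)$ with $l(2,\beta)=0$ (existence and uniqueness are shown in the paper). $\Lambda_3=\frac{2}{\sqrt{1-\sigma_3^2}}+\frac{\beta^2}{\sqrt{\beta^2-\sigma_3^2}}$, where $\sigma_3\in(0,1)$ is the unique solution of $\frac{2\sigma}{\sqrt{1-\sigma^2}}+\frac{\sigma}{\sqrt{\beta^2-\sigma^2}}=1$; it is the optical length of an $S_3$-path, i.e. of the minimizing curve joining $(2m+k,k)$ to $(2m+k+3,k+1)$ within the strip $k\le y\le k+1$. *)

theory Defs
  imports "HOL-Analysis.Analysis"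
begin

definition chess_a :: "real \<Rightarrow> real \<times> real \<Rightarrow> real" where
  "chess_a \<beta> P =
     (let u = fst P - 2 * of_int \<lfloor>fst P / 2\<rfloor>; v = snd P - 2 * of_int \<lfloor>snd P / 2\<rfloor> in
      if (0 < u \<and> u < 1 \<and> 1 < v \<and> v < 2) \<or> (1 < u \<and> u < 2 \<and> 0 < v \<and> v < 1) then \<beta> else 1)"

definition abs_cont_01 :: "(real \<Rightarrow> real \<times> real) \<Rightarrow> bool" where
  "abs_cont_01 u \<longleftrightarrow>
     (\<forall>\<epsilon>>0. \<exists>\<delta>>0. \<forall>(n::nat) (a::nat \<Rightarrow> real) b.
        (\<forall>i<n. 0 \<le> a i \<and> a i \<le> b i \<and> b i \<le> 1) \<and>
        (\<forall>i<n. \<forall>j<n. i \<noteq> j \<longrightarrow> b i \<le> a j \<or> b j \<le> a i) \<and>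
        (\<Sum>i<n. b i - a i) < \<delta>
        \<longrightarrow> (\<Sum>i<n. dist (u (b i)) (u (a i))) < \<epsilon>)"

definition optical_length :: "real \<Rightarrow> (real \<Rightarrow> real \<times> real) \<Rightarrow> real" where
  "optical_length \<beta> u =
     integral {0..1} (\<lambda>t. chess_a \<beta> (u t) * norm (vector_derivative u (at t)))"

definition is_geodesic :: "real \<Rightarrow> real \<times> real \<Rightarrow> real \<times> real \<Rightarrow> (real \<Rightarrow> real \<times> real) \<Rightarrow> bool" where
  "is_geodesic \<beta> P Q u \<longleftrightarrow>
     abs_cont_01 u \<and> u 0 = P \<and> u 1 = Q \<and>
     (\<forall>v. abs_cont_01 v \<and> v 0 = P \<and> v 1 = Q \<longrightarrow> optical_length \<beta> u \<le> optical_length \<beta> v)"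

definition light_vertex :: "real \<times> real \<Rightarrow> bool" where
  "light_vertex P \<longleftrightarrow> (\<exists>n j :: int. P = (of_int (2 * n + j), of_int j))"

definition qfun :: "real \<Rightarrow> real" where
  "qfun t = (if odd \<lfloor>t\<rfloor> then of_int \<lfloor>t + 1\<rfloor> / 2 else t - of_int \<lfloor>t\<rfloor> / 2)"

definition pfun :: "real \<Rightarrow> real" where
  "pfun t = t + 1 - qfun t"

definition sigma_hat :: "real \<Rightarrow> real \<Rightarrow> real" where
  "sigma_hat t \<beta> = (THE \<sigma>. 0 < \<sigma> \<and> \<sigma> < 1 \<and>
      pfun t * \<sigma> / sqrt (1 - \<sigma>\<^sup>2) + qfun t * \<sigma> / sqrt (\<beta>\<^sup>2 - \<sigma>\<^sup>2) = 1)"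

definition lnorm :: "real \<Rightarrow> real \<Rightarrow> real" where
  "lnorm t \<beta> = (let \<sigma> = sigma_hat t \<beta> in
      pfun t / sqrt (1 - \<sigma>\<^sup>2) + \<beta>\<^sup>2 * qfun t / sqrt (\<beta>\<^sup>2 - \<sigma>\<^sup>2) - t - sqrt 2)"

definition beta0c :: real where
  "beta0c = (THE \<beta>. 1 < \<beta> \<and> \<beta> < sqrt 2 \<and> lnorm 2 \<beta> = 0)"

definition sigma3 :: "real \<Rightarrow> real" where
  "sigma3 \<beta> = (THE \<sigma>. 0 < \<sigma> \<and> \<sigma> < 1 \<and>
      2 * \<sigma> / sqrt (1 - \<sigma>\<^sup>2) + \<sigma> / sqrt (\<beta>\<^sup>2 - \<sigma>\<^sup>2) = 1)"

definition Lambda3 :: "real \<Rightarrow> real" where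
  "Lambda3 \<beta> = 2 / sqrt (1 - (sigma3 \<beta>)\<^sup>2) + \<beta>\<^sup>2 / sqrt (\<beta>\<^sup>2 - (sigma3 \<beta>)\<^sup>2)"

end

theory Submission
  imports Defs
begin

text \<open>
The upper bounds come from explicit curves: diagonals and grid lines, along which the coefficient
is 1, and \<open>S\<^sub>3\<close>-paths, which advance a light vertex by \<open>(3, 1)\<close> at cost \<open>\<Lambda>\<^sub>3\<close>.

The lower bounds come from calibrations. If \<open>\<Phi>\<close> is 1-Lipschitz on closed light squares and
\<open>c\<close>-Lipschitz on closed dark ones with \<open>c \<le> \<beta>\<close>, then \<open>(\<Phi> \<circ> u)' \<le> a(u) |u'|\<close> almost everywhere along
every absolutely continuous \<open>u\<close>. On the grid this holds because, at almost every time spent on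
a grid line, \<open>u'\<close> is parallel to that line, which also bounds a light square. Hence
\<open>\<Phi>(Q) - \<Phi>(P)\<close> is at most the optical length of any curve from \<open>P\<close> to \<open>Q\<close>. For a linear form
\<open>p x + q y\<close> with \<open>3 p + q = \<Lambda>\<^sub>3(c)\<close>, a calibration agreeing with it at all light vertices is
prescribed on the edges of the squares by maxima of affine functions, and extended inside each square
as a Lipschitz function. The bound \<open>c\<^sup>2 \<ge> 3/2\<close> is what prevents a shorter
cut through the dark corner between a diagonal and a grid line. Taking \<open>c = \<beta>\<^sub>0\<^sup>c\<close> gives (i),
and \<open>c = \<beta>\<close> with the two forms through \<open>(1, 0), (3, 1)\<close> and through \<open>(3, 1), (1, 1)\<close> gives (ii).
\<close>

section \<open>Absolutely continuous curves\<close>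

text \<open>A linear form cannot calibrate by itself: (1, sqrt 2 - 1), for instance, has norm above
  1 and breaks the bound in light squares. The calibration is the form plus a correction, periodic
  under light vertices and zero at them. Which forms are needed is dictated by three directions: (1,
  0) at cost 1, (1, 1) at cost sqrt 2 and (3, 1) at cost \<open>Lambda3\<close>. Since (3, 1) = 2
  (1, 0) + (1, 1), an S3-path competes with two horizontal units and a diagonal. As long as it is
  cheaper, (3, 1) is a corner between two linear pieces; at \<open>beta0c\<close> the costs tie, the
  corner disappears and both forms become x + (sqrt 2 - 1) y. The number 3/2 is the squared norm of
  (1, 1 / sqrt 2): rate 1 along a grid line combined with the vertical component of the unit
  diagonal gradient, which the data on the edges of a dark square may demand together. Since
  \<open>optical_length\<close> integrates a pointwise derivative, all this rests on the fundamental
  theorem of calculus for absolutely continuous functions, obtained here from the total variation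
  and Radon-Nikodym.\<close>

definition abs_cont :: "(real \<Rightarrow> 'a::metric_space) \<Rightarrow> bool" where
  "abs_cont f \<longleftrightarrow>
     (\<forall>\<epsilon>>0. \<exists>\<delta>>0. \<forall>(n::nat) (a::nat \<Rightarrow> real) b.
        (\<forall>i<n. 0 \<le> a i \<and> a i \<le> b i \<and> b i \<le> 1) \<and>
        (\<forall>i<n. \<forall>j<n. i \<noteq> j \<longrightarrow> b i \<le> a j \<or> b j \<le> a i) \<and>
        (\<Sum>i<n. b i - a i) < \<delta>
        \<longrightarrow> (\<Sum>i<n. dist (f (b i)) (f (a i))) < \<epsilon>)"

lemma abs_cont_01_iff: "abs_cont_01 u \<longleftrightarrow> abs_cont u"
  by (simp add: abs_cont_01_def abs_cont_def)

text \<open>Arbitrary finite index sets allow families to be merged and refined without renumbering.\<close>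

definition disj_family :: "'i set \<Rightarrow> ('i \<Rightarrow> real) \<Rightarrow> ('i \<Rightarrow> real) \<Rightarrow> real \<Rightarrow> real \<Rightarrow> bool" where
  "disj_family I a b s t \<longleftrightarrow> finite I \<and> (\<forall>i\<in>I. s \<le> a i \<and> a i \<le> b i \<and> b i \<le> t) \<and>
     (\<forall>i\<in>I. \<forall>j\<in>I. i \<noteq> j \<longrightarrow> b i \<le> a j \<or> b j \<le> a i)"

lemma disj_familyI:
  assumes "finite I" "\<And>i. i \<in> I \<Longrightarrow> s \<le> a i" "\<And>i. i \<in> I \<Longrightarrow> a i \<le> b i" "\<And>i. i \<in> I \<Longrightarrow> b i \<le> t"
    "\<And>i j. i \<in> I \<Longrightarrow> j \<in> I \<Longrightarrow> i \<noteq> j \<Longrightarrow> b i \<le> a j \<or> b j \<le> a i"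
  shows "disj_family I a b s t"
  unfolding disj_family_def by (intro conjI ballI impI assms)

lemma disj_familyD:
  assumes "disj_family I a b s t"
  shows "finite I" "i \<in> I \<Longrightarrow> s \<le> a i" "i \<in> I \<Longrightarrow> a i \<le> b i" "i \<in> I \<Longrightarrow> b i \<le> t"
    "i \<in> I \<Longrightarrow> j \<in> I \<Longrightarrow> i \<noteq> j \<Longrightarrow> b i \<le> a j \<or> b j \<le> a i"
  using assms unfolding disj_family_def by blast+

lemma disj_family_reindex:
  assumes F: "disj_family I a b s t" and h: "bij_betw h J I"
  shows "disj_family J (a \<circ> h) (b \<circ> h) s t"
proof -
  have m: "h j \<in> I" if "j \<in> J" for j using h that by (auto simp: bij_betw_def)
  have n: "h i \<noteq> h j" if "i \<in> J" "j \<in> J" "i \<noteq> j" for i j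
    using h that by (auto simp: bij_betw_def inj_on_def)
  show ?thesis
  proof (rule disj_familyI)
    show "finite J" using h disj_familyD(1)[OF F] bij_betw_finite by blast
  qed (use disj_familyD(2-5)[OF F] m n in simp_all)
qed

lemma disj_family_mono_comp:
  assumes F: "disj_family I a b s t" and m: "\<And>x y. x \<le> y \<Longrightarrow> h x \<le> (h y :: real)"
  shows "disj_family I (\<lambda>i. h (a i)) (\<lambda>i. h (b i)) (h s) (h t)"
proof (rule disj_familyI)
  fix i j assume "i \<in> I" "j \<in> I" "i \<noteq> j"
  from disj_familyD(5)[OF F this] show "h (b i) \<le> h (a j) \<or> h (b j) \<le> h (a i)"
    using m by blast
qed (use disj_familyD(1-4)[OF F] m in simp_all)

lemma disj_family_mono:
  assumes "disj_family I a b s t" "s' \<le> s" "t \<le> t'"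
  shows "disj_family I a b s' t'"
  using assms unfolding disj_family_def by (meson order_trans)

lemma abs_cont_iff:
  "abs_cont f \<longleftrightarrow> (\<forall>e>0. \<exists>d>0. \<forall>n (a::nat \<Rightarrow> real) b. disj_family {..<n} a b 0 1 \<longrightarrow>
     (\<Sum>i<n. b i - a i) < d \<longrightarrow> (\<Sum>i<n. dist (f (b i)) (f (a i))) < e)"
  by (simp only: abs_cont_def disj_family_def finite_lessThan Ball_def lessThan_iff imp_conjL conj_assoc simp_thms)

lemma disj_family_single:
  "s \<le> a \<Longrightarrow> a \<le> b \<Longrightarrow> b \<le> t \<Longrightarrow> disj_family {i} (\<lambda>_. a) (\<lambda>_. b) s t"
  by (simp add: disj_family_def)

lemma abs_contD:
  assumes "abs_cont f" "e > 0"
  obtains d where "d > 0"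
    "\<And>I (a::'i \<Rightarrow> real) b. disj_family I a b 0 1 \<Longrightarrow> (\<Sum>i\<in>I. b i - a i) < d \<Longrightarrow>
       (\<Sum>i\<in>I. dist (f (b i)) (f (a i))) < e"
proof -
  obtain d where d: "d > 0" and D: "\<And>(n::nat) (a::nat \<Rightarrow> real) b.
        disj_family {..<n} a b 0 1 \<Longrightarrow> (\<Sum>i<n. b i - a i) < d
        \<Longrightarrow> (\<Sum>i<n. dist (f (b i)) (f (a i))) < e"
    using assms unfolding abs_cont_iff by meson
  show ?thesis
  proof (rule that[OF d])
    fix I and a b :: "'i \<Rightarrow> real"
    assume F: "disj_family I a b 0 1" and S: "(\<Sum>i\<in>I. b i - a i) < d"
    then have "finite I" by (simp add: disj_family_def)
    then obtain h where h: "bij_betw h {..<card I} I"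
      using bij_betw_from_nat_into_finite by blast
    have "(\<Sum>i<card I. dist (f ((b \<circ> h) i)) (f ((a \<circ> h) i))) < e"
      using S sum.reindex_bij_betw[OF h, of "\<lambda>i. b i - a i"]
      by (intro D disj_family_reindex[OF F h]) simp
    then show "(\<Sum>i\<in>I. dist (f (b i)) (f (a i))) < e"
      using sum.reindex_bij_betw[OF h, of "\<lambda>i. dist (f (b i)) (f (a i))"] by simp
  qed
qed

lemma abs_contI:
  assumes "\<And>e. e > 0 \<Longrightarrow> \<exists>d>0. \<forall>n (a::nat \<Rightarrow> real) b. disj_family {..<n} a b 0 1 \<longrightarrow>
     (\<Sum>i<n. b i - a i) < d \<longrightarrow> (\<Sum>i<n. dist (f (b i)) (f (a i))) < e"
  shows "abs_cont f"
  using assms unfolding abs_cont_iff by blast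

text \<open>Comparing increments instead of composing functions lets one lemma serve coordinates,
  \<open>\<Phi> \<circ> u\<close>, Lipschitz curves (with \<open>f\<close> the identity) and
  functions known only on [0, 1].\<close>

lemma abs_cont_lipschitz_comp:
  assumes "abs_cont f" and L: "\<And>x y. x \<in> {0..1} \<Longrightarrow> y \<in> {0..1} \<Longrightarrow> dist (g x) (g y) \<le> L * dist (f x) (f y)"
  shows "abs_cont g"
proof (rule abs_contI)
  fix e :: real assume "e > 0"
  \<comment> \<open>\<open>L\<close> may be zero or negative, but \<open>e\<close> has to be divided
    by a positive constant.\<close>
  define L' where "L' = max L 1"
  have "L' > 0" "L \<le> L'" by (auto simp: L'_def)
  obtain d where "d > 0" and d: "\<And>I (a::nat \<Rightarrow> real) b. disj_family I a b 0 1 \<Longrightarrow> (\<Sum>i\<in>I. b i - a i) < d \<Longrightarrow>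
       (\<Sum>i\<in>I. dist (f (b i)) (f (a i))) < e / L'"
    using abs_contD[OF assms(1) divide_pos_pos[OF \<open>e > 0\<close> \<open>L' > 0\<close>]] by blast
  show "\<exists>d>0. \<forall>n (a::nat \<Rightarrow> real) b. disj_family {..<n} a b 0 1 \<longrightarrow>
     (\<Sum>i<n. b i - a i) < d \<longrightarrow> (\<Sum>i<n. dist (g (b i)) (g (a i))) < e"
  proof (intro exI[of _ d] conjI allI impI)
    fix n and a b :: "nat \<Rightarrow> real"
    assume F: "disj_family {..<n} a b 0 1" and S: "(\<Sum>i<n. b i - a i) < d"
    have "(\<Sum>i<n. dist (g (b i)) (g (a i))) \<le> (\<Sum>i<n. L' * dist (f (b i)) (f (a i)))"
    proof (rule sum_mono)
      fix i assume "i \<in> {..<n}"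
      then have "a i \<in> {0..1}" "b i \<in> {0..1}" 
        using disj_familyD(2-4)[OF F, of i] by auto
      then have "dist (g (b i)) (g (a i)) \<le> L * dist (f (b i)) (f (a i))" using L by blast
      also have "\<dots> \<le> L' * dist (f (b i)) (f (a i))"
        using \<open>L \<le> L'\<close> by (simp add: mult_right_mono)
      finally show "dist (g (b i)) (g (a i)) \<le> L' * dist (f (b i)) (f (a i))" .
    qed
    also have "\<dots> = L' * (\<Sum>i<n. dist (f (b i)) (f (a i)))" by (simp add: sum_distrib_left)
    also have "\<dots> < e" using d[OF F S] \<open>L' > 0\<close> by (simp add: field_simps)
    finally show "(\<Sum>i<n. dist (g (b i)) (g (a i))) < e" .
  qed (fact \<open>d > 0\<close>)
qed

lemma abs_cont_lipschitz:
  assumes "\<And>x y. x \<in> {0..1} \<Longrightarrow> y \<in> {0..1} \<Longrightarrow> dist (g x) (g y) \<le> L * \<bar>x - y\<bar>"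
  shows "abs_cont g"
proof (rule abs_cont_lipschitz_comp[where f = "\<lambda>x::real. x" and L = L])
  show "abs_cont (\<lambda>x::real. x)"
  proof (rule abs_contI)
    fix e :: real assume "e > 0"
    then show "\<exists>d>0. \<forall>n (a::nat \<Rightarrow> real) b. disj_family {..<n} a b 0 1 \<longrightarrow>
     (\<Sum>i<n. b i - a i) < d \<longrightarrow> (\<Sum>i<n. dist (b i) (a i)) < e"
      by (intro exI[of _ e] conjI allI impI)
        (simp_all add: disj_family_def dist_real_def)
  qed
qed (use assms in \<open>simp add: dist_real_def\<close>)

lemma abs_cont_diff:
  fixes f g :: "real \<Rightarrow> 'a::real_normed_vector"
  assumes "abs_cont f" "abs_cont g"
  shows "abs_cont (\<lambda>x. f x - g x)"
proof (rule abs_contI)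
  fix e :: real assume "e > 0"
  then have "e / 2 > 0" by simp
  obtain d1 where d1: "d1 > 0" "\<And>I (a::nat \<Rightarrow> real) b. disj_family I a b 0 1 \<Longrightarrow> (\<Sum>i\<in>I. b i - a i) < d1 \<Longrightarrow>
       (\<Sum>i\<in>I. dist (f (b i)) (f (a i))) < e / 2"
    using abs_contD[OF assms(1) \<open>e / 2 > 0\<close>] by blast
  obtain d2 where d2: "d2 > 0" "\<And>I (a::nat \<Rightarrow> real) b. disj_family I a b 0 1 \<Longrightarrow> (\<Sum>i\<in>I. b i - a i) < d2 \<Longrightarrow>
       (\<Sum>i\<in>I. dist (g (b i)) (g (a i))) < e / 2"
    using abs_contD[OF assms(2) \<open>e / 2 > 0\<close>] by blast
  show "\<exists>d>0. \<forall>n (a::nat \<Rightarrow> real) b. disj_family {..<n} a b 0 1 \<longrightarrow>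
     (\<Sum>i<n. b i - a i) < d \<longrightarrow> (\<Sum>i<n. dist (f (b i) - g (b i)) (f (a i) - g (a i))) < e"
  proof (intro exI[of _ "min d1 d2"] conjI allI impI)
    fix n and a b :: "nat \<Rightarrow> real"
    assume F: "disj_family {..<n} a b 0 1" and S: "(\<Sum>i<n. b i - a i) < min d1 d2"
    have "(\<Sum>i<n. dist (f (b i) - g (b i)) (f (a i) - g (a i)))
        \<le> (\<Sum>i<n. dist (f (b i)) (f (a i)) + dist (g (b i)) (g (a i)))"
    proof (rule sum_mono)
      fix i
      have "f (b i) - g (b i) - (f (a i) - g (a i)) = (f (b i) - f (a i)) - (g (b i) - g (a i))"
        by (simp add: algebra_simps)
      then show "dist (f (b i) - g (b i)) (f (a i) - g (a i)) \<le> dist (f (b i)) (f (a i)) + dist (g (b i)) (g (a i))"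
        by (simp only: dist_norm norm_triangle_ineq4)
    qed
    also have "\<dots> < e"
      using d1(2)[OF F] d2(2)[OF F] S by (simp add: sum.distrib)
    finally show "(\<Sum>i<n. dist (f (b i) - g (b i)) (f (a i) - g (a i))) < e" .
  qed (use d1 d2 in auto)
qed

lemma abs_cont_imp_continuous_on:
  assumes "abs_cont f"
  shows "continuous_on {0..1} f"
  unfolding continuous_on_iff
proof (intro ballI allI impI)
  fix x e :: real assume x: "x \<in> {0..1}" and "e > 0"
  obtain d where "d > 0" and d: "\<And>I (a::nat \<Rightarrow> real) b. disj_family I a b 0 1 \<Longrightarrow> (\<Sum>i\<in>I. b i - a i) < d \<Longrightarrow>
       (\<Sum>i\<in>I. dist (f (b i)) (f (a i))) < e"
    using abs_contD[OF assms \<open>e > 0\<close>] by blast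
  show "\<exists>d>0. \<forall>y\<in>{0..1}. dist y x < d \<longrightarrow> dist (f y) (f x) < e"
  proof (intro exI[of _ d] conjI ballI impI)
    fix y assume y: "y \<in> {0..1}" "dist y x < d"
    have "disj_family {0::nat} (\<lambda>_. min x y) (\<lambda>_. max x y) 0 1"
      using x y by (intro disj_family_single) auto
    from d[OF this] y show "dist (f y) (f x) < e"
      by (cases "x \<le> y") (auto simp: dist_real_def max_def min_def dist_commute)
  qed (fact \<open>d > 0\<close>)
qed

text \<open>Half-open intervals are disjoint even when the closed ones share an endpoint, so their
  Lebesgue measures add up.\<close>

lemma disj_family_length:
  assumes F: "disj_family I a b s t" and "s \<le> t"
  shows "(\<Sum>i\<in>I. b i - a i) \<le> t - s"
proof -
  have disj: "disjoint_family_on (\<lambda>i. {a i<..b i}) I"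
    unfolding disjoint_family_on_def
  proof (intro ballI impI)
    fix i j assume "i \<in> I" "j \<in> I" "i \<noteq> j"
    from disj_familyD(5)[OF F this] show "{a i<..b i} \<inter> {a j<..b j} = {}" by auto
  qed
  have "ennreal (\<Sum>i\<in>I. b i - a i) = (\<Sum>i\<in>I. emeasure lborel {a i<..b i})"
    using disj_familyD(3)[OF F] by (subst sum_ennreal[symmetric]) auto
  also have "\<dots> = emeasure lborel (\<Union>i\<in>I. {a i<..b i})"
    by (rule sum_emeasure) (use disj disj_familyD(1)[OF F] in auto)
  also have "\<dots> \<le> emeasure lborel {s..t}"
    using disj_familyD(2,4)[OF F] by (intro emeasure_mono) (force, simp)
  also have "\<dots> = ennreal (t - s)" using \<open>s \<le> t\<close> by simp
  finally show ?thesis using \<open>s \<le> t\<close> by (simp add: ennreal_le_iff)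
qed

text \<open>Clipping at \<open>t\<close> splits a family without splitting intervals: the clipped parts that miss one side
degenerate to points and contribute nothing.\<close>

lemma disj_family_split:
  assumes F: "disj_family I a b s r" and "s \<le> t" "t \<le> r"
  shows "disj_family I (\<lambda>i. min t (a i)) (\<lambda>i. min t (b i)) s t"
    and "disj_family I (\<lambda>i. max t (a i)) (\<lambda>i. max t (b i)) t r"
    and "(\<Sum>i\<in>I. dist (f (b i)) (f (a i))) \<le> (\<Sum>i\<in>I. dist (f (min t (b i))) (f (min t (a i))))
      + (\<Sum>i\<in>I. dist (f (max t (b i))) (f (max t (a i))))"
    and "(\<Sum>i\<in>I. b i - a i) = (\<Sum>i\<in>I. min t (b i) - min t (a i)) + (\<Sum>i\<in>I. max t (b i) - max t (a i))"
proof -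
  show "disj_family I (\<lambda>i. min t (a i)) (\<lambda>i. min t (b i)) s t"
    using disj_family_mono_comp[OF F, of "min t"] \<open>s \<le> t\<close> \<open>t \<le> r\<close>
    by (simp add: min.absorb1 min.absorb2 min.mono)
  show "disj_family I (\<lambda>i. max t (a i)) (\<lambda>i. max t (b i)) t r"
    using disj_family_mono_comp[OF F, of "max t"] \<open>s \<le> t\<close> \<open>t \<le> r\<close>
    by (simp add: max.absorb1 max.absorb2 max.mono)
  show "(\<Sum>i\<in>I. dist (f (b i)) (f (a i))) \<le> (\<Sum>i\<in>I. dist (f (min t (b i))) (f (min t (a i))))
      + (\<Sum>i\<in>I. dist (f (max t (b i))) (f (max t (a i))))"
    unfolding sum.distrib[symmetric]
  proof (rule sum_mono)
    fix i assume "i \<in> I"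
    then show "dist (f (b i)) (f (a i)) \<le> dist (f (min t (b i))) (f (min t (a i)))
        + dist (f (max t (b i))) (f (max t (a i)))"
      using disj_familyD(3)[OF F, of i] dist_triangle[of "f (b i)" "f (a i)" "f t"]
      by (auto simp: min_def max_def)
  qed
  show "(\<Sum>i\<in>I. b i - a i) = (\<Sum>i\<in>I. min t (b i) - min t (a i)) + (\<Sum>i\<in>I. max t (b i) - max t (a i))"
    unfolding sum.distrib[symmetric] by (intro sum.cong) (auto simp: min_def max_def)
qed

section \<open>Total variation\<close>

definition var_sums :: "(real \<Rightarrow> 'a::metric_space) \<Rightarrow> real \<Rightarrow> real \<Rightarrow> real set" where
  "var_sums f s t = {\<Sum>i\<in>I. dist (f (b i)) (f (a i)) | (I :: nat set) a b. disj_family I a b s t}"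

text \<open>Disjoint families replace partitions: closing the gaps can only increase a sum, so this
  is the usual total variation, and its sums are literally those of absolute continuity.\<close>

definition variation :: "(real \<Rightarrow> 'a::metric_space) \<Rightarrow> real \<Rightarrow> real \<Rightarrow> real" where
  "variation f s t = Sup (var_sums f s t)"

lemma var_sumsI:
  assumes F: "disj_family I a b s t"
  shows "(\<Sum>i\<in>I. dist (f (b i)) (f (a i))) \<in> var_sums f s t"
proof -
  obtain h where h: "bij_betw h {..<card I} I"
    using bij_betw_from_nat_into_finite[OF disj_familyD(1)[OF F]] by blast
  have "(\<Sum>i\<in>I. dist (f (b i)) (f (a i))) = (\<Sum>i<card I. dist (f ((b \<circ> h) i)) (f ((a \<circ> h) i)))"
    using sum.reindex_bij_betw[OF h, of "\<lambda>i. dist (f (b i)) (f (a i))"] by simp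
  with disj_family_reindex[OF F h] show ?thesis unfolding var_sums_def by blast
qed

lemma var_sums_nonempty: "var_sums f s t \<noteq> {}"
  using var_sumsI[of "{}::nat set"] by (auto simp: disj_family_def)

text \<open>[0, 1] splits into \<open>N\<close> pieces shorter than the \<open>d\<close> belonging
  to \<open>e = 1\<close>; each piece contributes less than 1, so every sum is at most
  \<open>N\<close>.\<close>

lemma var_sums_bdd_above:
  assumes "abs_cont f" "0 \<le> s" "t \<le> 1"
  shows "bdd_above (var_sums f s t)"
proof -
  obtain d where "d > 0" and d: "\<And>I (a::nat \<Rightarrow> real) b. disj_family I a b 0 1 \<Longrightarrow> (\<Sum>i\<in>I. b i - a i) < d \<Longrightarrow>
       (\<Sum>i\<in>I. dist (f (b i)) (f (a i))) < 1"
    using abs_contD[OF assms(1) zero_less_one] by blast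
  obtain N where N: "N > 0" "1 / real N < d"
    using \<open>d > 0\<close> by (metis nat_approx_posE zero_less_Suc)
  \<comment> \<open>Clipping keeps the index set, so \<open>I\<close> stays fixed in the induction
    and only the endpoints vary.\<close>
  have *: "k \<le> N \<Longrightarrow> disj_family I a b 0 (real k / real N) \<Longrightarrow>
      (\<Sum>i\<in>I. dist (f (b i)) (f (a i))) \<le> real k" for k and I :: "nat set" and a b
  proof (induction k arbitrary: a b)
    case 0
    have "dist (f (b i)) (f (a i)) = 0" if "i \<in> I" for i
    proof -
      have "a i = b i" using disj_familyD(2-4)[OF 0(2) that] by simp
      then show ?thesis by simp
    qed
    then show ?case by simp
  next
    case (Suc k)
    let ?t = "real k / real N"
    have t: "0 \<le> ?t" "?t \<le> real (Suc k) / real N" using \<open>N > 0\<close> by (auto simp: divide_simps)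
    note S = disj_family_split[OF Suc.prems(2) t]
    have "(\<Sum>i\<in>I. dist (f (min ?t (b i))) (f (min ?t (a i)))) \<le> real k"
      using Suc.prems by (intro Suc.IH S(1)) auto
    moreover have "(\<Sum>i\<in>I. dist (f (max ?t (b i))) (f (max ?t (a i)))) < 1"
    proof (rule d)
      show "disj_family I (\<lambda>i. max ?t (a i)) (\<lambda>i. max ?t (b i)) 0 1"
        by (rule disj_family_mono[OF S(2)]) (use Suc.prems \<open>N > 0\<close> t in \<open>auto simp: divide_simps\<close>)
      have "(\<Sum>i\<in>I. max ?t (b i) - max ?t (a i)) \<le> real (Suc k) / real N - ?t"
        by (rule disj_family_length[OF S(2) t(2)])
      also have "\<dots> = 1 / real N" by (simp add: add_divide_distrib)
      finally show "(\<Sum>i\<in>I. max ?t (b i) - max ?t (a i)) < d" using N by linarith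
    qed
    ultimately show ?case using S(3)[of f] by simp
  qed
  have "x \<le> real N" if "x \<in> var_sums f s t" for x
  proof -
    from that obtain I :: "nat set" and a b where F: "disj_family I a b s t"
      and x: "x = (\<Sum>i\<in>I. dist (f (b i)) (f (a i)))" unfolding var_sums_def by blast
    show ?thesis unfolding x using N
      by (intro *) (auto intro!: disj_family_mono[OF F] assms)
  qed
  then show ?thesis by (rule bdd_aboveI)
qed

lemma sum_le_variation:
  assumes "abs_cont f" "0 \<le> s" "t \<le> 1" "disj_family I a b s t"
  shows "(\<Sum>i\<in>I. dist (f (b i)) (f (a i))) \<le> variation f s t"
  unfolding variation_def
  by (intro cSup_upper var_sumsI var_sums_bdd_above assms)

lemma dist_le_variation:
  assumes "abs_cont f" "0 \<le> s" "s \<le> t" "t \<le> 1"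
  shows "dist (f t) (f s) \<le> variation f s t"
  using sum_le_variation[OF assms(1,2,4) disj_family_single[of s s t t "0::nat"]] assms(3) by simp

lemma variation_le:
  assumes "\<And>I (a::nat \<Rightarrow> real) b. disj_family I a b s t \<Longrightarrow> (\<Sum>i\<in>I. dist (f (b i)) (f (a i))) \<le> c"
  shows "variation f s t \<le> c"
  unfolding variation_def
  by (intro cSup_least var_sums_nonempty) (use assms in \<open>auto simp: var_sums_def\<close>)

lemma variation_approx:
  assumes "abs_cont f" "0 \<le> s" "t \<le> 1" "e > 0"
  obtains I and a b :: "nat \<Rightarrow> real" where "disj_family I a b s t"
    "variation f s t < (\<Sum>i\<in>I. dist (f (b i)) (f (a i))) + e"
proof -
  have "variation f s t - e < Sup (var_sums f s t)"
    using \<open>e > 0\<close> by (simp add: variation_def)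
  then obtain x where "x \<in> var_sums f s t" "variation f s t - e < x"
    using less_cSupD[OF var_sums_nonempty] by blast
  then show ?thesis using that unfolding var_sums_def by force
qed

text \<open>Clipping at \<open>t\<close> gives one inequality; placing two nearly optimal families
  side by side, indexed by a sum type, gives the other.\<close>

lemma variation_add:
  assumes f: "abs_cont f" and "0 \<le> s" "s \<le> t" "t \<le> r" "r \<le> 1"
  shows "variation f s r = variation f s t + variation f t r"
proof (rule antisym)
  show "variation f s r \<le> variation f s t + variation f t r"
  proof (rule variation_le)
    fix I and a b :: "nat \<Rightarrow> real" assume F: "disj_family I a b s r"
    note S = disj_family_split[OF F \<open>s \<le> t\<close> \<open>t \<le> r\<close>]
    have "(\<Sum>i\<in>I. dist (f (min t (b i))) (f (min t (a i)))) \<le> variation f s t"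
      by (rule sum_le_variation[OF f _ _ S(1)]) (use assms in auto)
    moreover have "(\<Sum>i\<in>I. dist (f (max t (b i))) (f (max t (a i)))) \<le> variation f t r"
      by (rule sum_le_variation[OF f _ _ S(2)]) (use assms in auto)
    ultimately show "(\<Sum>i\<in>I. dist (f (b i)) (f (a i))) \<le> variation f s t + variation f t r"
      using S(3)[of f] by linarith
  qed
  show "variation f s t + variation f t r \<le> variation f s r"
  proof (rule field_le_epsilon)
    fix e :: real assume "e > 0"
    then have e: "e / 2 > 0" by simp
    obtain I and a b :: "nat \<Rightarrow> real" where F: "disj_family I a b s t"
      and 1: "variation f s t < (\<Sum>i\<in>I. dist (f (b i)) (f (a i))) + e / 2"
      using variation_approx[OF f _ _ e, of s t] assms by auto
    obtain J and a' b' :: "nat \<Rightarrow> real" where G: "disj_family J a' b' t r"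
      and 2: "variation f t r < (\<Sum>i\<in>J. dist (f (b' i)) (f (a' i))) + e / 2"
      using variation_approx[OF f _ _ e, of t r] assms by auto
    have "disj_family (I <+> J) (case_sum a a') (case_sum b b') s r"
    proof (rule disj_familyI)
      fix i j assume "i \<in> I <+> J" "j \<in> I <+> J" "i \<noteq> j"
      then show "case_sum b b' i \<le> case_sum a a' j \<or> case_sum b b' j \<le> case_sum a a' i"
        using disj_familyD(5)[OF F] disj_familyD(5)[OF G] disj_familyD(4)[OF F] disj_familyD(2)[OF G]
        by (elim PlusE; fastforce)
    qed (use disj_familyD(1-4)[OF F] disj_familyD(1-4)[OF G] assms in \<open>fastforce+\<close>)
    from sum_le_variation[OF f _ _ this] assms
    have "(\<Sum>i\<in>I. dist (f (b i)) (f (a i))) + (\<Sum>i\<in>J. dist (f (b' i)) (f (a' i))) \<le> variation f s r"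
      using disj_familyD(1)[OF F] disj_familyD(1)[OF G] by (simp add: sum.Plus)
    with 1 2 show "variation f s t + variation f t r \<le> variation f s r + e" by linarith
  qed
qed

text \<open>Refining each interval by a nearly optimal family inside it does not increase the total
  length, so the \<open>d\<close> that works for \<open>f\<close> with \<open>e / 2\<close> also
  works for its variation with \<open>e\<close>.\<close>

lemma variation_abs_cont:
  assumes f: "abs_cont f"
  shows "abs_cont (variation f 0)"
proof (rule abs_contI)
  fix e :: real assume "e > 0"
  then have "e / 2 > 0" by simp
  obtain d where "d > 0" and d: "\<And>I (a::nat \<times> nat \<Rightarrow> real) b. disj_family I a b 0 1 \<Longrightarrow> (\<Sum>i\<in>I. b i - a i) < d \<Longrightarrow>
       (\<Sum>i\<in>I. dist (f (b i)) (f (a i))) < e / 2"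
    using abs_contD[OF f \<open>e / 2 > 0\<close>] by blast
  show "\<exists>d>0. \<forall>n (a::nat \<Rightarrow> real) b. disj_family {..<n} a b 0 1 \<longrightarrow> (\<Sum>i<n. b i - a i) < d \<longrightarrow>
       (\<Sum>i<n. dist (variation f 0 (b i)) (variation f 0 (a i))) < e"
  proof (intro exI[of _ d] conjI allI impI)
    fix n and a b :: "nat \<Rightarrow> real"
    assume F: "disj_family {..<n} a b 0 1" and S: "(\<Sum>i<n. b i - a i) < d"
    \<comment> \<open>\<open>n\<close> approximation errors stay within \<open>e / 2\<close> in
      total; the summand 1 covers \<open>n = 0\<close>.\<close>
    define e' where "e' = e / (2 * (real n + 1))"
    have "e' > 0" using \<open>e > 0\<close> by (simp add: e'_def)
    have "\<forall>i. \<exists>T. i < n \<longrightarrow> disj_family (fst T :: nat set) (fst (snd T)) (snd (snd T)) (a i) (b i) \<and>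
        variation f (a i) (b i) < (\<Sum>k\<in>fst T. dist (f (snd (snd T) k)) (f (fst (snd T) k))) + e'"
    proof
      fix i
      show "\<exists>T. i < n \<longrightarrow> disj_family (fst T :: nat set) (fst (snd T)) (snd (snd T)) (a i) (b i) \<and>
        variation f (a i) (b i) < (\<Sum>k\<in>fst T. dist (f (snd (snd T) k)) (f (fst (snd T) k))) + e'"
      proof (cases "i < n")
        case True
        then have i: "i \<in> {..<n}" by simp
        obtain I \<alpha> \<beta> where "disj_family (I::nat set) \<alpha> \<beta> (a i) (b i)"
          "variation f (a i) (b i) < (\<Sum>k\<in>I. dist (f (\<beta> k)) (f (\<alpha> k))) + e'"
          using variation_approx[OF f disj_familyD(2)[OF F i] disj_familyD(4)[OF F i] \<open>e' > 0\<close>] by blast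
        then show ?thesis by (intro exI[of _ "(I, \<alpha>, \<beta>)"]) simp
      qed simp
    qed
    from choice[OF this] obtain T where
      T: "\<And>i. i < n \<Longrightarrow> disj_family (fst (T i) :: nat set) (fst (snd (T i))) (snd (snd (T i))) (a i) (b i)"
         "\<And>i. i < n \<Longrightarrow> variation f (a i) (b i) <
            (\<Sum>k\<in>fst (T i). dist (f (snd (snd (T i)) k)) (f (fst (snd (T i)) k))) + e'"
      by blast
    define I where "I i = fst (T i)" for i
    define \<alpha> where "\<alpha> i = fst (snd (T i))" for i
    define \<beta> where "\<beta> i = snd (snd (T i))" for i
    note G = T(1)[folded I_def \<alpha>_def \<beta>_def] and V = T(2)[folded I_def \<alpha>_def \<beta>_def]
    let ?\<alpha> = "\<lambda>(i, k). \<alpha> i k" and ?\<beta> = "\<lambda>(i, k). \<beta> i k"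
    have fin: "\<forall>i\<in>{..<n}. finite (I i)" using G disj_familyD(1) by blast
    have "disj_family (Sigma {..<n} I) ?\<alpha> ?\<beta> 0 1"
    proof (rule disj_familyI)
      show "finite (Sigma {..<n} I)" using fin by (intro finite_SigmaI) auto
    next
      fix x assume x: "x \<in> Sigma {..<n} I"
      obtain i k where [simp]: "x = (i, k)" by (cases x)
      from x have ik: "i < n" "k \<in> I i" by auto
      have "a i \<le> \<alpha> i k" "\<alpha> i k \<le> \<beta> i k" "\<beta> i k \<le> b i" using disj_familyD(2-4)[OF G[OF ik(1)] ik(2)] .
      moreover have "0 \<le> a i" "b i \<le> 1" using disj_familyD(2,4)[OF F, of i] ik by auto
      ultimately show "0 \<le> ?\<alpha> x" "?\<alpha> x \<le> ?\<beta> x" "?\<beta> x \<le> 1" by auto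
    next
      fix x y assume x: "x \<in> Sigma {..<n} I" and y: "y \<in> Sigma {..<n} I" and "x \<noteq> y"
      obtain i k j l where [simp]: "x = (i, k)" "y = (j, l)" by (cases x, cases y)
      from x y have ik: "i < n" "k \<in> I i" "j < n" "l \<in> I j" by auto
      show "?\<beta> x \<le> ?\<alpha> y \<or> ?\<beta> y \<le> ?\<alpha> x"
      proof (cases "i = j")
        case True
        with \<open>x \<noteq> y\<close> ik have "k \<noteq> l" "l \<in> I i" by auto
        from disj_familyD(5)[OF G[OF ik(1)] ik(2) this(2,1)] True show ?thesis by simp
      next
        case False
        with disj_familyD(5)[OF F, of i j] ik have "b i \<le> a j \<or> b j \<le> a i" by auto
        moreover have "a i \<le> \<alpha> i k" "\<beta> i k \<le> b i" "a j \<le> \<alpha> j l" "\<beta> j l \<le> b j"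
          using disj_familyD(2,4)[OF G[OF ik(1)] ik(2)] disj_familyD(2,4)[OF G[OF ik(3)] ik(4)] by auto
        ultimately show ?thesis by auto
      qed
    qed
    moreover have "(\<Sum>x\<in>Sigma {..<n} I. ?\<beta> x - ?\<alpha> x) < d"
    proof -
      have "(\<Sum>x\<in>Sigma {..<n} I. ?\<beta> x - ?\<alpha> x) = (\<Sum>i<n. \<Sum>k\<in>I i. \<beta> i k - \<alpha> i k)"
        using fin by (subst sum.Sigma) (auto simp: case_prod_unfold)
      also have "\<dots> \<le> (\<Sum>i<n. b i - a i)"
        using disj_familyD(3)[OF F] by (intro sum_mono disj_family_length[OF G]) auto
      finally show ?thesis using S by linarith
    qed
    ultimately have "(\<Sum>x\<in>Sigma {..<n} I. dist (f (?\<beta> x)) (f (?\<alpha> x))) < e / 2" by (rule d)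
    also have "(\<Sum>x\<in>Sigma {..<n} I. dist (f (?\<beta> x)) (f (?\<alpha> x))) = (\<Sum>i<n. \<Sum>k\<in>I i. dist (f (\<beta> i k)) (f (\<alpha> i k)))"
      using fin by (subst sum.Sigma) (auto simp: case_prod_unfold)
    finally have 1: "(\<Sum>i<n. \<Sum>k\<in>I i. dist (f (\<beta> i k)) (f (\<alpha> i k))) < e / 2" .
    have "(\<Sum>i<n. dist (variation f 0 (b i)) (variation f 0 (a i))) = (\<Sum>i<n. variation f (a i) (b i))"
    proof (rule sum.cong[OF refl])
      fix i assume "i \<in> {..<n}"
      note i = disj_familyD(2-4)[OF F this]
      have "0 \<le> variation f (a i) (b i)"
        using dist_le_variation[OF f i] zero_le_dist order_trans by blast
      then show "dist (variation f 0 (b i)) (variation f 0 (a i)) = variation f (a i) (b i)"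
        using variation_add[OF f order_refl i] by (simp add: dist_real_def)
    qed
    also have "\<dots> \<le> (\<Sum>i<n. (\<Sum>k\<in>I i. dist (f (\<beta> i k)) (f (\<alpha> i k))) + e')"
      using V by (intro sum_mono) (auto intro: less_imp_le)
    also have "\<dots> = (\<Sum>i<n. \<Sum>k\<in>I i. dist (f (\<beta> i k)) (f (\<alpha> i k))) + n * e'"
      by (simp add: sum.distrib)
    also have "n * e' \<le> e / 2" using \<open>e > 0\<close> by (simp add: e'_def field_simps)
    finally show "(\<Sum>i<n. dist (variation f 0 (b i)) (variation f 0 (a i))) < e" using 1 by linarith
  qed (fact \<open>d > 0\<close>)
qed

section \<open>Differentiability almost everywhere\<close>

lemma negligible_affine_image:
  fixes N :: "real set"
  assumes "negligible N"
  shows "negligible ((\<lambda>x. c * x + d) ` N)"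
  by (rule negligible_differentiable_image_negligible[OF _ assms])
     (auto simp: differentiable_on_def intro!: derivative_intros)

text \<open>Lebesgue differentiation is available for averages over cubes with lower corner at
  \<open>x\<close>, which in dimension one yields the right-hand limit alone.\<close>

lemma right_diff_quotient:
  fixes g :: "real \<Rightarrow> real"
  assumes g: "\<And>a b. a \<le> b \<Longrightarrow> (g has_integral G b - G a) {a..b}"
  obtains N where "negligible N" "\<And>x. x \<notin> N \<Longrightarrow> ((\<lambda>y. (G y - G x) / (y - x)) \<longlongrightarrow> g x) (at_right x)"
proof -
  have int: "g integrable_on cbox a b" for a b :: real
    using g[of a b] by (cases "a \<le> b") (auto simp: integrable_on_def)
  obtain N where N: "negligible N" and lim: "\<And>x e. \<lbrakk>x \<notin> N; 0 < e\<rbrakk> \<Longrightarrow>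
               \<exists>d>0. \<forall>h. 0 < h \<and> h < d \<longrightarrow>
                         norm (integral (cbox x (x + h *\<^sub>R One)) g /\<^sub>R h ^ DIM(real) - g x) < e"
    using integrable_ccontinuous_explicit[of g, OF int] by metis
  show ?thesis
  proof (rule that[OF N])
    fix x assume x: "x \<notin> N"
    show "((\<lambda>y. (G y - G x) / (y - x)) \<longlongrightarrow> g x) (at_right x)"
      unfolding tendsto_iff eventually_at_right_field
    proof (intro allI impI)
      fix e :: real assume "e > 0"
      from lim[OF x this] obtain d where "d > 0" and d: "\<forall>h. 0 < h \<and> h < d \<longrightarrow>
          norm (integral (cbox x (x + h *\<^sub>R One)) g /\<^sub>R h ^ DIM(real) - g x) < e" by (elim exE conjE)
      show "\<exists>b>x. \<forall>y>x. y < b \<longrightarrow> dist ((G y - G x) / (y - x)) (g x) < e"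
      proof (intro exI[of _ "x + d"] conjI allI impI)
        fix y assume y: "x < y" "y < x + d"
        have "integral {x..y} g = G y - G x" using g[of x y] y by (simp add: integral_unique)
        then show "dist ((G y - G x) / (y - x)) (g x) < e"
          using d[rule_format, of "y - x"] y by (simp add: dist_real_def divide_inverse mult.commute)
      qed (use \<open>d > 0\<close> in simp)
    qed
  qed
qed

text \<open>The left-hand quotient at \<open>x\<close> is a right-hand quotient of the reflected
  function at \<open>- x\<close>.\<close>

theorem indefinite_integral_has_derivative_ae:
  fixes g :: "real \<Rightarrow> real"
  assumes g: "\<And>a b. a \<le> b \<Longrightarrow> (g has_integral G b - G a) {a..b}"
  obtains N where "negligible N" "\<And>x. x \<notin> N \<Longrightarrow> (G has_real_derivative g x) (at x)"
proof -
  obtain N where N: "negligible N"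
    and R: "\<And>x. x \<notin> N \<Longrightarrow> ((\<lambda>y. (G y - G x) / (y - x)) \<longlongrightarrow> g x) (at_right x)"
    using right_diff_quotient[OF g] by blast
  have "((\<lambda>x. g (- x)) has_integral - G (- b) - (- G (- a))) {a..b}" if "a \<le> b" for a b
  proof -
    have "(g has_integral G (- a) - G (- b)) {- b.. - a}" using g[of "- b" "- a"] that by simp
    from has_integral_reflect_lemma_real[OF this]
    have "((\<lambda>x. g (- x)) has_integral G (- a) - G (- b)) {a..b}" by simp
    then show ?thesis by simp
  qed
  from right_diff_quotient[where g = "\<lambda>x. g (- x)" and G = "\<lambda>x. - G (- x)", OF this] obtain M where M: "negligible M"
    and L: "\<And>x. x \<notin> M \<Longrightarrow> ((\<lambda>y. (- G (- y) - - G (- x)) / (y - x)) \<longlongrightarrow> g (- x)) (at_right x)"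
    by blast
  show ?thesis
  proof (rule that)
    show "negligible (N \<union> uminus ` M)"
      using N negligible_affine_image[OF M, of "-1" 0] by (simp add: negligible_Un_eq)
    fix x assume x: "x \<notin> N \<union> uminus ` M"
    then have "- x \<notin> M" by force
    from L[OF this] have "((\<lambda>y. (- G (- y) + G x) / (y + x)) \<longlongrightarrow> g x) (at_right (- x))" by simp
    then have "((\<lambda>y. (- G y + G x) / (- y + x)) \<longlongrightarrow> g x) (at_left x)"
      by (subst at_left_minus) (simp add: filterlim_filtermap add.commute)
    moreover have "(- G y + G x) / (- y + x) = (G y - G x) / (y - x)" for y
      using minus_divide_divide[of "G y - G x" "y - x"] by simp
    ultimately have "((\<lambda>y. (G y - G x) / (y - x)) \<longlongrightarrow> g x) (at_left x)" by simp
    with R[of x] x show "(G has_real_derivative g x) (at x)"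
      by (simp add: has_field_derivative_iff filterlim_at_split)
  qed
qed

text \<open>The density is the Radon-Nikodym derivative of the Stieltjes measure of
  \<open>G\<close>. Constancy outside [0, 1] makes that measure live on (0, 1], where absolute
  continuity of \<open>G\<close> turns Lebesgue null sets into null sets of the measure.\<close>

lemma mono_abs_cont_density:
  fixes G :: "real \<Rightarrow> real"
  assumes mono: "mono G" and ac: "abs_cont G"
    and lo: "\<And>x. x \<le> 0 \<Longrightarrow> G x = G 0" and hi: "\<And>x. x \<ge> 1 \<Longrightarrow> G x = G 1"
  obtains g where "g \<in> borel_measurable borel" "\<And>x. g x \<ge> 0"
    "\<And>a b. a \<le> b \<Longrightarrow> (g has_integral G b - G a) {a..b}"
proof -
  have mG: "G x \<le> G y" if "x \<le> y" for x y using mono that by (simp add: mono_def)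
  have clampG: "G x = G (max 0 (min 1 x))" for x
    using lo[of x] hi[of x] by (cases "x \<le> 0"; cases "x \<ge> 1") simp_all
  have "continuous_on UNIV (\<lambda>x. G (max 0 (min 1 x)))"
    by (rule continuous_on_compose2[OF abs_cont_imp_continuous_on[OF ac]])
       (auto intro!: continuous_intros)
  then have contG: "continuous_on UNIV G" using clampG by simp
  then have isG: "isCont G x" for x by (simp add: continuous_on_eq_continuous_at)
  define \<nu> where "\<nu> = interval_measure G"
  have Ioc: "emeasure \<nu> {a<..b} = ennreal (G b - G a)" if "a \<le> b" for a b
    unfolding \<nu>_def using that mG isG
    by (intro emeasure_interval_measure_Ioc) (auto intro: continuous_at_imp_continuous_within)
  have sets[measurable_cong, simp]: "sets \<nu> = sets borel" by (simp add: \<nu>_def)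
  have lonull: "{..0} \<in> null_sets \<nu>"
  proof -
    have "(\<Union>n::nat. {- real n<..0}) \<in> null_sets \<nu>"
    proof (rule null_sets_UN)
      fix n :: nat
      show "{- real n<..0} \<in> null_sets \<nu>"
        using Ioc[of "- real n" 0] lo[of "- real n"] by (intro null_setsI) simp_all
    qed
    moreover have "(\<Union>n::nat. {- real n<..0}) = {..0}"
    proof safe
      fix x :: real assume "x \<le> 0"
      obtain n :: nat where "- x < real n" using reals_Archimedean2 by blast
      then have "x \<in> {- real n<..0}" using \<open>x \<le> 0\<close> by simp
      then show "x \<in> (\<Union>n::nat. {- real n<..0})" by blast
    qed auto
    ultimately show ?thesis by simp
  qed
  have hinull: "{1<..} \<in> null_sets \<nu>"
  proof -
    have "(\<Union>n::nat. {1<..1 + real n}) \<in> null_sets \<nu>"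
    proof (rule null_sets_UN)
      fix n :: nat
      show "{1<..1 + real n} \<in> null_sets \<nu>"
        using Ioc[of 1 "1 + real n"] hi[of "1 + real n"] by (intro null_setsI) simp_all
    qed
    moreover have "(\<Union>n::nat. {1<..1 + real n}) = {1<..}"
    proof safe
      fix x :: real assume "1 < x"
      obtain n :: nat where "x < real n" using reals_Archimedean2 by blast
      then show "x \<in> (\<Union>n::nat. {1<..1 + real n})" using \<open>1 < x\<close> by (auto intro!: exI[of _ n])
    qed auto
    ultimately show ?thesis by simp
  qed
  \<comment> \<open>Absolute continuity speaks of finite families, an open set is infinite: it is
    exhausted by the finite unions \<open>W n\<close> of those grid intervals of mesh 1 / (n + 1)
    that it contains.\<close>
  have open_small: "emeasure \<nu> (U \<inter> {0<..1}) \<le> ennreal e"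
    if "open U" "e > 0" "d > 0" "emeasure lborel U < ennreal d"
      and d: "\<And>I (a::nat \<Rightarrow> real) b. disj_family I a b 0 1 \<Longrightarrow> (\<Sum>i\<in>I. b i - a i) < d \<Longrightarrow>
       (\<Sum>i\<in>I. dist (G (b i)) (G (a i))) < e" for U e d
  proof -
    define D where "D n i = {real i / real (Suc n)<..real (Suc i) / real (Suc n)}" for n i :: nat
    define I where "I n = {i. i < Suc n \<and> D n i \<subseteq> U}" for n
    define W where "W n = (\<Union>i\<in>I n. D n i)" for n
    have finI: "finite (I n)" for n unfolding I_def by simp
    have fam: "disj_family (I n) (\<lambda>i. real i / real (Suc n)) (\<lambda>i. real (Suc i) / real (Suc n)) 0 1" for n
    proof (rule disj_familyI[OF finI])
      fix i j :: nat assume "i \<noteq> j"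
      then have "Suc i \<le> j \<or> Suc j \<le> i" by linarith
      then show "real (Suc i) / real (Suc n) \<le> real j / real (Suc n) \<or> real (Suc j) / real (Suc n) \<le> real i / real (Suc n)"
        by (meson divide_right_mono of_nat_0_le_iff of_nat_le_iff)
    next
      fix i assume "i \<in> I n"
      then have "Suc i \<le> Suc n" by (simp add: I_def)
      then show "real (Suc i) / real (Suc n) \<le> 1"
        by (metis divide_le_eq_1_pos of_nat_0_less_iff of_nat_le_iff zero_less_Suc)
    qed (auto intro!: divide_right_mono)
    have disj: "disjoint_family_on (D n) (I n)" for n
      unfolding disjoint_family_on_def
    proof (intro ballI impI)
      fix i j assume "i \<in> I n" "j \<in> I n" "i \<noteq> j"
      from disj_familyD(5)[OF fam this] show "D n i \<inter> D n j = {}" unfolding D_def by auto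
    qed
    have Wm[measurable]: "W n \<in> sets borel" for n
      unfolding W_def D_def using finI by (intro sets.finite_UN) auto
    have W_small: "emeasure \<nu> (W n) \<le> ennreal e" for n
    proof -
      have le: "real i / real (Suc n) \<le> real (Suc i) / real (Suc n)" for i :: nat
        by (intro divide_right_mono) auto
      have "ennreal (\<Sum>i\<in>I n. real (Suc i) / real (Suc n) - real i / real (Suc n)) = (\<Sum>i\<in>I n. emeasure lborel (D n i))"
        using le by (subst sum_ennreal[symmetric]) (auto simp: D_def)
      also have "\<dots> = emeasure lborel (W n)"
        unfolding W_def by (rule sum_emeasure[OF _ disj finI]) (auto simp: D_def)
      also have "\<dots> \<le> emeasure lborel U"
        using \<open>open U\<close> by (intro emeasure_mono) (auto simp: W_def I_def)
      also have "\<dots> < ennreal d" by fact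
      finally have "(\<Sum>i\<in>I n. real (Suc i) / real (Suc n) - real i / real (Suc n)) < d"
        by (subst (asm) ennreal_less_iff) (use le in \<open>auto intro!: sum_nonneg\<close>)
      from d[OF fam this] have s: "(\<Sum>i\<in>I n. dist (G (real (Suc i) / real (Suc n))) (G (real i / real (Suc n)))) < e" .
      have "emeasure \<nu> (W n) = (\<Sum>i\<in>I n. emeasure \<nu> (D n i))"
        unfolding W_def by (rule sum_emeasure[OF _ disj finI, symmetric]) (auto simp: D_def)
      also have "\<dots> = (\<Sum>i\<in>I n. ennreal (dist (G (real (Suc i) / real (Suc n))) (G (real i / real (Suc n)))))"
        unfolding D_def using le mG[OF le] by (intro sum.cong refl) (subst Ioc, auto simp: dist_real_def)
      also have "\<dots> = ennreal (\<Sum>i\<in>I n. dist (G (real (Suc i) / real (Suc n))) (G (real i / real (Suc n))))"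
        by (rule sum_ennreal) simp
      finally show ?thesis using s by (simp add: ennreal_leI)
    qed
    \<comment> \<open>The grids are not nested, so \<open>W\<close> need not increase; its tail
      intersections do, and they still cover the part of \<open>U\<close> in (0, 1].\<close>
    define Z where "Z n = (\<Inter>m\<in>{n..}. W m)" for n
    have Zm[measurable]: "Z n \<in> sets borel" for n unfolding Z_def by (intro sets.countable_INT) auto
    have "U \<inter> {0<..1} \<subseteq> (\<Union>n. Z n)"
    proof
      fix x assume x: "x \<in> U \<inter> {0<..1}"
      then obtain r where "r > 0" and r: "\<And>y. dist y x < r \<Longrightarrow> y \<in> U"
        using \<open>open U\<close> unfolding open_dist by blast
      obtain n where n: "inverse (real (Suc n)) < r" using reals_Archimedean[OF \<open>r > 0\<close>] by blast
      have "x \<in> W m" if "m \<ge> n" for m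
      proof -
        \<comment> \<open>The intervals \<open>D m i\<close> are open on the left, hence ceiling
          minus one rather than floor.\<close>
        define i where "i = nat (\<lceil>x * real (Suc m)\<rceil> - 1)"
        have pos: "x * real (Suc m) > 0" using x by simp
        then have c: "\<lceil>x * real (Suc m)\<rceil> \<ge> 1" by linarith
        have i: "real i = of_int \<lceil>x * real (Suc m)\<rceil> - 1" using c by (simp add: i_def)
        have b: "real i < x * real (Suc m)" "x * real (Suc m) \<le> real (Suc i)"
          using i le_of_int_ceiling[of "x * real (Suc m)"] of_int_ceiling_le_add_one[of "x * real (Suc m)"]
            ceiling_correct[of "x * real (Suc m)"] by (simp_all only: of_nat_Suc)
        have "x * real (Suc m) \<le> real (Suc m)" using x by simp
        then have "real i < real (Suc m)" using b by linarith
        then have "i < Suc m" by simp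
        moreover have xD: "x \<in> D m i" using b by (simp add: D_def divide_simps mult.commute)
        moreover have "D m i \<subseteq> U"
        proof
          fix y assume y: "y \<in> D m i"
          have "real (Suc i) / real (Suc m) - real i / real (Suc m) = inverse (real (Suc m))"
            by (simp add: field_simps)
          moreover have "inverse (real (Suc m)) \<le> inverse (real (Suc n))"
            using that by (simp add: le_imp_inverse_le)
          moreover have "\<bar>y - x\<bar> \<le> real (Suc i) / real (Suc m) - real i / real (Suc m)"
            using y xD unfolding D_def greaterThanAtMost_iff by linarith
          ultimately have "dist y x < r" using n unfolding dist_real_def by linarith
          then show "y \<in> U" by (rule r)
        qed
        ultimately show ?thesis unfolding W_def I_def by auto
      qed
      then show "x \<in> (\<Union>n. Z n)" unfolding Z_def by auto
    qed
    then have "emeasure \<nu> (U \<inter> {0<..1}) \<le> emeasure \<nu> (\<Union>n. Z n)"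
      by (intro emeasure_mono) auto
    also have "\<dots> = (SUP n. emeasure \<nu> (Z n))"
      by (rule SUP_emeasure_incseq[symmetric]) (auto simp: incseq_def Z_def)
    also have "\<dots> \<le> ennreal e"
    proof (rule SUP_least)
      fix n
      have "emeasure \<nu> (Z n) \<le> emeasure \<nu> (W n)" by (intro emeasure_mono) (auto simp: Z_def)
      then show "emeasure \<nu> (Z n) \<le> ennreal e" using W_small[of n] by order
    qed
    finally show ?thesis .
  qed
  have ac\<nu>: "absolutely_continuous lborel \<nu>"
    unfolding absolutely_continuous_def
  proof
    fix N assume N: "N \<in> null_sets (lborel :: real measure)"
    then have Nm[measurable]: "N \<in> sets borel" and N0: "emeasure lborel N = 0" by (auto simp: null_sets_def)
    have "emeasure \<nu> (N \<inter> {0<..1}) \<le> ennreal e" if "e > 0" for e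
    proof -
      obtain d where "d > 0" and d: "\<And>I (a::nat \<Rightarrow> real) b. disj_family I a b 0 1 \<Longrightarrow> (\<Sum>i\<in>I. b i - a i) < d \<Longrightarrow>
         (\<Sum>i\<in>I. dist (G (b i)) (G (a i))) < e"
        using abs_contD[OF ac \<open>e > 0\<close>] by blast
      \<comment> \<open>Outer regularity covers the null set by an open set short enough for
        \<open>open_small\<close>.\<close>
      obtain U where U: "open U" "N \<subseteq> U" and "emeasure lborel (U - N) < ennreal d"
        using outer_regular_lborel[of N d] \<open>d > 0\<close> by auto
      moreover have "emeasure lborel U \<le> emeasure lborel (U - N) + emeasure lborel N"
        using U by (intro order_trans[OF emeasure_mono emeasure_subadditive]) auto
      ultimately have "emeasure lborel U < ennreal d" using N0 by auto
      have "emeasure \<nu> (N \<inter> {0<..1}) \<le> emeasure \<nu> (U \<inter> {0<..1})"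
        using U by (intro emeasure_mono) auto
      also have "\<dots> \<le> ennreal e"
        by (rule open_small[OF U(1) \<open>e > 0\<close> \<open>d > 0\<close> \<open>emeasure lborel U < ennreal d\<close> d])
      finally show ?thesis .
    qed
    then have "emeasure \<nu> (N \<inter> {0<..1}) \<le> 0 + ennreal e" if "e > 0" for e
      using that by simp
    then have "emeasure \<nu> (N \<inter> {0<..1}) \<le> 0" by (rule ennreal_le_epsilon)
    then have "N \<inter> {0<..1} \<in> null_sets \<nu>" by (auto intro!: null_setsI)
    then have "({..0} \<union> {1<..}) \<union> (N \<inter> {0<..1}) \<in> null_sets \<nu>" using lonull hinull by blast
    then show "N \<in> null_sets \<nu>" by (rule null_sets_subset) auto
  qed
  obtain h where h[measurable]: "h \<in> borel_measurable lborel" and dens: "density lborel h = \<nu>"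
    using sigma_finite_measure.Radon_Nikodym[OF sigma_finite_lborel ac\<nu>] by auto
  have hI: "(\<integral>\<^sup>+ x. h x * indicator {a<..b} x \<partial>lborel) = ennreal (G b - G a)" if "a \<le> b" for a b
    using Ioc[OF that] unfolding dens[symmetric] by (simp add: emeasure_density)
  have hfin: "AE x in lborel. h x < \<infinity>"
  proof -
    have "(\<integral>\<^sup>+ x. h x \<partial>lborel) = emeasure \<nu> UNIV"
      unfolding dens[symmetric] by (simp add: emeasure_density)
    also have "UNIV = {..0} \<union> {1<..} \<union> {0<..(1::real)}" by auto
    also have "emeasure \<nu> \<dots> \<le> emeasure \<nu> ({..0} \<union> {1<..}) + emeasure \<nu> {0<..1}"
      by (intro emeasure_subadditive) auto
    also have "emeasure \<nu> ({..0} \<union> {1<..}) = 0" using lonull hinull by (meson null_setsD1 null_sets.Un)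
    finally have "(\<integral>\<^sup>+ x. h x \<partial>lborel) \<noteq> \<infinity>" using Ioc[of 0 1] by (auto simp: top_unique)
    from nn_integral_PInf_AE[OF h this] show ?thesis by (simp add: less_top)
  qed
  \<comment> \<open>\<open>h\<close> may be infinite on a null set, where \<open>enn2real\<close>
    returns 0.\<close>
  define g where "g x = enn2real (h x)" for x
  have [measurable]: "g \<in> borel_measurable borel" unfolding g_def using h by measurable
  have "(g has_integral G b - G a) {a..b}" if "a \<le> b" for a b
  proof -
    have "(\<integral>\<^sup>+ x. ennreal (g x * indicator {a..b} x) \<partial>lborel) = (\<integral>\<^sup>+ x. h x * indicator {a<..b} x \<partial>lborel)"
    proof (rule nn_integral_cong_AE)
      have "AE x in lborel. x \<noteq> a" by (rule AE_lborel_singleton)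
      with hfin show "AE x in lborel. ennreal (g x * indicator {a..b} x) = h x * indicator {a<..b} x"
      proof eventually_elim
        case (elim x)
        then show ?case by (auto simp: g_def indicator_def less_top)
      qed
    qed
    also have "\<dots> = ennreal (G b - G a)" using hI[OF that] .
    finally have "((\<lambda>x. g x * indicator {a..b} x) has_integral G b - G a) UNIV"
      by (intro nn_integral_has_integral) (auto simp: g_def mG[OF that])
    moreover have "(\<lambda>x. g x * indicator {a..b} x) = (\<lambda>x. if x \<in> {a..b} then g x else 0)"
      by (auto simp: indicator_def)
    ultimately show ?thesis by (simp only: has_integral_restrict_UNIV)
  qed
  with \<open>g \<in> borel_measurable borel\<close> show ?thesis by (intro that[of g]) (auto simp: g_def)
qed

text \<open>Clamping the argument to [0, 1] produces a globally monotone function that is constant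
  outside, as the density lemma requires, without changing derivatives in (0, 1).\<close>

lemma mono_abs_cont_has_derivative_ae:
  fixes F :: "real \<Rightarrow> real"
  assumes mono: "\<And>s t. 0 \<le> s \<Longrightarrow> s \<le> t \<Longrightarrow> t \<le> 1 \<Longrightarrow> F s \<le> F t" and ac: "abs_cont F"
  obtains g N where "g \<in> borel_measurable borel" "g absolutely_integrable_on {0..1}"
    "(g has_integral F 1 - F 0) {0..1}"
    "negligible N" "\<And>x. x \<in> {0<..<1} - N \<Longrightarrow> (F has_real_derivative g x) (at x)"
proof -
  define G where "G x = F (max 0 (min 1 x))" for x
  have GF: "G x = F x" if "x \<in> {0..1}" for x using that by (simp add: G_def)
  have 1: "mono G" unfolding G_def by (intro monoI mono) (auto simp: max_def min_def)
  have 2: "abs_cont G" by (rule abs_cont_lipschitz_comp[OF ac, of _ 1]) (simp add: GF)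
  have lo: "G x = G 0" if "x \<le> 0" for x using that by (simp add: G_def)
  have hi: "G x = G 1" if "x \<ge> 1" for x using that by (simp add: G_def)
  obtain g where g: "g \<in> borel_measurable borel" "\<And>x. g x \<ge> 0"
    and I: "\<And>a b. a \<le> b \<Longrightarrow> (g has_integral G b - G a) {a..b}"
    using mono_abs_cont_density[OF 1 2 lo hi] by blast
  obtain N where N: "negligible N" and D: "\<And>x. x \<notin> N \<Longrightarrow> (G has_real_derivative g x) (at x)"
    using indefinite_integral_has_derivative_ae[OF I] by blast
  show ?thesis
  proof (rule that[OF g(1) _ _ N])
    show I': "(g has_integral F 1 - F 0) {0..1}" using I[of 0 1] GF by simp
    show "g absolutely_integrable_on {0..1}"
      using I' g(2) by (intro nonnegative_absolutely_integrable_1) (auto simp: integrable_on_def)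
    fix x assume x: "x \<in> {0<..<1} - N"
    have "eventually (\<lambda>y. y \<in> {0<..<1::real}) (nhds x)"
      using x by (intro eventually_nhds_in_open) auto
    then have "eventually (\<lambda>y. G y = F y) (nhds x)"
      by eventually_elim (simp add: GF)
    with D[of x] x show "(F has_real_derivative g x) (at x)"
      by (metis DERIV_cong_ev DiffD2)
  qed
qed

text \<open>Jordan decomposition: f = V - (V - f) with \<open>V\<close> the variation from 0. Both
  terms are absolutely continuous and nondecreasing because an increment of \<open>f\<close> never
  exceeds that of \<open>V\<close>.\<close>

theorem abs_cont_has_derivative_ae:
  fixes f :: "real \<Rightarrow> real"
  assumes f: "abs_cont f"
  shows "\<exists>g N. g \<in> borel_measurable borel \<and> g absolutely_integrable_on {0..1} \<and>
    (g has_integral f 1 - f 0) {0..1} \<and> negligible N \<and>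
    (\<forall>x\<in>{0<..<1} - N. (f has_real_derivative g x) (at x))"
proof -
  define V where "V = variation f 0"
  have V: "abs_cont V" unfolding V_def by (rule variation_abs_cont[OF f])
  have le: "\<bar>f t - f s\<bar> \<le> V t - V s" if "0 \<le> s" "s \<le> t" "t \<le> 1" for s t
    using variation_add[OF f order_refl that] dist_le_variation[OF f that] by (simp add: V_def dist_real_def)
  obtain g N where g: "g \<in> borel_measurable borel" "g absolutely_integrable_on {0..1}"
    "(g has_integral V 1 - V 0) {0..1}" "negligible N"
    "\<And>x. x \<in> {0<..<1} - N \<Longrightarrow> (V has_real_derivative g x) (at x)"
    by (rule mono_abs_cont_has_derivative_ae[of V]) (use le V in \<open>auto simp: abs_le_iff, smt (verit)\<close>)
  have ac': "abs_cont (\<lambda>x. V x - f x)" by (rule abs_cont_diff[OF V f])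
  obtain h M where h: "h \<in> borel_measurable borel" "h absolutely_integrable_on {0..1}"
    "(h has_integral (V 1 - f 1) - (V 0 - f 0)) {0..1}" "negligible M"
    "\<And>x. x \<in> {0<..<1} - M \<Longrightarrow> ((\<lambda>x. V x - f x) has_real_derivative h x) (at x)"
    by (rule mono_abs_cont_has_derivative_ae[of "\<lambda>x. V x - f x"]) (use le ac' in \<open>auto simp: abs_le_iff, smt (verit)\<close>)
  show ?thesis
  proof (intro exI[of _ "\<lambda>x. g x - h x"] exI[of _ "N \<union> M"] conjI ballI)
    show "((\<lambda>x. g x - h x) has_integral f 1 - f 0) {0..1}"
      using has_integral_diff[OF g(3) h(3)] by simp
    fix x assume "x \<in> {0<..<1} - (N \<union> M)"
    then show "(f has_real_derivative g x - h x) (at x)"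
      using DERIV_diff[OF g(5)[of x] h(5)[of x]] by simp
  qed (use g h in \<open>auto intro!: borel_measurable_diff set_integral_diff\<close>)
qed

section \<open>Optical length and calibrations\<close>

text \<open>The residue modulo 2 is the fractional part plus the parity of the floor. This replaces
  the period square by parities, in which cells are indexed.\<close>

lemma mod_two_residue:
  fixes X :: real
  defines "u \<equiv> X - 2 * of_int \<lfloor>X / 2\<rfloor>"
  shows "0 < u \<and> u < 1 \<longleftrightarrow> X \<notin> \<int> \<and> even \<lfloor>X\<rfloor>" "1 < u \<and> u < 2 \<longleftrightarrow> X \<notin> \<int> \<and> odd \<lfloor>X\<rfloor>"
proof -
  have f: "\<lfloor>X / 2\<rfloor> = \<lfloor>X\<rfloor> div 2" using floor_divide_real_eq_div[of 2 X] by simp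
  have "\<lfloor>X\<rfloor> = 2 * (\<lfloor>X\<rfloor> div 2) + \<lfloor>X\<rfloor> mod 2" by simp
  then have "real_of_int \<lfloor>X\<rfloor> = real_of_int (2 * (\<lfloor>X\<rfloor> div 2) + \<lfloor>X\<rfloor> mod 2)" by (rule arg_cong)
  then have "real_of_int \<lfloor>X\<rfloor> = 2 * of_int (\<lfloor>X\<rfloor> div 2) + of_int (\<lfloor>X\<rfloor> mod 2)"
    by (simp only: of_int_add of_int_mult of_int_numeral)
  then have u: "u = X - of_int \<lfloor>X\<rfloor> + of_int (\<lfloor>X\<rfloor> mod 2)" unfolding u_def f by linarith
  have I: "X \<in> \<int> \<longleftrightarrow> X - of_int \<lfloor>X\<rfloor> = 0"
    by (metis Ints_cases Ints_of_int eq_iff_diff_eq_0 floor_of_int)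
  have b: "0 \<le> X - of_int \<lfloor>X\<rfloor>" "X - of_int \<lfloor>X\<rfloor> < 1" by linarith+
  show "0 < u \<and> u < 1 \<longleftrightarrow> X \<notin> \<int> \<and> even \<lfloor>X\<rfloor>" "1 < u \<and> u < 2 \<longleftrightarrow> X \<notin> \<int> \<and> odd \<lfloor>X\<rfloor>"
    using u b unfolding I by (cases "even \<lfloor>X\<rfloor>"; simp add: even_iff_mod_2_eq_zero odd_iff_mod_2_eq_one; linarith)+
qed

lemma chess_a_eq:
  "chess_a \<beta> P = (if fst P \<notin> \<int> \<and> snd P \<notin> \<int> \<and> odd (\<lfloor>fst P\<rfloor> + \<lfloor>snd P\<rfloor>) then \<beta> else 1)"
  unfolding chess_a_def Let_def mod_two_residue
  using mod_two_residue[of "fst P"] mod_two_residue[of "snd P"] by auto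

lemma chess_a_measurable[measurable]: "chess_a \<beta> \<in> borel_measurable borel"
  unfolding chess_a_def[abs_def] Let_def borel_prod[symmetric] by measurable

lemma chess_a_bounds:
  assumes "1 \<le> \<beta>"
  shows "1 \<le> chess_a \<beta> P" "chess_a \<beta> P \<le> \<beta>"
  using assms by (auto simp: chess_a_eq)

text \<open>Closed squares, so that every grid edge lies in exactly one light square
  (\<open>i + j\<close> even) besides a dark one.\<close>

definition cell :: "int \<Rightarrow> int \<Rightarrow> (real \<times> real) set" where
  "cell i j = {of_int i..of_int (i + 1)} \<times> {of_int j..of_int (j + 1)}"

lemma floor_eq_of_nonint: "x \<notin> \<int> \<Longrightarrow> of_int i \<le> x \<Longrightarrow> x \<le> of_int (i + 1) \<Longrightarrow> \<lfloor>x\<rfloor> = i"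
  by (rule floor_unique) (auto simp: less_le)

lemma chess_a_light_cell:
  assumes "even (i + j)" "P \<in> cell i j"
  shows "chess_a \<beta> P = 1"
proof (rule ccontr)
  assume "chess_a \<beta> P \<noteq> 1"
  then have "fst P \<notin> \<int>" "snd P \<notin> \<int>" "odd (\<lfloor>fst P\<rfloor> + \<lfloor>snd P\<rfloor>)"
    by (auto simp: chess_a_eq split: if_splits)
  moreover have "\<lfloor>fst P\<rfloor> = i" "\<lfloor>snd P\<rfloor> = j"
    using assms calculation by (auto simp: cell_def intro!: floor_eq_of_nonint)
  ultimately show False using assms by simp
qed

lemma abs_cont_component:
  assumes "abs_cont u"
  shows "abs_cont (\<lambda>t. fst (u t) :: real)" "abs_cont (\<lambda>t. snd (u t) :: real)"
  by (rule abs_cont_lipschitz_comp[OF assms, of _ 1]; simp add: dist_fst_le dist_snd_le)+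

text \<open>Two default values could spoil \<open>optical_length\<close>: that of
  \<open>vector_derivative\<close> at points without a derivative, and that of
  \<open>integral\<close> for a non-integrable function. Almost everywhere differentiability with
  integrable derivatives excludes both, and the derivatives become explicit functions.\<close>

lemma optical_length_integral:
  fixes u :: "real \<Rightarrow> real \<times> real"
  assumes u: "abs_cont u" and "1 \<le> \<beta>"
  shows "\<exists>gx gy N. negligible N \<and>
    (\<forall>t\<in>{0<..<1} - N. ((\<lambda>t. fst (u t)) has_real_derivative gx t) (at t)) \<and>
    (\<forall>t\<in>{0<..<1} - N. ((\<lambda>t. snd (u t)) has_real_derivative gy t) (at t)) \<and>
    ((\<lambda>t. chess_a \<beta> (u t) * norm (gx t, gy t)) has_integral optical_length \<beta> u) {0..1}"
proof -
  obtain gx N where gx: "gx \<in> borel_measurable borel" "gx absolutely_integrable_on {0..1}" "negligible N"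
    "\<forall>t\<in>{0<..<1} - N. ((\<lambda>t. fst (u t)) has_real_derivative gx t) (at t)"
    using abs_cont_has_derivative_ae[OF abs_cont_component(1)[OF u]] by (elim exE conjE)
  obtain gy M where gy: "gy \<in> borel_measurable borel" "gy absolutely_integrable_on {0..1}" "negligible M"
    "\<forall>t\<in>{0<..<1} - M. ((\<lambda>t. snd (u t)) has_real_derivative gy t) (at t)"
    using abs_cont_has_derivative_ae[OF abs_cont_component(2)[OF u]] by (elim exE conjE)
  let ?f = "\<lambda>t. chess_a \<beta> (u t) * norm (gx t, gy t)"
  have cu: "continuous_on {0..1} u" by (rule abs_cont_imp_continuous_on[OF u])
  have "?f absolutely_integrable_on {0..1}"
  proof (rule measurable_bounded_by_integrable_imp_absolutely_integrable)
    have "u \<in> borel_measurable (lebesgue_on {0..1})"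
      using cu by (rule continuous_imp_measurable_on_sets_lebesgue) simp
    from measurable_compose[OF this chess_a_measurable]
    have 1: "(\<lambda>t. chess_a \<beta> (u t)) \<in> borel_measurable (lebesgue_on {0..1})" .
    have "(\<lambda>t. (gx t, gy t)) \<in> borel_measurable borel"
      using gx(1) gy(1) by (rule borel_measurable_Pair)
    then have "(\<lambda>t. norm (gx t, gy t)) \<in> borel_measurable borel" by measurable
    then have 2: "(\<lambda>t. norm (gx t, gy t)) \<in> borel_measurable (lebesgue_on {0..1})"
      by (intro measurable_restrict_space1) (auto intro: measurable_completion)
    show "?f \<in> borel_measurable (lebesgue_on {0..1})"
      by (rule borel_measurable_times[OF 1 2])
    have "(\<lambda>t. \<bar>gx t\<bar>) integrable_on {0..1}" "(\<lambda>t. \<bar>gy t\<bar>) integrable_on {0..1}"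
      using gx(2) gy(2) unfolding absolutely_integrable_on_def by auto
    then show "(\<lambda>t. \<beta> * (\<bar>gx t\<bar> + \<bar>gy t\<bar>)) integrable_on {0..1}"
      by (intro integrable_on_mult_right integrable_add)
    fix t
    show "norm (?f t) \<le> \<beta> * (\<bar>gx t\<bar> + \<bar>gy t\<bar>)"
      using chess_a_bounds[OF \<open>1 \<le> \<beta>\<close>, of "u t"] norm_Pair_le[of "gx t" "gy t"] \<open>1 \<le> \<beta>\<close>
      by (simp add: abs_mult) (intro mult_mono, auto)
  qed simp
  then have int: "?f integrable_on {0..1}" by (simp add: absolutely_integrable_on_def)
  have "(?f has_integral optical_length \<beta> u) {0..1}"
  proof -
    have "optical_length \<beta> u = integral {0..1} ?f"
      unfolding optical_length_def
    proof (rule integral_spike[symmetric])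
      show "negligible (N \<union> M \<union> {0, 1})" using gx(3) gy(3) by (simp add: negligible_Un_eq)
      fix t assume "t \<in> {0..1} - (N \<union> M \<union> {0, 1})"
      then have "t \<in> {0<..<1} - N" "t \<in> {0<..<1} - M" by auto
      then have "((\<lambda>t. (fst (u t), snd (u t))) has_vector_derivative (gx t, gy t)) (at t)"
        using gx(4) gy(4) by (intro has_vector_derivative_Pair) (auto simp: has_real_derivative_iff_has_vector_derivative)
      then show "chess_a \<beta> (u t) * norm (vector_derivative u (at t)) = ?f t"
        by (simp add: vector_derivative_at)
    qed
    with int show ?thesis by (simp add: integrable_integral)
  qed
  then show ?thesis using gx gy
    by (intro exI[of _ gx] exI[of _ gy] exI[of _ "N \<union> M"] conjI) (auto simp: negligible_Un_eq)
qed

text \<open>The triangle inequality through the integers between the two points; it carries bounds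
  from cells to whole lines.\<close>

lemma int_lipschitz_imp_lipschitz:
  fixes f :: "real \<Rightarrow> real"
  assumes L: "\<And>(k::int) x y. x \<in> {of_int k..of_int (k+1)} \<Longrightarrow> y \<in> {of_int k..of_int (k+1)} \<Longrightarrow> \<bar>f x - f y\<bar> \<le> L * \<bar>x - y\<bar>"
  shows "\<bar>f x - f y\<bar> \<le> L * \<bar>x - y\<bar>"
proof -
  have *: "x \<le> y \<Longrightarrow> y \<le> of_int (\<lfloor>x\<rfloor> + 1) + real n \<Longrightarrow> \<bar>f x - f y\<bar> \<le> L * \<bar>x - y\<bar>" for n x y
  proof (induction n arbitrary: y)
    case 0
    have "of_int \<lfloor>x\<rfloor> \<le> x" "x \<le> of_int \<lfloor>x\<rfloor> + 1" by linarith+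
    with 0 have "of_int \<lfloor>x\<rfloor> \<le> y" by linarith
    with 0 \<open>of_int \<lfloor>x\<rfloor> \<le> x\<close> \<open>x \<le> of_int \<lfloor>x\<rfloor> + 1\<close> show ?case by (intro L[of _ "\<lfloor>x\<rfloor>"]) auto
  next
    case (Suc n)
    let ?z = "of_int (\<lfloor>x\<rfloor> + 1) + real n"
    have xz: "x \<le> ?z" by linarith
    show ?case
    proof (cases "y \<le> ?z")
      case True
      with Suc show ?thesis by blast
    next
      case False
      have "\<bar>f x - f ?z\<bar> \<le> L * \<bar>x - ?z\<bar>" by (rule Suc.IH) (use xz in auto)
      moreover have "\<bar>f ?z - f y\<bar> \<le> L * \<bar>?z - y\<bar>"
        by (rule L[of _ "\<lfloor>x\<rfloor> + 1 + int n"]) (use False Suc.prems in auto)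
      moreover have "\<bar>x - y\<bar> = \<bar>x - ?z\<bar> + \<bar>?z - y\<bar>" using False xz by linarith
      ultimately show ?thesis by (simp only: distrib_left) linarith
    qed
  qed
  have **: "\<bar>f x - f y\<bar> \<le> L * \<bar>x - y\<bar>" if "x \<le> y" for x y
  proof -
    obtain n where "y \<le> real n + of_int (\<lfloor>x\<rfloor> + 1)" using real_arch_simple[of "y - of_int (\<lfloor>x\<rfloor> + 1)"] by (auto simp: field_simps)
    with that show ?thesis by (intro *[of x y n]) (auto simp: add.commute)
  qed
  show ?thesis using **[of x y] **[of y x] by (cases "x \<le> y") (auto simp: abs_minus_commute)
qed

text \<open>\<open>H\<close> will be a multiple of the distance inside a square, and a bound with
  different weights along and across the line on the grid.\<close>

lemma deriv_abs_le:
  assumes F: "(F has_real_derivative D) (at t)"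
    and ev: "eventually (\<lambda>s. \<bar>F s - F t\<bar> \<le> H s) (at t)"
    and H: "((\<lambda>s. H s / \<bar>s - t\<bar>) \<longlongrightarrow> b) (at t)"
  shows "\<bar>D\<bar> \<le> b"
proof (rule tendsto_le[OF _ H])
  show "((\<lambda>s. \<bar>(F s - F t) / (s - t)\<bar>) \<longlongrightarrow> \<bar>D\<bar>) (at t)"
    using F unfolding has_field_derivative_iff by (rule tendsto_rabs)
  show "eventually (\<lambda>s. \<bar>(F s - F t) / (s - t)\<bar> \<le> H s / \<bar>s - t\<bar>) (at t)"
    using ev by eventually_elim (simp add: divide_right_mono)
qed simp

text \<open>Balls of half the isolation radius are pairwise disjoint open sets, hence countably
  many.\<close>

lemma countable_isolated:
  fixes A :: "real set"
  assumes "\<And>t. t \<in> A \<Longrightarrow> \<exists>e>0. \<forall>s\<in>A. s \<noteq> t \<longrightarrow> e \<le> \<bar>s - t\<bar>"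
  shows "countable A"
proof -
  obtain e where e: "\<And>t. t \<in> A \<Longrightarrow> e t > 0" "\<And>t s. t \<in> A \<Longrightarrow> s \<in> A \<Longrightarrow> s \<noteq> t \<Longrightarrow> e t \<le> \<bar>s - t\<bar>"
    using assms by metis
  define B where "B t = ball t (e t / 2)" for t
  have disj: "B t \<inter> B s = {}" if "t \<in> A" "s \<in> A" "s \<noteq> t" for s t
  proof (rule ccontr)
    assume "B t \<inter> B s \<noteq> {}"
    then obtain x where "\<bar>t - x\<bar> < e t / 2" "\<bar>s - x\<bar> < e s / 2" by (auto simp: B_def dist_real_def)
    moreover have "e t \<le> \<bar>s - t\<bar>" "e s \<le> \<bar>t - s\<bar>" using e(2) that by auto
    ultimately show False by linarith
  qed
  have "countable (B ` A)"
    by (rule countable_disjoint_open_subsets) (use disj in \<open>auto simp: B_def pairwise_def disjnt_def\<close>)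
  moreover have "inj_on B A"
  proof (rule inj_onI, rule ccontr)
    fix s t assume "s \<in> A" "t \<in> A" "B s = B t" "s \<noteq> t"
    then have "B s = {}" using disj by blast
    then show False using e(1)[OF \<open>s \<in> A\<close>] by (simp add: B_def)
  qed
  ultimately show ?thesis by (rule countable_image_inj_on)
qed

text \<open>For each grid line the transversal crossing times are isolated points of the set of hitting times.\<close>

lemma countable_transversal_crossings:
  fixes h g :: "real \<Rightarrow> real"
  shows "countable {t. h t \<in> \<int> \<and> g t \<noteq> 0 \<and> (h has_real_derivative g t) (at t)}"
proof -
  have "countable {t. h t = c \<and> g t \<noteq> 0 \<and> (h has_real_derivative g t) (at t)}" for c
  proof (rule countable_isolated)
    fix t assume "t \<in> {t. h t = c \<and> g t \<noteq> 0 \<and> (h has_real_derivative g t) (at t)}"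
    then have c: "h t = c" "g t \<noteq> 0" and d: "(h has_real_derivative g t) (at t)" by auto
    from d have "((\<lambda>s. (h s - h t) / (s - t)) \<longlongrightarrow> g t) (at t)" by (simp add: has_field_derivative_iff)
    from tendsto_imp_eventually_ne[OF this c(2)]
    obtain e where "e > 0" and e: "\<And>s. s \<noteq> t \<Longrightarrow> dist s t < e \<Longrightarrow> (h s - h t) / (s - t) \<noteq> 0"
      unfolding eventually_at by auto
    have "e \<le> \<bar>s - t\<bar>" if "h s = c" "s \<noteq> t" for s
      using e[of s] that c by (force simp: dist_real_def)
    with \<open>e > 0\<close> show "\<exists>e>0. \<forall>s\<in>{t. h t = c \<and> g t \<noteq> 0 \<and> (h has_real_derivative g t) (at t)}. s \<noteq> t \<longrightarrow> e \<le> \<bar>s - t\<bar>"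
      by blast
  qed
  then have "countable (\<Union>k::int. {t. h t = of_int k \<and> g t \<noteq> 0 \<and> (h has_real_derivative g t) (at t)})"
    by blast
  moreover have "{t. h t \<in> \<int> \<and> g t \<noteq> 0 \<and> (h has_real_derivative g t) (at t)} =
      (\<Union>k::int. {t. h t = of_int k \<and> g t \<noteq> 0 \<and> (h has_real_derivative g t) (at t)})"
    by (auto elim: Ints_cases)
  ultimately show ?thesis by simp
qed

lemma mem_cell: "(x, y) \<in> cell i j \<longleftrightarrow> of_int i \<le> x \<and> x \<le> of_int (i + 1) \<and> of_int j \<le> y \<and> y \<le> of_int (j + 1)"
  by (auto simp: cell_def)

lemma has_integral_le_AE:
  fixes f g :: "real \<Rightarrow> real"
  assumes f: "(f has_integral i) S" and g: "(g has_integral j) S" and N: "negligible N"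
    and le: "\<And>x. x \<in> S - N \<Longrightarrow> f x \<le> g x"
  shows "i \<le> j"
proof -
  have "((\<lambda>x. if x \<in> N then g x else f x) has_integral i) S"
    by (rule has_integral_spike[OF N _ f]) auto
  then show ?thesis using g by (rule has_integral_le) (use le in auto)
qed

text \<open>\<open>c\<close> may be smaller than the dark coefficient of the board; this is how all \<open>\<beta> \<ge> \<beta>\<^sub>0\<^sup>c\<close> are
handled by the calibration at \<open>\<beta>\<^sub>0\<^sup>c\<close>.\<close>

locale calibration =
  fixes \<Phi> :: "real \<times> real \<Rightarrow> real" and c :: real
  assumes light: "\<And>i j P Q. even (i + j) \<Longrightarrow> P \<in> cell i j \<Longrightarrow> Q \<in> cell i j \<Longrightarrow> \<bar>\<Phi> P - \<Phi> Q\<bar> \<le> dist P Q"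
    and dark: "\<And>i j P Q. odd (i + j) \<Longrightarrow> P \<in> cell i j \<Longrightarrow> Q \<in> cell i j \<Longrightarrow> \<bar>\<Phi> P - \<Phi> Q\<bar> \<le> c * dist P Q"
    and c1: "1 \<le> c"
begin

lemma cell_lipschitz: "P \<in> cell i j \<Longrightarrow> Q \<in> cell i j \<Longrightarrow> \<bar>\<Phi> P - \<Phi> Q\<bar> \<le> c * dist P Q"
proof (cases "even (i + j)")
  case True
  assume "P \<in> cell i j" "Q \<in> cell i j"
  with True have "\<bar>\<Phi> P - \<Phi> Q\<bar> \<le> 1 * dist P Q" by (simp add: light)
  also have "\<dots> \<le> c * dist P Q" using c1 by (intro mult_right_mono) auto
  finally show ?thesis .
qed (rule dark)

lemma lipschitz_horizontal: "\<bar>\<Phi> (x, y) - \<Phi> (x', y)\<bar> \<le> c * \<bar>x - x'\<bar>"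
proof (rule int_lipschitz_imp_lipschitz)
  fix k :: int and a b :: real assume "a \<in> {of_int k..of_int (k+1)}" "b \<in> {of_int k..of_int (k+1)}"
  moreover have "of_int \<lfloor>y\<rfloor> \<le> y" "y \<le> of_int \<lfloor>y\<rfloor> + 1" by linarith+
  ultimately have "\<bar>\<Phi> (a, y) - \<Phi> (b, y)\<bar> \<le> c * dist (a, y) (b, y)"
    by (intro cell_lipschitz[of _ k "\<lfloor>y\<rfloor>"]) (auto simp: mem_cell)
  then show "\<bar>\<Phi> (a, y) - \<Phi> (b, y)\<bar> \<le> c * \<bar>a - b\<bar>" by (simp add: dist_Pair_Pair dist_real_def)
qed

lemma lipschitz_vertical: "\<bar>\<Phi> (x, y) - \<Phi> (x, y')\<bar> \<le> c * \<bar>y - y'\<bar>"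
proof (rule int_lipschitz_imp_lipschitz)
  fix k :: int and a b :: real assume "a \<in> {of_int k..of_int (k+1)}" "b \<in> {of_int k..of_int (k+1)}"
  moreover have "of_int \<lfloor>x\<rfloor> \<le> x" "x \<le> of_int \<lfloor>x\<rfloor> + 1" by linarith+
  ultimately have "\<bar>\<Phi> (x, a) - \<Phi> (x, b)\<bar> \<le> c * dist (x, a) (x, b)"
    by (intro cell_lipschitz[of _ "\<lfloor>x\<rfloor>" k]) (auto simp: mem_cell)
  then show "\<bar>\<Phi> (x, a) - \<Phi> (x, b)\<bar> \<le> c * \<bar>a - b\<bar>" by (simp add: dist_Pair_Pair dist_real_def)
qed

text \<open>Each unit edge borders a light square, above or below according to the parity of
  \<open>k + j\<close>, so the dark constant never enters.\<close>

lemma lipschitz_horizontal_grid: "\<bar>\<Phi> (x, of_int j) - \<Phi> (x', of_int j)\<bar> \<le> \<bar>x - x'\<bar>"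
proof -
  have "\<bar>\<Phi> (x, of_int j) - \<Phi> (x', of_int j)\<bar> \<le> 1 * \<bar>x - x'\<bar>"
  proof (rule int_lipschitz_imp_lipschitz)
    fix k :: int and a b :: real assume ab: "a \<in> {of_int k..of_int (k+1)}" "b \<in> {of_int k..of_int (k+1)}"
    define l where "l = (if even (k + j) then j else j - 1)"
    have "even (k + l)" by (simp add: l_def)
    then have "\<bar>\<Phi> (a, of_int j) - \<Phi> (b, of_int j)\<bar> \<le> dist (a, of_int j :: real) (b, of_int j)"
      by (rule light) (use ab in \<open>auto simp: mem_cell l_def\<close>)
    then show "\<bar>\<Phi> (a, of_int j) - \<Phi> (b, of_int j)\<bar> \<le> 1 * \<bar>a - b\<bar>" by (simp add: dist_Pair_Pair dist_real_def)
  qed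
  then show ?thesis by simp
qed

lemma lipschitz_vertical_grid: "\<bar>\<Phi> (of_int i, y) - \<Phi> (of_int i, y')\<bar> \<le> \<bar>y - y'\<bar>"
proof -
  have "\<bar>\<Phi> (of_int i, y) - \<Phi> (of_int i, y')\<bar> \<le> 1 * \<bar>y - y'\<bar>"
  proof (rule int_lipschitz_imp_lipschitz)
    fix k :: int and a b :: real assume ab: "a \<in> {of_int k..of_int (k+1)}" "b \<in> {of_int k..of_int (k+1)}"
    define l where "l = (if even (i + k) then i else i - 1)"
    have "even (l + k)" by (simp add: l_def)
    then have "\<bar>\<Phi> (of_int i, a) - \<Phi> (of_int i, b)\<bar> \<le> dist (of_int i :: real, a) (of_int i, b)"
      by (rule light) (use ab in \<open>auto simp: mem_cell l_def\<close>)
    then show "\<bar>\<Phi> (of_int i, a) - \<Phi> (of_int i, b)\<bar> \<le> 1 * \<bar>a - b\<bar>" by (simp add: dist_Pair_Pair dist_real_def)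
  qed
  then show ?thesis by simp
qed

text \<open>Moving to the grid line first and then along it charges \<open>c\<close> only to the
  displacement across the line, which drops out when the normal derivative is zero.\<close>

lemma split_horizontal_first:
  "\<bar>\<Phi> (x', y') - \<Phi> (x, of_int j)\<bar> \<le> c * \<bar>y' - of_int j\<bar> + \<bar>x' - x\<bar>"
  using lipschitz_vertical[of x' y' "of_int j"] lipschitz_horizontal_grid[of x' j x] by linarith

lemma split_vertical_first:
  "\<bar>\<Phi> (x', y') - \<Phi> (of_int i, y)\<bar> \<le> c * \<bar>x' - of_int i\<bar> + \<bar>y' - y\<bar>"
  using lipschitz_horizontal[of x' y' "of_int i"] lipschitz_vertical_grid[of i y' y] by linarith

text \<open>A crude constant suffices: this only has to make \<Phi> \<circ> u absolutely
  continuous.\<close>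

lemma global_lipschitz: "dist (\<Phi> P) (\<Phi> Q) \<le> (2 * c) * dist P Q"
proof -
  obtain x y x' y' where [simp]: "P = (x, y)" "Q = (x', y')" by (cases P, cases Q)
  have "\<bar>x - x'\<bar> \<le> dist P Q" "\<bar>y - y'\<bar> \<le> dist P Q"
    using dist_fst_le[of P Q] dist_snd_le[of P Q] by (simp_all add: dist_real_def)
  then have "c * \<bar>x - x'\<bar> + c * \<bar>y - y'\<bar> \<le> c * dist P Q + c * dist P Q"
    using c1 by (intro add_mono mult_left_mono) auto
  then show ?thesis
    using lipschitz_horizontal[of x y x'] lipschitz_vertical[of x' y y'] by (simp add: dist_real_def)
qed

theorem calibration_le_optical_length:
  assumes u: "abs_cont u" and "c \<le> \<beta>"
  shows "\<Phi> (u 1) - \<Phi> (u 0) \<le> optical_length \<beta> u"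
proof -
  have "1 \<le> \<beta>" using c1 \<open>c \<le> \<beta>\<close> by simp
  obtain gx gy N where N: "negligible N"
    and gx': "\<forall>t\<in>{0<..<1} - N. ((\<lambda>t. fst (u t)) has_real_derivative gx t) (at t)"
    and gy': "\<forall>t\<in>{0<..<1} - N. ((\<lambda>t. snd (u t)) has_real_derivative gy t) (at t)"
    and L: "((\<lambda>t. chess_a \<beta> (u t) * norm (gx t, gy t)) has_integral optical_length \<beta> u) {0..1}"
    using optical_length_integral[OF u \<open>1 \<le> \<beta>\<close>] by (elim exE conjE)
  note gx = bspec[OF gx'] and gy = bspec[OF gy']
  have ac: "abs_cont (\<lambda>t. \<Phi> (u t))"
    by (rule abs_cont_lipschitz_comp[OF u global_lipschitz])
  obtain D M where M: "negligible M" and DI: "(D has_integral \<Phi> (u 1) - \<Phi> (u 0)) {0..1}"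
    and D': "\<forall>t\<in>{0<..<1} - M. ((\<lambda>t. \<Phi> (u t)) has_real_derivative D t) (at t)"
    using abs_cont_has_derivative_ae[OF ac] by (elim exE conjE) (rule that, assumption+)
  note D = bspec[OF D']
  \<comment> \<open>Transversal grid crossings are countable and may be discarded; at every other
    hitting time the velocity component normal to the line is zero.\<close>
  define Z where "Z = {t. fst (u t) \<in> \<int> \<and> gx t \<noteq> 0 \<and> ((\<lambda>t. fst (u t)) has_real_derivative gx t) (at t)}
    \<union> {t. snd (u t) \<in> \<int> \<and> gy t \<noteq> 0 \<and> ((\<lambda>t. snd (u t)) has_real_derivative gy t) (at t)}"
  have "countable Z" unfolding Z_def by (intro countable_Un countable_transversal_crossings)
  then have Z: "negligible Z" 
    by (simp add: negligible_iff_null_sets countable_imp_null_set_lborel null_sets_completionI)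
  have pt: "D t \<le> chess_a \<beta> (u t) * norm (gx t, gy t)" if "t \<in> {0<..<1} - (N \<union> M \<union> Z)" for t
  proof -
    have t: "t \<in> {0<..<1} - N" "t \<in> {0<..<1} - M" "t \<notin> Z" using that by auto
    note dx = gx[OF t(1)] and dy = gy[OF t(1)] and dF = D[OF t(2)]
    obtain x y where xy: "u t = (x, y)" by (cases "u t")
    have qx: "((\<lambda>s. \<bar>fst (u s) - x\<bar> / \<bar>s - t\<bar>) \<longlongrightarrow> \<bar>gx t\<bar>) (at t)"
      using tendsto_rabs[OF dx[unfolded has_field_derivative_iff]] xy by simp
    have qy: "((\<lambda>s. \<bar>snd (u s) - y\<bar> / \<bar>s - t\<bar>) \<longlongrightarrow> \<bar>gy t\<bar>) (at t)"
      using tendsto_rabs[OF dy[unfolded has_field_derivative_iff]] xy by simp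
    have zx: "gx t = 0" if "x \<in> \<int>" using t(3) dx xy that by (auto simp: Z_def)
    have zy: "gy t = 0" if "y \<in> \<int>" using t(3) dy xy that by (auto simp: Z_def)
    show ?thesis
    proof (cases "y \<in> \<int> \<or> x \<in> \<int>")
      case True
      have "\<bar>D t\<bar> \<le> norm (gx t, gy t)"
      \<comment> \<open>Vertices fall under the first case; there one vanishing component is already
        enough.\<close>
      proof (cases "y \<in> \<int>")
        case True
        then obtain j where j: "y = of_int j" by (elim Ints_cases)
        have "\<bar>D t\<bar> \<le> c * \<bar>gy t\<bar> + \<bar>gx t\<bar>"
        proof (rule deriv_abs_le[OF dF])
          show "\<forall>\<^sub>F s in at t. \<bar>\<Phi> (u s) - \<Phi> (u t)\<bar> \<le> c * \<bar>snd (u s) - y\<bar> + \<bar>fst (u s) - x\<bar>"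
            using split_horizontal_first[of "fst (u s)" "snd (u s)" x j for s] by (simp add: xy j)
          show "((\<lambda>s. (c * \<bar>snd (u s) - y\<bar> + \<bar>fst (u s) - x\<bar>) / \<bar>s - t\<bar>) \<longlongrightarrow> c * \<bar>gy t\<bar> + \<bar>gx t\<bar>) (at t)"
            using tendsto_add[OF tendsto_mult_left[OF qy, of c] qx] by (simp add: add_divide_distrib)
        qed
        then show ?thesis using zy[OF True] by (simp add: norm_Pair)
      next
        case False
        with True obtain i where i: "x = of_int i" by (auto elim: Ints_cases)
        have "\<bar>D t\<bar> \<le> c * \<bar>gx t\<bar> + \<bar>gy t\<bar>"
        proof (rule deriv_abs_le[OF dF])
          show "\<forall>\<^sub>F s in at t. \<bar>\<Phi> (u s) - \<Phi> (u t)\<bar> \<le> c * \<bar>fst (u s) - x\<bar> + \<bar>snd (u s) - y\<bar>"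
            using split_vertical_first[of "fst (u s)" "snd (u s)" i y for s] by (simp add: xy i)
          show "((\<lambda>s. (c * \<bar>fst (u s) - x\<bar> + \<bar>snd (u s) - y\<bar>) / \<bar>s - t\<bar>) \<longlongrightarrow> c * \<bar>gx t\<bar> + \<bar>gy t\<bar>) (at t)"
            using tendsto_add[OF tendsto_mult_left[OF qx, of c] qy] by (simp add: add_divide_distrib)
        qed
        then show ?thesis using zx i by (simp add: norm_Pair)
      qed
      moreover have "chess_a \<beta> (u t) = 1" using True xy by (auto simp: chess_a_eq)
      ultimately show ?thesis by simp
    next
      case False
      \<comment> \<open>Off the grid the curve stays in one square near time \<open>t\<close>, so
        the Lipschitz bound of that square applies to the difference quotients.\<close>
      define i j where "i = \<lfloor>x\<rfloor>" and "j = \<lfloor>y\<rfloor>"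
      have "of_int i \<noteq> x" "of_int j \<noteq> y" using False by auto
      then have "of_int i < x" "x < of_int (i + 1)" "of_int j < y" "y < of_int (j + 1)"
        unfolding i_def j_def by linarith+
      then have xin: "x \<in> {of_int i<..<of_int (i + 1)}" and yin: "y \<in> {of_int j<..<of_int (j + 1)}" by auto
      have "isCont (\<lambda>t. fst (u t)) t" "isCont (\<lambda>t. snd (u t)) t" using dx dy DERIV_isCont by blast+
      then have "eventually (\<lambda>s. fst (u s) \<in> {of_int i<..<of_int (i + 1)}) (at t)"
        "eventually (\<lambda>s. snd (u s) \<in> {of_int j<..<of_int (j + 1)}) (at t)"
        unfolding isCont_def using xin yin xy
        by (metis fst_conv open_greaterThanLessThan topological_tendstoD,
            metis snd_conv open_greaterThanLessThan topological_tendstoD)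
      then have ev: "eventually (\<lambda>s. u s \<in> cell i j) (at t)"
      proof eventually_elim
        case (elim s)
        then show ?case by (cases "u s") (auto simp: mem_cell)
      qed
      have ut: "u t \<in> cell i j" using xin yin xy by (auto simp: mem_cell)
      have K: "\<bar>\<Phi> P - \<Phi> (u t)\<bar> \<le> chess_a \<beta> (u t) * dist P (u t)" if P: "P \<in> cell i j" for P
      proof (cases "even (i + j)")
        case True
        then show ?thesis using light[OF True P ut] chess_a_light_cell[OF True ut] by simp
      next
        case odd: False
        have "chess_a \<beta> (u t) = \<beta>" using odd False xy by (simp add: chess_a_eq i_def j_def)
        moreover have "c * dist P (u t) \<le> \<beta> * dist P (u t)" using \<open>c \<le> \<beta>\<close> by (intro mult_right_mono) auto
        ultimately show ?thesis using dark[OF odd P ut] by simp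
      qed
      have "\<bar>D t\<bar> \<le> chess_a \<beta> (u t) * norm (gx t, gy t)"
      proof (rule deriv_abs_le[OF dF])
        show "\<forall>\<^sub>F s in at t. \<bar>\<Phi> (u s) - \<Phi> (u t)\<bar> \<le> chess_a \<beta> (u t) * dist (u s) (u t)"
          using ev by eventually_elim (rule K)
        have "dist (u s) (u t) / \<bar>s - t\<bar> = sqrt ((\<bar>fst (u s) - x\<bar> / \<bar>s - t\<bar>)\<^sup>2 + (\<bar>snd (u s) - y\<bar> / \<bar>s - t\<bar>)\<^sup>2)" for s
          by (simp add: dist_prod_def xy dist_real_def power_divide add_divide_distrib[symmetric] real_sqrt_divide)
        moreover have "((\<lambda>s. sqrt ((\<bar>fst (u s) - x\<bar> / \<bar>s - t\<bar>)\<^sup>2 + (\<bar>snd (u s) - y\<bar> / \<bar>s - t\<bar>)\<^sup>2)) \<longlongrightarrow>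
            sqrt (\<bar>gx t\<bar>\<^sup>2 + \<bar>gy t\<bar>\<^sup>2)) (at t)"
          by (intro tendsto_intros qx qy)
        ultimately have "((\<lambda>s. dist (u s) (u t) / \<bar>s - t\<bar>) \<longlongrightarrow> norm (gx t, gy t)) (at t)"
          by (simp add: norm_Pair)
        from tendsto_mult_left[OF this, of "chess_a \<beta> (u t)"]
        show "((\<lambda>s. chess_a \<beta> (u t) * dist (u s) (u t) / \<bar>s - t\<bar>) \<longlongrightarrow> chess_a \<beta> (u t) * norm (gx t, gy t)) (at t)"
          by simp
      qed
      then show ?thesis by linarith
    qed
  qed
  show ?thesis
  proof (rule has_integral_le_AE[OF DI L])
    show "negligible (N \<union> M \<union> Z \<union> {0, 1})" using N M Z by (simp add: negligible_Un_eq)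
    show "D t \<le> chess_a \<beta> (u t) * norm (gx t, gy t)" if "t \<in> {0..1} - (N \<union> M \<union> Z \<union> {0, 1})" for t
      using that by (intro pt) auto
  qed
qed

end

section \<open>Segments and concatenation of curves\<close>

definition reach :: "real \<Rightarrow> real \<times> real \<Rightarrow> real \<times> real \<Rightarrow> real \<Rightarrow> bool" where
  "reach \<beta> P Q c \<longleftrightarrow> (\<exists>v. abs_cont v \<and> v 0 = P \<and> v 1 = Q \<and> optical_length \<beta> v \<le> c)"

text \<open>An upper bound on the coefficient is enough, so a segment through a dark square can be
  charged the dark coefficient throughout, endpoints included.\<close>

lemma reach_segment:
  assumes "1 \<le> \<beta>" and K: "\<And>t. t \<in> {0..1} \<Longrightarrow> chess_a \<beta> (P + t *\<^sub>R (Q - P)) \<le> K"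
  shows "reach \<beta> P Q (K * dist P Q)"
proof -
  define v where "v t = P + t *\<^sub>R (Q - P)" for t :: real
  have ac: "abs_cont v"
    by (rule abs_cont_lipschitz[of _ "norm (Q - P)"])
       (simp add: v_def dist_norm scaleR_left_diff_distrib[symmetric])
  have dv: "(v has_vector_derivative (Q - P)) (at t)" for t
    unfolding v_def by (auto intro!: derivative_eq_intros)
  obtain gx gy N where N: "negligible N"
    and gx: "\<forall>t\<in>{0<..<1} - N. ((\<lambda>t. fst (v t)) has_real_derivative gx t) (at t)"
    and gy: "\<forall>t\<in>{0<..<1} - N. ((\<lambda>t. snd (v t)) has_real_derivative gy t) (at t)"
    and L: "((\<lambda>t. chess_a \<beta> (v t) * norm (gx t, gy t)) has_integral optical_length \<beta> v) {0..1}"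
    using optical_length_integral[OF ac \<open>1 \<le> \<beta>\<close>] by (elim exE conjE)
  have "optical_length \<beta> v \<le> K * dist P Q"
  proof (rule has_integral_le_AE[OF L])
    show "((\<lambda>t. K * dist P Q) has_integral K * dist P Q) {0..1::real}"
      using has_integral_const_real[of "K * dist P Q" 0 1] by simp
    show "negligible (N \<union> {0, 1})" using N by (simp add: negligible_Un_eq)
    fix t assume "t \<in> {0..1} - (N \<union> {0, 1})"
    then have t: "t \<in> {0<..<1} - N" "t \<in> {0..1}" by auto
    have "((\<lambda>t. (fst (v t), snd (v t))) has_vector_derivative (gx t, gy t)) (at t)"
      using bspec[OF gx t(1)] bspec[OF gy t(1)]
      by (intro has_vector_derivative_Pair) (auto simp: has_real_derivative_iff_has_vector_derivative)
    then have "(gx t, gy t) = Q - P"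
      using vector_derivative_unique_at[OF dv[of t], of "(gx t, gy t)"] by simp
    then show "chess_a \<beta> (v t) * norm (gx t, gy t) \<le> K * dist P Q"
      using K[OF t(2)] by (simp add: v_def dist_norm norm_minus_commute mult_right_mono)
  qed
  then show ?thesis unfolding reach_def using ac by (intro exI[of _ v]) (auto simp: v_def)
qed

lemma abs_cont_join:
  fixes v w :: "real \<Rightarrow> 'a::metric_space"
  assumes v: "abs_cont v" and w: "abs_cont w" and "v 1 = w 0"
  shows "abs_cont (\<lambda>t. if t \<le> 1/2 then v (2 * t) else w (2 * t - 1))" (is "abs_cont ?z")
proof (rule abs_contI)
  fix e :: real assume "e > 0"
  then have "e / 2 > 0" by simp
  obtain d1 where d1: "d1 > 0" "\<And>I (a::nat \<Rightarrow> real) b. disj_family I a b 0 1 \<Longrightarrow> (\<Sum>i\<in>I. b i - a i) < d1 \<Longrightarrow>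
       (\<Sum>i\<in>I. dist (v (b i)) (v (a i))) < e / 2"
    using abs_contD[OF v \<open>e / 2 > 0\<close>] by blast
  obtain d2 where d2: "d2 > 0" "\<And>I (a::nat \<Rightarrow> real) b. disj_family I a b 0 1 \<Longrightarrow> (\<Sum>i\<in>I. b i - a i) < d2 \<Longrightarrow>
       (\<Sum>i\<in>I. dist (w (b i)) (w (a i))) < e / 2"
    using abs_contD[OF w \<open>e / 2 > 0\<close>] by blast
  show "\<exists>d>0. \<forall>n (a::nat \<Rightarrow> real) b. disj_family {..<n} a b 0 1 \<longrightarrow>
     (\<Sum>i<n. b i - a i) < d \<longrightarrow> (\<Sum>i<n. dist (?z (b i)) (?z (a i))) < e"
  \<comment> \<open>Both halves are traversed at double speed, which doubles interval
    lengths.\<close>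
  proof (intro exI[of _ "min d1 d2 / 2"] conjI allI impI)
    fix n and a b :: "nat \<Rightarrow> real"
    assume F: "disj_family {..<n} a b 0 1" and S: "(\<Sum>i<n. b i - a i) < min d1 d2 / 2"
    let ?h = "1 / 2 :: real"
    have h: "0 \<le> ?h" "?h \<le> 1" by simp_all
    note T = disj_family_split[OF F h]
    have pos: "0 \<le> (\<Sum>i<n. min ?h (b i) - min ?h (a i))" "0 \<le> (\<Sum>i<n. max ?h (b i) - max ?h (a i))"
      using disj_familyD(3)[OF T(1)] disj_familyD(3)[OF T(2)] by (auto intro!: sum_nonneg)
    have "(\<Sum>i<n. dist (v (2 * min ?h (b i))) (v (2 * min ?h (a i)))) < e / 2"
    proof (rule d1(2))
      show "disj_family {..<n} (\<lambda>i. 2 * min ?h (a i)) (\<lambda>i. 2 * min ?h (b i)) 0 1"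
        using disj_family_mono_comp[OF T(1), of "\<lambda>x. 2 * x"] by simp
      show "(\<Sum>i<n. 2 * min ?h (b i) - 2 * min ?h (a i)) < d1"
        using T(4) S pos unfolding right_diff_distrib[symmetric] sum_distrib_left[symmetric] by linarith
    qed
    moreover have "?z (min ?h t) = v (2 * min ?h t)" for t by (auto simp: min_def)
    moreover have "(\<Sum>i<n. dist (w (2 * max ?h (b i) - 1)) (w (2 * max ?h (a i) - 1))) < e / 2"
    proof (rule d2(2))
      show "disj_family {..<n} (\<lambda>i. 2 * max ?h (a i) - 1) (\<lambda>i. 2 * max ?h (b i) - 1) 0 1"
        using disj_family_mono_comp[OF T(2), of "\<lambda>x. 2 * x - 1"] by simp
      have "2 * max ?h (b i) - 1 - (2 * max ?h (a i) - 1) = 2 * (max ?h (b i) - max ?h (a i))" for i by simp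
      then show "(\<Sum>i<n. 2 * max ?h (b i) - 1 - (2 * max ?h (a i) - 1)) < d2"
        using T(4) S pos unfolding sum_distrib_left[symmetric] by (simp only: sum_distrib_left[symmetric])
    qed
    moreover have "?z (max ?h t) = w (2 * max ?h t - 1)" for t
    proof (cases "t \<le> ?h")
      case True
      then have "max ?h t = ?h" by simp
      then show ?thesis using \<open>v 1 = w 0\<close> by (simp only:) simp
    qed (simp add: max_def)
    ultimately show "(\<Sum>i<n. dist (?z (b i)) (?z (a i))) < e" using T(3)[of ?z] by simp
  qed (use d1 d2 in auto)
qed

lemma DERIV_affine_comp:
  assumes "(f has_real_derivative D) (at (2 * t + c))"
  shows "((\<lambda>t. f (2 * t + c)) has_real_derivative 2 * D) (at t)"
proof -
  have "((\<lambda>t::real. 2 * t + c) has_real_derivative 2) (at t)" by (auto intro!: derivative_eq_intros)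
  from DERIV_chain2[OF assms this] show ?thesis by (simp add: mult.commute)
qed

text \<open>Almost everywhere the joined curve has twice the velocity of the piece it runs through,
  and the substitutions 2 t and 2 t - 1 absorb this factor.\<close>

lemma reach_trans:
  assumes "1 \<le> \<beta>" "reach \<beta> P Q c" "reach \<beta> Q R d"
  shows "reach \<beta> P R (c + d)"
proof -
  obtain v w where v: "abs_cont v" "v 0 = P" "v 1 = Q" "optical_length \<beta> v \<le> c"
    and w: "abs_cont w" "w 0 = Q" "w 1 = R" "optical_length \<beta> w \<le> d"
    using assms unfolding reach_def by blast
  define z where "z t = (if t \<le> 1/2 then v (2 * t) else w (2 * t - 1))" for t
  have z: "abs_cont z" unfolding z_def[abs_def] by (rule abs_cont_join) (use v w in auto)
  obtain vx vy N1 where N1: "negligible N1"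
    and vx: "\<forall>t\<in>{0<..<1} - N1. ((\<lambda>t. fst (v t)) has_real_derivative vx t) (at t)"
    and vy: "\<forall>t\<in>{0<..<1} - N1. ((\<lambda>t. snd (v t)) has_real_derivative vy t) (at t)"
    and Lv: "((\<lambda>t. chess_a \<beta> (v t) * norm (vx t, vy t)) has_integral optical_length \<beta> v) {0..1}"
    using optical_length_integral[OF v(1) \<open>1 \<le> \<beta>\<close>] by (elim exE conjE)
  obtain wx wy N2 where N2: "negligible N2"
    and wx: "\<forall>t\<in>{0<..<1} - N2. ((\<lambda>t. fst (w t)) has_real_derivative wx t) (at t)"
    and wy: "\<forall>t\<in>{0<..<1} - N2. ((\<lambda>t. snd (w t)) has_real_derivative wy t) (at t)"
    and Lw: "((\<lambda>t. chess_a \<beta> (w t) * norm (wx t, wy t)) has_integral optical_length \<beta> w) {0..1}"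
    using optical_length_integral[OF w(1) \<open>1 \<le> \<beta>\<close>] by (elim exE conjE)
  obtain zx zy N3 where N3: "negligible N3"
    and zx: "\<forall>t\<in>{0<..<1} - N3. ((\<lambda>t. fst (z t)) has_real_derivative zx t) (at t)"
    and zy: "\<forall>t\<in>{0<..<1} - N3. ((\<lambda>t. snd (z t)) has_real_derivative zy t) (at t)"
    and Lz: "((\<lambda>t. chess_a \<beta> (z t) * norm (zx t, zy t)) has_integral optical_length \<beta> z) {0..1}"
    using optical_length_integral[OF z \<open>1 \<le> \<beta>\<close>] by (elim exE conjE)
  define F where "F t = (if t \<le> 1/2 then 2 * (chess_a \<beta> (v (2 * t)) * norm (vx (2 * t), vy (2 * t)))
    else 2 * (chess_a \<beta> (w (2 * t - 1)) * norm (wx (2 * t - 1), wy (2 * t - 1))))" for t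
  have "((\<lambda>t. 2 * (chess_a \<beta> (v (2 * t)) * norm (vx (2 * t), vy (2 * t)))) has_integral optical_length \<beta> v) {0..1/2}"
    using has_integral_mult_right[OF has_integral_affinity'[OF Lv[unfolded box_real(2)[symmetric]], of 2 0], of 2] by simp
  then have F1: "(F has_integral optical_length \<beta> v) {0..1/2}"
    by (rule has_integral_eq[rotated]) (simp add: F_def)
  have "((\<lambda>t. 2 * (chess_a \<beta> (w (2 * t - 1)) * norm (wx (2 * t - 1), wy (2 * t - 1)))) has_integral optical_length \<beta> w) {1/2..1}"
    using has_integral_mult_right[OF has_integral_affinity'[OF Lw[unfolded box_real(2)[symmetric]], of 2 "-1"], of 2] by simp
  then have F2: "(F has_integral optical_length \<beta> w) {1/2..1}"
    by (rule has_integral_spike[of "{1/2}", rotated 2]) (auto simp: F_def)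
  have F: "(F has_integral optical_length \<beta> v + optical_length \<beta> w) {0..1}"
    by (rule has_integral_combine[OF _ _ F1 F2]) auto
  \<comment> \<open>The exceptional times of both pieces, pulled back to the joined parameter,
    together with the junction and the endpoints.\<close>
  define M where "M = N3 \<union> (\<lambda>x. (1/2) * x + 0) ` N1 \<union> (\<lambda>x. (1/2) * x + 1/2) ` N2 \<union> {0, 1/2, 1}"
  have M: "negligible M" unfolding M_def
    using N1 N2 N3 by (simp only: negligible_Un_eq negligible_affine_image negligible_insert negligible_empty simp_thms)
  have "optical_length \<beta> z \<le> optical_length \<beta> v + optical_length \<beta> w"
  proof (rule has_integral_le_AE[OF Lz F M])
    fix t assume "t \<in> {0..1} - M"
    then have t: "t \<in> {0<..<1} - N3" "t \<noteq> 1/2" and t': "t \<notin> (\<lambda>x. (1/2) * x + 0) ` N1" "t \<notin> (\<lambda>x. (1/2) * x + 1/2) ` N2"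
      by (auto simp: M_def)
    note dz = bspec[OF zx t(1)] bspec[OF zy t(1)]
    show "chess_a \<beta> (z t) * norm (zx t, zy t) \<le> F t"
    proof (cases "t < 1/2")
      case True
      have "2 * t \<notin> N1"
      proof
        assume "2 * t \<in> N1"
        moreover have "t = (1/2) * (2 * t) + 0" by simp
        ultimately show False using t'(1) by blast
      qed
      then have m: "2 * t \<in> {0<..<1} - N1" using t True by auto
      have "eventually (\<lambda>s. s \<in> {..<1/2}) (nhds t)" using True by (intro eventually_nhds_in_open) auto
      then have ev: "eventually (\<lambda>s. z s = v (2 * s + 0)) (nhds t)" by eventually_elim (simp add: z_def)
      have "((\<lambda>s. fst (v (2 * s + 0))) has_real_derivative 2 * vx (2 * t)) (at t)"
        using bspec[OF vx m] by (intro DERIV_affine_comp) simp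
      moreover have "((\<lambda>s. fst (v (2 * s + 0))) has_real_derivative zx t) (at t)"
        by (rule DERIV_cong_ev[THEN iffD1, OF refl _ refl dz(1)]) (use ev in \<open>eventually_elim, simp\<close>)
      ultimately have 1: "zx t = 2 * vx (2 * t)" by (rule DERIV_unique[rotated])
      have "((\<lambda>s. snd (v (2 * s + 0))) has_real_derivative 2 * vy (2 * t)) (at t)"
        using bspec[OF vy m] by (intro DERIV_affine_comp) simp
      moreover have "((\<lambda>s. snd (v (2 * s + 0))) has_real_derivative zy t) (at t)"
        by (rule DERIV_cong_ev[THEN iffD1, OF refl _ refl dz(2)]) (use ev in \<open>eventually_elim, simp\<close>)
      ultimately have 2: "zy t = 2 * vy (2 * t)" by (rule DERIV_unique[rotated])
      have "norm (zx t, zy t) = norm (2 *\<^sub>R (vx (2 * t), vy (2 * t)))" by (simp add: 1 2)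
      also have "\<dots> = 2 * norm (vx (2 * t), vy (2 * t))" by (simp only: norm_scaleR real_norm_def abs_numeral)
      finally show ?thesis using True by (simp add: F_def z_def)
    next
      case False
      with t have gt: "t > 1/2" by simp
      have "2 * t - 1 \<notin> N2"
      proof
        assume "2 * t - 1 \<in> N2"
        moreover have "t = (1/2) * (2 * t - 1) + 1/2" by (simp add: field_simps)
        ultimately show False using t'(2) by blast
      qed
      then have m: "2 * t + - 1 \<in> {0<..<1} - N2" using t gt by auto
      have "eventually (\<lambda>s. s \<in> {1/2<..}) (nhds t)" using gt by (intro eventually_nhds_in_open) auto
      then have ev: "eventually (\<lambda>s. z s = w (2 * s + - 1)) (nhds t)" by eventually_elim (simp add: z_def)
      have "((\<lambda>s. fst (w (2 * s + - 1))) has_real_derivative 2 * wx (2 * t + - 1)) (at t)"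
        using bspec[OF wx m] by (rule DERIV_affine_comp)
      moreover have "((\<lambda>s. fst (w (2 * s + - 1))) has_real_derivative zx t) (at t)"
        by (rule DERIV_cong_ev[THEN iffD1, OF refl _ refl dz(1)]) (use ev in \<open>eventually_elim, simp\<close>)
      ultimately have 1: "zx t = 2 * wx (2 * t + - 1)" by (rule DERIV_unique[rotated])
      have "((\<lambda>s. snd (w (2 * s + - 1))) has_real_derivative 2 * wy (2 * t + - 1)) (at t)"
        using bspec[OF wy m] by (rule DERIV_affine_comp)
      moreover have "((\<lambda>s. snd (w (2 * s + - 1))) has_real_derivative zy t) (at t)"
        by (rule DERIV_cong_ev[THEN iffD1, OF refl _ refl dz(2)]) (use ev in \<open>eventually_elim, simp\<close>)
      ultimately have 2: "zy t = 2 * wy (2 * t + - 1)" by (rule DERIV_unique[rotated])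
      have "norm (zx t, zy t) = norm (2 *\<^sub>R (wx (2 * t - 1), wy (2 * t - 1)))" by (simp add: 1 2)
      also have "\<dots> = 2 * norm (wx (2 * t - 1), wy (2 * t - 1))" by (simp only: norm_scaleR real_norm_def abs_numeral)
      finally show ?thesis using gt by (simp add: F_def z_def)
    qed
  qed
  then show ?thesis unfolding reach_def using z v w
    by (intro exI[of _ z]) (auto simp: z_def)
qed

section \<open>The optical length of an S3-path\<close>

text \<open>Height gained by a ray with Snell invariant \<sigma> across unit columns that are light,
  dark and light; an S3-path is the ray with rise 1.\<close>

definition s3_rise :: "real \<Rightarrow> real \<Rightarrow> real" where
  "s3_rise \<beta> \<sigma> = 2 * \<sigma> / sqrt (1 - \<sigma>\<^sup>2) + \<sigma> / sqrt (\<beta>\<^sup>2 - \<sigma>\<^sup>2)"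

lemma sq_less_one: "0 \<le> \<sigma> \<Longrightarrow> \<sigma> < 1 \<Longrightarrow> \<sigma>\<^sup>2 < (1::real)"
  by (simp add: power_less_one_iff)

lemma s3_rise_strict_mono:
  assumes "1 < \<beta>" "0 \<le> \<sigma>" "\<sigma> < \<tau>" "\<tau> < 1"
  shows "s3_rise \<beta> \<sigma> < s3_rise \<beta> \<tau>"
proof -
  have le: "\<sigma>\<^sup>2 \<le> \<tau>\<^sup>2" using assms by (intro power_mono) auto
  have t: "\<tau>\<^sup>2 < 1" using assms by (intro sq_less_one) auto
  have b: "1 < \<beta>\<^sup>2" using assms by (intro one_less_power) auto
  have tb: "\<tau>\<^sup>2 < \<beta>\<^sup>2" using t b by linarith
  have "2 * \<sigma> / sqrt (1 - \<sigma>\<^sup>2) < 2 * \<tau> / sqrt (1 - \<tau>\<^sup>2)"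
    using assms le t by (intro frac_less) auto
  moreover have "\<sigma> / sqrt (\<beta>\<^sup>2 - \<sigma>\<^sup>2) < \<tau> / sqrt (\<beta>\<^sup>2 - \<tau>\<^sup>2)"
    using assms le tb by (intro frac_less) auto
  ultimately show ?thesis unfolding s3_rise_def by linarith
qed

lemma s3_rise_ex1:
  assumes "1 < \<beta>"
  shows "\<exists>!\<sigma>. 0 < \<sigma> \<and> \<sigma> < 1 \<and> s3_rise \<beta> \<sigma> = 1"
proof (rule ex_ex1I)
  have b: "1 < \<beta>\<^sup>2" using assms by (intro one_less_power) auto
  \<comment> \<open>At 1/2 the two light columns alone already rise by at least 1.\<close>
  have "\<exists>\<sigma>\<ge>0. \<sigma> \<le> 1/2 \<and> s3_rise \<beta> \<sigma> = 1"
  proof (rule IVT')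
    show "s3_rise \<beta> 0 \<le> 1" by (simp add: s3_rise_def)
    have "sqrt (1 - (1/2)\<^sup>2) \<le> 1" by (simp add: power2_eq_square)
    moreover have "sqrt (1 - (1/2)\<^sup>2) > (0::real)" by (simp add: power2_eq_square)
    ultimately have "1 \<le> 2 * (1/2) / sqrt (1 - (1/2)\<^sup>2)" by simp
    moreover have "0 \<le> (1/2) / sqrt (\<beta>\<^sup>2 - (1/2)\<^sup>2)" using b by (intro divide_nonneg_nonneg) (auto simp: power2_eq_square)
    ultimately show "1 \<le> s3_rise \<beta> (1/2)" unfolding s3_rise_def by linarith
    have ne: "1 - \<sigma>\<^sup>2 \<noteq> 0" "\<beta>\<^sup>2 - \<sigma>\<^sup>2 \<noteq> 0" if "\<sigma> \<in> {0..1/2}" for \<sigma> :: real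
      using sq_less_one[of \<sigma>] b that by auto
    show "continuous_on {0..1/2} (s3_rise \<beta>)"
      unfolding s3_rise_def using ne by (auto intro!: continuous_intros)
  qed simp
  then obtain \<sigma> where "\<sigma> \<ge> 0" "\<sigma> \<le> 1/2" "s3_rise \<beta> \<sigma> = 1" by blast
  moreover have "\<sigma> \<noteq> 0" using \<open>s3_rise \<beta> \<sigma> = 1\<close> by (auto simp: s3_rise_def)
  ultimately show "\<exists>\<sigma>. 0 < \<sigma> \<and> \<sigma> < 1 \<and> s3_rise \<beta> \<sigma> = 1" by (intro exI[of _ \<sigma>]) auto
  show "\<sigma> = \<tau>" if "0 < \<sigma> \<and> \<sigma> < 1 \<and> s3_rise \<beta> \<sigma> = 1" "0 < \<tau> \<and> \<tau> < 1 \<and> s3_rise \<beta> \<tau> = 1" for \<sigma> \<tau>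
    using s3_rise_strict_mono[OF assms, of \<sigma> \<tau>] s3_rise_strict_mono[OF assms, of \<tau> \<sigma>] that
    by (cases \<sigma> \<tau> rule: linorder_cases) auto
qed

lemma sigma3_spec:
  assumes "1 < \<beta>"
  shows "0 < sigma3 \<beta>" "sigma3 \<beta> < 1" "s3_rise \<beta> (sigma3 \<beta>) = 1"
  using theI'[OF s3_rise_ex1[OF assms]] unfolding sigma3_def s3_rise_def by blast+

text \<open>Multiplying the rise equation by \<open>s\<close> removes the quotients. The result
  pairs the gradients (k, s), (m, s), (k, s) of the three squares with an S3-path of total
  displacement (3, 1), which is how the calibration sees \<open>Lambda3\<close>.\<close>

lemma Lambda3_eq:
  assumes "1 < \<beta>"
  shows "Lambda3 \<beta> = sigma3 \<beta> + 2 * sqrt (1 - (sigma3 \<beta>)\<^sup>2) + sqrt (\<beta>\<^sup>2 - (sigma3 \<beta>)\<^sup>2)"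
proof -
  define s k m where "s = sigma3 \<beta>" and "k = sqrt (1 - s\<^sup>2)" and "m = sqrt (\<beta>\<^sup>2 - s\<^sup>2)"
  have b: "1 < \<beta>\<^sup>2" using assms by (intro one_less_power) auto
  have s: "s\<^sup>2 < 1" using sigma3_spec[OF assms] unfolding s_def by (intro sq_less_one) auto
  have "k > 0" "m > 0" "k\<^sup>2 = 1 - s\<^sup>2" "m\<^sup>2 = \<beta>\<^sup>2 - s\<^sup>2" using s b by (auto simp: k_def m_def)
  have e: "2 * s / k + s / m = 1" using sigma3_spec(3)[OF assms] by (simp add: s3_rise_def s_def k_def m_def)
  have "2 / k = 2 * k + s * (2 * s / k)"
    using \<open>k > 0\<close> \<open>k\<^sup>2 = 1 - s\<^sup>2\<close> by (simp add: field_simps power2_eq_square)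
  moreover have "\<beta>\<^sup>2 / m = m + s * (s / m)"
    using \<open>m > 0\<close> \<open>m\<^sup>2 = \<beta>\<^sup>2 - s\<^sup>2\<close> by (simp add: field_simps power2_eq_square)
  ultimately have "2 / k + \<beta>\<^sup>2 / m = 2 * k + m + s * (2 * s / k + s / m)" by (simp only: distrib_left)
  then show ?thesis unfolding Lambda3_def e by (simp add: s_def k_def m_def)
qed

lemma Cauchy_Schwarz_2: "a * x + b * y \<le> sqrt (a\<^sup>2 + b\<^sup>2) * sqrt (x\<^sup>2 + y\<^sup>2)" for a b x y :: real
proof -
  have "(a * x + b * y)\<^sup>2 + (a * y - b * x)\<^sup>2 = (a\<^sup>2 + b\<^sup>2) * (x\<^sup>2 + y\<^sup>2)" by algebra
  then have "(a * x + b * y)\<^sup>2 \<le> (a\<^sup>2 + b\<^sup>2) * (x\<^sup>2 + y\<^sup>2)"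
    using zero_le_power2[of "a * y - b * x"] by linarith
  then show ?thesis by (metis real_le_rsqrt real_sqrt_mult)
qed

text \<open>The right-hand side is the length of the polygon through \<open>(1, a)\<close> and \<open>(2, 1 - a)\<close>; Snell's law
makes the \<open>S\<^sub>3\<close>-path the shortest of these.\<close>

lemma Lambda3_le:
  assumes "1 < \<beta>" "2 * a + b = 1"
  shows "Lambda3 \<beta> \<le> 2 * sqrt (1 + a\<^sup>2) + \<beta> * sqrt (1 + b\<^sup>2)"
proof -
  define s k m where "s = sigma3 \<beta>" and "k = sqrt (1 - s\<^sup>2)" and "m = sqrt (\<beta>\<^sup>2 - s\<^sup>2)"
  have b: "1 < \<beta>\<^sup>2" using assms by (intro one_less_power) auto
  have s: "s\<^sup>2 < 1" using sigma3_spec[OF assms(1)] unfolding s_def by (intro sq_less_one) auto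
  have kk: "k\<^sup>2 = 1 - s\<^sup>2" "m\<^sup>2 = \<beta>\<^sup>2 - s\<^sup>2" using s b by (auto simp: k_def m_def)
  have 1: "k + s * a \<le> sqrt (1 + a\<^sup>2)"
    using Cauchy_Schwarz_2[of k 1 s a] kk by simp
  have 2: "m + s * b \<le> \<beta> * sqrt (1 + b\<^sup>2)"
    using Cauchy_Schwarz_2[of m 1 s b] kk assms(1) by simp
  have "s = s * (2 * a + b)" using assms by simp
  then have "s = 2 * (s * a) + s * b" by (simp add: algebra_simps)
  moreover have "Lambda3 \<beta> = s + 2 * k + m"
    using Lambda3_eq[OF assms(1)] by (simp add: s_def k_def m_def)
  ultimately show ?thesis using 1 2 by linarith
qed

lemma Lambda3_attained:
  assumes "1 < \<beta>"
  shows "\<exists>a b. 0 < a \<and> 0 < b \<and> 2 * a + b = 1 \<and>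
    Lambda3 \<beta> = 2 * sqrt (1 + a\<^sup>2) + \<beta> * sqrt (1 + b\<^sup>2)"
proof -
  define s k m where "s = sigma3 \<beta>" and "k = sqrt (1 - s\<^sup>2)" and "m = sqrt (\<beta>\<^sup>2 - s\<^sup>2)"
  have b: "1 < \<beta>\<^sup>2" using assms by (intro one_less_power) auto
  have s: "s\<^sup>2 < 1" "s > 0" using sigma3_spec[OF assms] unfolding s_def by (auto intro!: sq_less_one)
  have p: "k > 0" "m > 0" and kk: "k\<^sup>2 = 1 - s\<^sup>2" "m\<^sup>2 = \<beta>\<^sup>2 - s\<^sup>2" using s b by (auto simp: k_def m_def)
  have e: "2 * (s / k) + s / m = 1" using sigma3_spec(3)[OF assms] by (simp add: s3_rise_def s_def k_def m_def)
  have "1 + (s / k)\<^sup>2 = (1 / k)\<^sup>2" using p kk by (simp add: power_divide field_simps)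
  then have 1: "sqrt (1 + (s / k)\<^sup>2) = 1 / k" using p by (simp add: real_sqrt_unique)
  have "1 + (s / m)\<^sup>2 = (\<beta> / m)\<^sup>2" using p kk by (simp add: power_divide field_simps)
  then have 2: "sqrt (1 + (s / m)\<^sup>2) = \<beta> / m" using p assms by (simp add: real_sqrt_unique)
  show ?thesis
  \<comment> \<open>The witnesses \<open>s / k\<close> and \<open>s / m\<close> are the slopes of
    the ray in light and dark squares, where both Cauchy-Schwarz estimates are equalities.\<close>
  proof (intro exI conjI)
    show "Lambda3 \<beta> = 2 * sqrt (1 + (s / k)\<^sup>2) + \<beta> * sqrt (1 + (s / m)\<^sup>2)"
      unfolding 1 2 Lambda3_def by (simp add: s_def k_def m_def power2_eq_square)
  qed (use s p e in auto)
qed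

text \<open>For fixed slopes the polygon length grows affinely with the dark coefficient, and the
  slopes optimal for \<gamma> compete at \<beta>.\<close>

lemma Lambda3_strict_mono:
  assumes "1 < \<beta>" "\<beta> < \<gamma>"
  shows "Lambda3 \<beta> < Lambda3 \<gamma>"
proof -
  obtain a b where ab: "2 * a + b = 1" "Lambda3 \<gamma> = 2 * sqrt (1 + a\<^sup>2) + \<gamma> * sqrt (1 + b\<^sup>2)"
    using Lambda3_attained[of \<gamma>] assms by auto
  have "0 < sqrt (1 + b\<^sup>2)" by (simp add: add_pos_nonneg)
  then have "\<beta> * sqrt (1 + b\<^sup>2) < \<gamma> * sqrt (1 + b\<^sup>2)" using assms by simp
  with Lambda3_le[OF assms(1) ab(1)] ab(2) show ?thesis by linarith
qed

text \<open>Here the slopes optimal for \<beta> compete at \<gamma>; since \<open>b \<le> 1\<close>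
  the growth rate is at most 2. This supplies continuity for the intermediate value theorem.\<close>

lemma Lambda3_lipschitz:
  assumes "1 < \<beta>" "\<beta> \<le> \<gamma>"
  shows "Lambda3 \<gamma> \<le> Lambda3 \<beta> + 2 * (\<gamma> - \<beta>)"
proof -
  obtain a b where ab: "0 < a" "0 < b" "2 * a + b = 1" "Lambda3 \<beta> = 2 * sqrt (1 + a\<^sup>2) + \<beta> * sqrt (1 + b\<^sup>2)"
    using Lambda3_attained[of \<beta>] assms by auto
  have "b\<^sup>2 \<le> 1" using ab by (intro power_le_one) auto
  then have "sqrt (1 + b\<^sup>2) \<le> 2" by (intro real_le_lsqrt) auto
  then have "(\<gamma> - \<beta>) * sqrt (1 + b\<^sup>2) \<le> (\<gamma> - \<beta>) * 2" using assms by (intro mult_left_mono) auto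
  with Lambda3_le[of \<gamma> a b] ab assms show ?thesis by (simp add: algebra_simps)
qed

section \<open>The critical coefficient and numerical bounds\<close>

lemma sqrt_two_bounds: "1.414 < sqrt 2" "sqrt 2 < (1.4143::real)"
  by (rule real_less_rsqrt, simp add: power2_eq_square) (rule real_less_lsqrt, simp_all add: power2_eq_square)

lemma sqrt_three_halves_bounds: "1 < sqrt (3/2)" "sqrt (3/2) < sqrt (2::real)"
  by simp_all

lemma Lambda3_sqrt_three_halves: "Lambda3 (sqrt (3/2)) < 2 + sqrt 2"
proof -
  \<comment> \<open>Rational trial slopes 9/25 and 7/25, close to the optimal ones.\<close>
  have "Lambda3 (sqrt (3/2)) \<le> 2 * sqrt (1 + (9/25)\<^sup>2) + sqrt (3/2) * sqrt (1 + (7/25)\<^sup>2)"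
    by (rule Lambda3_le) simp_all
  also have "sqrt (1 + (9/25)\<^sup>2) \<le> 1.0632" by (rule real_le_lsqrt) (simp_all add: power2_eq_square)
  also have "sqrt (3/2) * sqrt (1 + (7/25)\<^sup>2) \<le> 1.272"
    unfolding real_sqrt_mult[symmetric] by (rule real_le_lsqrt) (simp_all add: power2_eq_square)
  finally show ?thesis using sqrt_two_bounds by simp
qed

lemma Lambda3_sqrt_two: "Lambda3 (sqrt 2) > 2 + sqrt 2"
proof -
  have "1 < sqrt (2::real)" by simp
  from Lambda3_attained[OF this] obtain a b where ab: "0 < a" "0 < b"
    "Lambda3 (sqrt 2) = 2 * sqrt (1 + a\<^sup>2) + sqrt 2 * sqrt (1 + b\<^sup>2)" by blast
  then have "1 < sqrt (1 + a\<^sup>2)" "1 < sqrt (1 + b\<^sup>2)" by auto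
  then have "sqrt 2 * 1 < sqrt 2 * sqrt (1 + b\<^sup>2)" by (intro mult_strict_left_mono) auto
  with ab \<open>1 < sqrt (1 + a\<^sup>2)\<close> show ?thesis by linarith
qed

text \<open>For t = 2 both definite descriptions have the same body, so no condition on \<beta> is
  needed. The zero of \<open>lnorm 2\<close> is thus the coefficient at which an S3-path ties with
  two horizontal units and a diagonal.\<close>

lemma lnorm_two: "lnorm 2 \<beta> = Lambda3 \<beta> - 2 - sqrt 2"
proof -
  have q: "qfun 2 = 1" "pfun 2 = 2" by (simp_all add: qfun_def pfun_def)
  have "sigma_hat 2 \<beta> = sigma3 \<beta>" unfolding sigma_hat_def sigma3_def q by simp
  then show ?thesis unfolding lnorm_def Let_def q Lambda3_def by simp
qed

text \<open>Existence comes from the intermediate value theorem between the two preceding estimates,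
  uniqueness from strict monotonicity on all coefficients above 1. The bounds make
  \<open>c = beta0c\<close> admissible for the calibration.\<close>

lemma beta0c_spec: "sqrt (3/2) < beta0c" "beta0c < sqrt 2" "Lambda3 beta0c = 2 + sqrt 2"
proof -
  have "\<exists>\<beta>\<ge>sqrt (3/2). \<beta> \<le> sqrt 2 \<and> Lambda3 \<beta> = 2 + sqrt 2"
  proof (rule IVT')
    show "continuous_on {sqrt (3/2)..sqrt 2} Lambda3"
    proof (rule lipschitz_on_continuous_on[of 2], rule lipschitz_onI)
      fix x y :: real assume xy: "x \<in> {sqrt (3/2)..sqrt 2}" "y \<in> {sqrt (3/2)..sqrt 2}"
      then have "1 < x" "1 < y"
        using sqrt_three_halves_bounds(1) by (auto simp del: real_sqrt_gt_1_iff intro: less_le_trans)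
      then show "dist (Lambda3 x) (Lambda3 y) \<le> 2 * dist x y"
        using Lambda3_lipschitz[of x y] Lambda3_lipschitz[of y x]
          Lambda3_strict_mono[of x y] Lambda3_strict_mono[of y x]
        by (cases x y rule: linorder_cases) (auto simp: dist_real_def)
    qed simp
  qed (use Lambda3_sqrt_three_halves Lambda3_sqrt_two in auto)
  then obtain \<beta> where \<beta>: "sqrt (3/2) \<le> \<beta>" "\<beta> \<le> sqrt 2" "Lambda3 \<beta> = 2 + sqrt 2" by blast
  then have ne: "sqrt (3/2) < \<beta>" "\<beta> < sqrt 2"
    using Lambda3_sqrt_three_halves Lambda3_sqrt_two by (auto simp: less_le)
  have "1 < \<beta>" using ne sqrt_three_halves_bounds by linarith
  have "beta0c = \<beta>"
    unfolding beta0c_def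
  proof (rule the_equality)
    show "1 < \<beta> \<and> \<beta> < sqrt 2 \<and> lnorm 2 \<beta> = 0" using \<open>1 < \<beta>\<close> ne \<beta> by (simp add: lnorm_two)
    fix \<gamma> assume "1 < \<gamma> \<and> \<gamma> < sqrt 2 \<and> lnorm 2 \<gamma> = 0"
    then show "\<gamma> = \<beta>"
      using Lambda3_strict_mono[of \<beta> \<gamma>] Lambda3_strict_mono[of \<gamma> \<beta>] \<open>1 < \<beta>\<close> \<beta>
      by (cases \<gamma> \<beta> rule: linorder_cases) (auto simp: lnorm_two)
  qed
  with ne \<beta> show "sqrt (3/2) < beta0c" "beta0c < sqrt 2" "Lambda3 beta0c = 2 + sqrt 2" by auto
qed

text \<open>\<open>s3_rise\<close> is below 1 at 0.3 and above 1 at 0.37, uniformly in the allowed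
  \<beta>. This bracket feeds the estimates \<open>23/25 \<le> k\<close> and
  \<open>29/25 \<le> m\<close> for the calibration.\<close>

lemma sigma3_bounds:
  assumes "3/2 \<le> \<beta>\<^sup>2" "\<beta>\<^sup>2 \<le> 2" "1 < \<beta>"
  shows "0.3 < sigma3 \<beta>" "sigma3 \<beta> < 0.37"
proof -
  note s = sigma3_spec[OF \<open>1 < \<beta>\<close>]
  have "s3_rise \<beta> 0.3 < 1"
  proof -
    have "0.95 \<le> sqrt (1 - 0.3\<^sup>2 :: real)" by (rule real_le_rsqrt) (simp add: power2_eq_square)
    then have "2 * 0.3 / sqrt (1 - 0.3\<^sup>2) \<le> 2 * 0.3 / (0.95::real)" by (intro frac_le) auto
    moreover have "1.1 \<le> sqrt (\<beta>\<^sup>2 - 0.3\<^sup>2)"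
      using assms by (intro real_le_rsqrt) (simp add: power2_eq_square)
    then have "0.3 / sqrt (\<beta>\<^sup>2 - 0.3\<^sup>2) \<le> 0.3 / 1.1" by (intro frac_le) auto
    ultimately show ?thesis unfolding s3_rise_def by simp
  qed
  then show "0.3 < sigma3 \<beta>"
    using s s3_rise_strict_mono[OF \<open>1 < \<beta>\<close>, of "sigma3 \<beta>" "0.3"]
    by (cases "sigma3 \<beta>" "0.3 :: real" rule: linorder_cases) auto
  have "1 < s3_rise \<beta> 0.37"
  proof -
    have p: "0 < sqrt (1 - 0.37\<^sup>2 :: real)" "0 < sqrt (\<beta>\<^sup>2 - 0.37\<^sup>2)" using assms by (auto simp: power2_eq_square)
    have "sqrt (1 - 0.37\<^sup>2 :: real) \<le> 0.93" by (rule real_le_lsqrt) (simp_all add: power2_eq_square)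
    then have "2 * 0.37 / (0.93::real) \<le> 2 * 0.37 / sqrt (1 - 0.37\<^sup>2)" using p by (intro frac_le) auto
    moreover have "sqrt (\<beta>\<^sup>2 - 0.37\<^sup>2) \<le> 1.37"
      using assms by (intro real_le_lsqrt) (simp_all add: power2_eq_square)
    then have "0.37 / 1.37 \<le> 0.37 / sqrt (\<beta>\<^sup>2 - 0.37\<^sup>2)" using p by (intro frac_le) auto
    ultimately show ?thesis unfolding s3_rise_def by simp
  qed
  then show "sigma3 \<beta> < 0.37"
    using s s3_rise_strict_mono[OF \<open>1 < \<beta>\<close>, of "0.37" "sigma3 \<beta>"]
    by (cases "sigma3 \<beta>" "0.37 :: real" rule: linorder_cases) auto
qed

section \<open>The calibration\<close>

text \<open>McShane's infimum of cones. The data form a relation whose single-valuedness follows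
  from the hypothesis at \<open>P = Q\<close>, so edges may overlap at corners without a separate
  check.\<close>

lemma lipschitz_extension:
  fixes E :: "('a::metric_space \<times> real) set"
  assumes "E \<noteq> {}" "0 \<le> K"
    and E: "\<And>P v Q w. (P, v) \<in> E \<Longrightarrow> (Q, w) \<in> E \<Longrightarrow> w - v \<le> K * dist P Q"
  shows "\<exists>F. (\<forall>P v. (P, v) \<in> E \<longrightarrow> F P = v) \<and> (\<forall>P Q. \<bar>F P - F Q\<bar> \<le> K * dist P Q)"
proof -
  define F where "F P = (INF e\<in>E. snd e + K * dist (fst e) P)" for P
  obtain P0 v0 where E0: "(P0, v0) \<in> E" using \<open>E \<noteq> {}\<close> by auto
  have bdd: "bdd_below ((\<lambda>e. snd e + K * dist (fst e) P) ` E)" for P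
  proof (rule bdd_belowI2)
    fix e assume "e \<in> E"
    then have "v0 - snd e \<le> K * dist (fst e) P0" by (intro E) (auto simp: E0)
    also have "\<dots> \<le> K * (dist (fst e) P + dist P P0)"
      using \<open>0 \<le> K\<close> by (intro mult_left_mono dist_triangle)
    finally show "v0 - K * dist P P0 \<le> snd e + K * dist (fst e) P" by (simp add: distrib_left)
  qed
  have upper: "F P \<le> v + K * dist Q P" if "(Q, v) \<in> E" for P Q v
    unfolding F_def using cINF_lower[OF bdd that, of P] by simp
  have le: "F P \<le> F Q + K * dist P Q" for P Q
  proof -
    have "F P - K * dist P Q \<le> F Q"
      unfolding F_def[of Q]
    proof (rule cINF_greatest[OF \<open>E \<noteq> {}\<close>])
      fix e assume "e \<in> E"
      then have "F P \<le> snd e + K * dist (fst e) P" by (intro upper) simp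
      also have "\<dots> \<le> snd e + K * (dist (fst e) Q + dist Q P)"
        using \<open>0 \<le> K\<close> by (intro add_left_mono mult_left_mono dist_triangle)
      finally show "F P - K * dist P Q \<le> snd e + K * dist (fst e) Q"
        by (simp add: distrib_left dist_commute)
    qed
    then show ?thesis by simp
  qed
  have val: "F P = v" if "(P, v) \<in> E" for P v
  proof (rule antisym)
    show "F P \<le> v" using upper[OF that, of P] by simp
    show "v \<le> F P"
      unfolding F_def
    proof (rule cINF_greatest[OF \<open>E \<noteq> {}\<close>])
      fix e assume "e \<in> E"
      then have "v - snd e \<le> K * dist (fst e) P" by (intro E) (auto simp: that)
      then show "v \<le> snd e + K * dist (fst e) P" by simp
    qed
  qed
  have "\<bar>F P - F Q\<bar> \<le> K * dist P Q" for P Q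
    using le[of P Q] le[of Q P] by (simp add: dist_commute abs_le_iff)
  with val show ?thesis by blast
qed

text \<open>The boundary data of every square are antisymmetric about its centre, so two adjacent edges
determine the other two.\<close>

lemma symmetric_lipschitz_extension:
  fixes E :: "((real \<times> real) \<times> real) set"
  assumes "E \<noteq> {}" "0 \<le> K"
    and E: "\<And>P v Q w. (P, v) \<in> E \<Longrightarrow> (Q, w) \<in> E \<Longrightarrow> w - v \<le> K * dist P Q"
    and E': "\<And>P v Q w. (P, v) \<in> E \<Longrightarrow> (Q, w) \<in> E \<Longrightarrow> \<bar>S - v - w\<bar> \<le> K * dist P ((1, 1) - Q)"
  shows "\<exists>F. (\<forall>P v. (P, v) \<in> E \<longrightarrow> F P = v \<and> F ((1, 1) - P) = S - v) \<and> (\<forall>P Q. \<bar>F P - F Q\<bar> \<le> K * dist P Q)"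
proof -
  \<comment> \<open>Point reflection in (1/2, 1/2) with values sent to \<open>S - v\<close>;
    \<open>S\<close> is the common sum of the values at opposite points.\<close>
  define E2 where "E2 = E \<union> (\<lambda>(P, v). ((1, 1) - P, S - v)) ` E"
  have refl: "dist ((1, 1) - P) ((1, 1) - Q) = dist P Q" for P Q :: "real \<times> real"
    by (simp add: dist_norm norm_minus_commute)
  have "\<exists>F. (\<forall>P v. (P, v) \<in> E2 \<longrightarrow> F P = v) \<and> (\<forall>P Q. \<bar>F P - F Q\<bar> \<le> K * dist P Q)"
  proof (rule lipschitz_extension[OF _ \<open>0 \<le> K\<close>])
    show "E2 \<noteq> {}" using \<open>E \<noteq> {}\<close> by (simp add: E2_def)
    fix P v Q w assume "(P, v) \<in> E2" "(Q, w) \<in> E2"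
    then consider "(P, v) \<in> E" "(Q, w) \<in> E"
      | Q' w' where "(P, v) \<in> E" "(Q', w') \<in> E" "Q = (1, 1) - Q'" "w = S - w'"
      | P' v' where "(P', v') \<in> E" "(Q, w) \<in> E" "P = (1, 1) - P'" "v = S - v'"
      | P' v' Q' w' where "(P', v') \<in> E" "(Q', w') \<in> E" "P = (1, 1) - P'" "v = S - v'" "Q = (1, 1) - Q'" "w = S - w'"
      unfolding E2_def by auto
    then show "w - v \<le> K * dist P Q"
    proof cases
      case 1
      then show ?thesis by (rule E)
    next
      case 2
      then show ?thesis using E'[OF 2(1,2)] by simp
    next
      case 3
      then show ?thesis using E'[OF 3(2,1)] by (simp add: dist_commute)
    next
      case 4
      then show ?thesis using E[OF 4(2,1)] by (simp add: refl dist_commute)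
    qed
  qed
  then obtain F where F: "\<And>P v. (P, v) \<in> E2 \<Longrightarrow> F P = v" "\<And>P Q. \<bar>F P - F Q\<bar> \<le> K * dist P Q"
    by blast
  have "F P = v \<and> F ((1, 1) - P) = S - v" if "(P, v) \<in> E" for P v
    using F(1)[of P v] F(1)[of "(1, 1) - P" "S - v"] that by (force simp: E2_def)
  with F(2) show ?thesis by blast
qed

text \<open>The edge comparisons below choose gradients (a, b) of norm at most \<open>K\<close> and
  estimate along them.\<close>

lemma linear_le_dist:
  fixes a b x y x' y' K :: real
  assumes "a\<^sup>2 + b\<^sup>2 \<le> K\<^sup>2" "0 \<le> K"
  shows "a * (x' - x) + b * (y' - y) \<le> K * dist (x, y) (x', y')"
proof -
  have "a * (x' - x) + b * (y' - y) \<le> sqrt (a\<^sup>2 + b\<^sup>2) * sqrt ((x' - x)\<^sup>2 + (y' - y)\<^sup>2)"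
    by (rule Cauchy_Schwarz_2)
  also have "\<dots> \<le> K * sqrt ((x' - x)\<^sup>2 + (y' - y)\<^sup>2)"
    using assms by (intro mult_right_mono real_le_lsqrt) auto
  also have "sqrt ((x' - x)\<^sup>2 + (y' - y)\<^sup>2) = dist (x, y) (x', y')"
    by (simp add: dist_Pair_Pair dist_real_def power2_commute)
  finally show ?thesis .
qed

text \<open>\<open>s\<close> is the sine of the angle of the \<open>S\<^sub>3\<close>-path in light squares, by Snell's law \<open>c\<close> times that in the
dark square; \<open>k\<close> and \<open>m\<close> are the horizontal components of the gradient along it in light and dark squares. The equation \<open>L\<close> is
\<open>3 p + q = \<Lambda>\<^sub>3(c)\<close>.\<close>

locale chess_corrector =
  fixes c s k m p q :: real
  assumes s: "0 < s" and k: "23/25 \<le> k" and ks: "k\<^sup>2 + s\<^sup>2 = 1"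
    and c: "0 < c" "3/2 \<le> c\<^sup>2" and ms: "m\<^sup>2 + s\<^sup>2 = c\<^sup>2"
    and p: "k \<le> p" "p \<le> 1" and q: "s \<le> q" and pq: "k + s \<le> p + q" "p + q \<le> sqrt 2"
    and L: "3 * p + q = s + 2 * k + m"
begin

definition "h = sqrt 2 / 2"

lemma h: "h\<^sup>2 = 1/2" "2 * h = sqrt 2" "7/10 < h" "h < 71/100"
  using sqrt_two_bounds by (auto simp: h_def power_divide)

lemma c1: "1 \<le> c"
  using c by (intro power2_le_imp_le[of 1 c]) auto

lemma s_le_h: "s \<le> h"
proof (rule power2_le_imp_le)
  have "(23/25)\<^sup>2 \<le> k\<^sup>2" using k by (intro power_mono) auto
  then show "s\<^sup>2 \<le> h\<^sup>2" using ks h by (simp add: power2_eq_square)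
qed (use h in simp)

text \<open>With \<open>23/25 \<le> k \<le> p\<close> and \<open>p + q \<le> sqrt 2\<close>,
  \<open>q\<close> stays small. The third bound is what the bottom and top edges of a dark square
  require.\<close>

lemma q_bounds: "q \<le> h" "q \<le> p" "1 + q - p \<le> h" "0 \<le> q"
  using pq p k h q s by linarith+

text \<open>Values of the calibration on the bottom (\<open>f\<close>) and right (\<open>g\<close>) edge of the light square \<open>[0, 1]\<^sup>2\<close>.
They are the maximum of the three unit-gradient affine functions \<open>k r + s t\<close>, \<open>p - 1 + r\<close> and
\<open>h (r + t) + p + q - 2 h\<close>, whose directions are those of the \<open>S\<^sub>3\<close>-path, the grid line and the
diagonal (the last one is never the largest on the bottom edge).\<close>

definition f :: "real \<Rightarrow> real" where "f r = max (k * r) (p - 1 + r)"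

definition g :: "real \<Rightarrow> real" where "g t = max p (max (k + s * t) (p + q - h * (1 - t)))"

lemma f_ends: "f 0 = 0" "f 1 = p"
  using p by (auto simp: f_def)

lemma f_ge: "k * r \<le> f r" "p - 1 + r \<le> f r"
  by (auto simp: f_def)

lemma f_incr: "r \<le> r' \<Longrightarrow> f r \<le> f r'" "r \<le> r' \<Longrightarrow> f r' - f r \<le> r' - r"
proof -
  assume "r \<le> r'"
  then have "k * r \<le> k * r'" "k * (r' - r) \<le> 1 * (r' - r)"
    using k p mult_left_mono[of r r' k] mult_right_mono[of k 1 "r' - r"] by auto
  with \<open>r \<le> r'\<close> show "f r \<le> f r'" "f r' - f r \<le> r' - r" unfolding f_def right_diff_distrib by auto
qed

lemma f_lip: "\<bar>f r' - f r\<bar> \<le> \<bar>r' - r\<bar>"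
  using f_incr[of r r'] f_incr[of r' r] by (cases "r \<le> r'") auto

lemma f_le: "0 \<le> r \<Longrightarrow> f r \<le> r" "r \<le> 1 \<Longrightarrow> f r \<le> p" "0 \<le> r \<Longrightarrow> 0 \<le> f r"
  using f_incr[of 0 r] f_incr[of r 1] by (auto simp: f_ends)

lemma g_ends: "g 0 = p" "g 1 = p + q"
  using p pq q_bounds by (auto simp: g_def)

lemma g_ge: "p \<le> g t" "k + s * t \<le> g t" "p + q - h * (1 - t) \<le> g t"
  by (auto simp: g_def)

lemma g_incr: "t \<le> t' \<Longrightarrow> g t \<le> g t'" "t \<le> t' \<Longrightarrow> g t' - g t \<le> h * (t' - t)"
proof -
  assume "t \<le> t'"
  then have "s * t \<le> s * t'" "s * (t' - t) \<le> h * (t' - t)" "0 \<le> h * (t' - t)"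
    using s s_le_h h by (auto intro!: mult_left_mono mult_right_mono)
  with \<open>t \<le> t'\<close> show "g t \<le> g t'" "g t' - g t \<le> h * (t' - t)" unfolding g_def right_diff_distrib by auto
qed

lemma g_lip: "\<bar>g t' - g t\<bar> \<le> \<bar>t' - t\<bar>"
proof -
  have "\<bar>g t' - g t\<bar> \<le> h * \<bar>t' - t\<bar>"
    using g_incr[of t t'] g_incr[of t' t] by (cases "t \<le> t'") auto
  also have "\<dots> \<le> 1 * \<bar>t' - t\<bar>" using h by (intro mult_right_mono) auto
  finally show ?thesis by simp
qed

lemma g_le: "t \<le> 1 \<Longrightarrow> g t \<le> p + q" "0 \<le> t \<Longrightarrow> g t \<le> p + h * t" "t \<le> 1 \<Longrightarrow> p + q - g t \<le> h * (1 - t)"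
  using g_incr[of t 1] g_incr[of 0 t] by (auto simp: g_ends)

lemma dist_ge: "a * (x' - x) + b * (y' - y) \<le> dist (x, y) (x', y')" if "a\<^sup>2 + b\<^sup>2 \<le> 1" for a b x y x' y' :: real
  using linear_le_dist[of a b 1 x' x y' y] that by simp

lemma dist_ge_c: "a * (x' - x) + b * (y' - y) \<le> c * dist (x, y) (x', y')" if "a\<^sup>2 + b\<^sup>2 \<le> c\<^sup>2" for a b x y x' y' :: real
  using linear_le_dist[of a b c x' x y' y] that c by simp

lemma coord_le_dist: "\<bar>x' - x\<bar> \<le> dist (x, y) (x', y')" "\<bar>y' - y\<bar> \<le> dist (x, y) (x', y')" for x y x' y' :: real
  using dist_fst_le[of "(x, y)" "(x', y')"] dist_snd_le[of "(x, y)" "(x', y')"] by (simp_all add: dist_real_def abs_minus_commute)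

lemma coord_le_c_dist: "\<bar>x' - x\<bar> \<le> c * dist (x, y) (x', y')" "\<bar>y' - y\<bar> \<le> c * dist (x, y) (x', y')" for x y x' y' :: real
proof -
  have "1 * dist (x, y) (x', y') \<le> c * dist (x, y) (x', y')" using c1 by (intro mult_right_mono) auto
  then show "\<bar>x' - x\<bar> \<le> c * dist (x, y) (x', y')" "\<bar>y' - y\<bar> \<le> c * dist (x, y) (x', y')"
    using coord_le_dist[of x' x y y'] coord_le_dist[of y' y x x'] by linarith+
qed

text \<open>Edge data extend as soon as all pairs of edges are compatible; by the antisymmetry with
  sum \<open>p + q\<close>, the bottom and right edges and their reflections onto top and left cover
  all pairs.\<close>

lemma light_extension:
  "\<exists>F. (\<forall>r\<in>{0..1}. F (r, 0) = f r \<and> F (r, 1) = p + q - f (1 - r)) \<and>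
       (\<forall>t\<in>{0..1}. F (1, t) = g t \<and> F (0, t) = p + q - g (1 - t)) \<and>
       (\<forall>P Q. \<bar>F P - F Q\<bar> \<le> dist P Q)"
proof -
  define B where "B = (\<lambda>r. ((r, 0::real), f r)) ` {0..1}"
  define R where "R = (\<lambda>t. ((1::real, t), g t)) ` {0..1}"
  have "\<exists>F. (\<forall>P v. (P, v) \<in> B \<union> R \<longrightarrow> F P = v \<and> F ((1, 1) - P) = (p + q) - v) \<and> (\<forall>P Q. \<bar>F P - F Q\<bar> \<le> 1 * dist P Q)"
  proof (rule symmetric_lipschitz_extension)
    show "B \<union> R \<noteq> {}" by (auto simp: B_def)
    fix P v Q w assume PQ: "(P, v) \<in> B \<union> R" "(Q, w) \<in> B \<union> R"
    consider (BB) r r' where "r \<in> {0..1}" "r' \<in> {0..1}" "P = (r, 0)" "v = f r" "Q = (r', 0)" "w = f r'"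
      | (BR) r t where "r \<in> {0..1}" "t \<in> {0..1}" "P = (r, 0)" "v = f r" "Q = (1, t)" "w = g t"
      | (RB) t r where "t \<in> {0..1}" "r \<in> {0..1}" "P = (1, t)" "v = g t" "Q = (r, 0)" "w = f r"
      | (RR) t t' where "t \<in> {0..1}" "t' \<in> {0..1}" "P = (1, t)" "v = g t" "Q = (1, t')" "w = g t'"
      using PQ unfolding B_def R_def by auto
    note cases = this
    \<comment> \<open>Each of the three pieces of \<open>g\<close> is compared with a lower bound of
      \<open>f\<close>, using the gradients (1, 0), (k, s) and (h, h) in turn.\<close>
    have BR: "g t - f r \<le> dist (r, 0::real) (1, t)" if "r \<in> {0..1}" "t \<in> {0..1}" for r t
    proof -
      have "p - f r \<le> \<bar>1 - r\<bar>" using f_ge(2)[of r] by auto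
      then have 1: "p - f r \<le> dist (r, 0::real) (1, t)" using coord_le_dist(1)[of 1 r 0 t] by linarith
      have 2: "k + s * t - f r \<le> dist (r, 0::real) (1, t)"
        using dist_ge[of k s 1 r t 0] ks f_ge(1)[of r] by (simp add: right_diff_distrib)
      have "h * r \<le> k * r" using k h that by (intro mult_right_mono) auto
      then have 3: "p + q - h * (1 - t) - f r \<le> dist (r, 0::real) (1, t)"
        using dist_ge[of h h 1 r t 0] h f_ge(1)[of r] pq by (simp add: right_diff_distrib)
      show ?thesis using 1 2 3 by (auto simp: g_def)
    qed
    have BT: "\<bar>p + q - f r - f r'\<bar> \<le> dist (r, 0::real) (1 - r', 1)" if "r \<in> {0..1}" "r' \<in> {0..1}" for r r'
    proof -
      have "h * r \<le> k * r" "h * r' \<le> k * r'" using k h that by (auto intro!: mult_right_mono)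
      then have "p + q - f r - f r' \<le> h * ((1 - r') - r) + h * (1 - 0)"
        using f_ge(1)[of r] f_ge(1)[of r'] pq h unfolding right_diff_distrib by linarith
      also have "\<dots> \<le> dist (r, 0::real) (1 - r', 1)" using h by (intro dist_ge) simp
      finally have 1: "p + q - f r - f r' \<le> dist (r, 0::real) (1 - r', 1)" .
      have "f r + f r' - (p + q) \<le> 1" using f_le(2)[of r] f_le(2)[of r'] that p q_bounds by auto
      then have "f r + f r' - (p + q) \<le> dist (r, 0::real) (1 - r', 1)" using coord_le_dist(2)[of 1 0 r "1 - r'"] by linarith
      with 1 show ?thesis by linarith
    qed
    have BL: "\<bar>p + q - f r - g t\<bar> \<le> dist (r, 0::real) (0, 1 - t)" if "r \<in> {0..1}" "t \<in> {0..1}" for r t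
    proof -
      have "h * (1 - t) \<le> 1 * (1 - t)" using h that by (intro mult_right_mono) auto
      moreover have "1 - t \<le> dist (r, 0::real) (0, 1 - t)" "r \<le> dist (r, 0::real) (0, 1 - t)"
        using coord_le_dist(2)[of "1 - t" 0 r 0] coord_le_dist(1)[of 0 r 0 "1 - t"] that by auto
      ultimately show ?thesis
        using g_le(1,3)[of t] f_le(1,3)[of r] that by auto
    qed
    \<comment> \<open>Pairs of pieces of \<open>g\<close>: if one is \<open>p\<close>, unit width
      suffices; two S3 pieces use \<open>k + s \<le> p + q\<close>; two diagonal pieces use
      \<open>p + q \<le> sqrt 2\<close>.\<close>
    have RL: "\<bar>p + q - g t - g t'\<bar> \<le> dist (1::real, t) (0, 1 - t')" if "t \<in> {0..1}" "t' \<in> {0..1}" for t t'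
    proof -
      define D where "D = dist (1::real, t) (0, 1 - t')"
      have D1: "1 \<le> D" using coord_le_dist(1)[of 0 1 t "1 - t'"] by (simp add: D_def)
      have Dk: "k + s * (t + t' - 1) \<le> D" using dist_ge[of "- k" "- s" 0 1 "1 - t'" t] ks by (simp add: D_def algebra_simps)
      have Dh: "h + h * (t + t' - 1) \<le> D" using dist_ge[of "- h" "- h" 0 1 "1 - t'" t] h by (simp add: D_def algebra_simps)
      have gt: "g t \<le> p + q" "g t' \<le> p + q" using g_le(1) that by auto
      \<comment> \<open>As \<open>s \<le> h\<close>, the diagonal piece lies below the line of slope
        \<open>s\<close> through its end value, so a mixed pair obeys the bound with gradient (k,
        s).\<close>
      have mixed: "k + s * x + (p + q - h * (1 - y)) - (p + q) \<le> k + s * (x + y - 1)" if "y \<le> 1" for x y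
      proof -
        have "s * (1 - y) \<le> h * (1 - y)" using s_le_h that by (intro mult_right_mono) auto
        then show ?thesis by (simp add: algebra_simps)
      qed
      have a: "p + g t' - (p + q) \<le> D" "p + g t - (p + q) \<le> D" using gt p D1 by auto
      have b: "(k + s * t) + (k + s * t') - (p + q) \<le> D" using Dk pq by (simp add: algebra_simps)
      have e: "(p + q - h * (1 - t)) + (p + q - h * (1 - t')) - (p + q) \<le> D"
        using Dh pq h by (simp add: algebra_simps)
      have d: "(k + s * t) + (p + q - h * (1 - t')) - (p + q) \<le> D" using mixed[of t' t] Dk that by auto
      have d': "(k + s * t') + (p + q - h * (1 - t)) - (p + q) \<le> D" using mixed[of t t'] Dk that by (auto simp: add.commute)
      have gD: "g t = p \<or> g t = k + s * t \<or> g t = p + q - h * (1 - t)" for t unfolding g_def by (auto simp: max_def)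
      have "g t + g t' - (p + q) \<le> D"
        using gD[of t] gD[of t'] a b e d d' by (elim disjE) (simp_all add: add.commute)
      moreover have "p + q - g t - g t' \<le> D" using g_ge(1)[of t] g_ge(1)[of t'] q_bounds D1 p by linarith
      ultimately show ?thesis unfolding D_def by linarith
    qed
    show "w - v \<le> 1 * dist P Q"
      using cases
    proof cases
      case BB
      then show ?thesis using f_lip[of r' r] coord_le_dist(1)[of r' r 0 0] by auto
    next
      case BR
      then show ?thesis using \<open>\<And>t r. r \<in> {0..1} \<Longrightarrow> t \<in> {0..1} \<Longrightarrow> g t - f r \<le> dist (r, 0::real) (1, t)\<close> by simp
    next
      case RB
      then have "f r \<le> p" "p \<le> g t" using f_le(2) g_ge by auto
      then have "w - v \<le> 0" using RB by simp
      moreover have "0 \<le> 1 * dist P Q" by simp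
      ultimately show ?thesis by linarith
    next
      case RR
      then show ?thesis using g_lip[of t' t] coord_le_dist(2)[of t' t 1 1] by auto
    qed
    show "\<bar>p + q - v - w\<bar> \<le> 1 * dist P ((1, 1) - Q)"
      using cases
    proof cases
      case BB
      then show ?thesis using BT[of r r'] by simp
    next
      case BR
      then show ?thesis using BL[of r t] by simp
    next
      case RB
      have "dist (1, t) (1 - r, 1::real) = dist (r, 0::real) (0, 1 - t)"
        by (simp add: dist_Pair_Pair dist_real_def abs_minus_commute)
      then show ?thesis using RB BL[of r t] by (simp add: algebra_simps)
    next
      case RR
      then show ?thesis using RL[of t t'] by simp
    qed
  qed simp
  then obtain F where F: "\<forall>P v. (P, v) \<in> B \<union> R \<longrightarrow> F P = v \<and> F ((1, 1) - P) = (p + q) - v"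
    and lip: "\<forall>P Q. \<bar>F P - F Q\<bar> \<le> 1 * dist P Q" by (elim exE conjE)
  have 1: "F (r, 0) = f r \<and> F (1 - r, 1) = p + q - f r" if "r \<in> {0..1}" for r
    using F[rule_format, of "(r, 0)" "f r"] that by (simp add: B_def)
  have 2: "F (1, t) = g t \<and> F (0, 1 - t) = p + q - g t" if "t \<in> {0..1}" for t
    using F[rule_format, of "(1, t)" "g t"] that by (simp add: R_def)
  show ?thesis
  proof (intro exI[of _ F] conjI ballI)
    fix r :: real assume r: "r \<in> {0..1}"
    then have r': "1 - r \<in> {0..1}" by auto
    show "F (r, 0) = f r" "F (r, 1) = p + q - f (1 - r)" "F (1, r) = g r" "F (0, r) = p + q - g (1 - r)"
      using 1[OF r] 1[OF r'] 2[OF r] 2[OF r'] by simp_all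
  qed (use lip in simp)
qed

text \<open>Here the lower left corner is a dark vertex, with value \<open>p\<close>.\<close>

lemma dark_extension:
  "\<exists>F. (\<forall>r\<in>{0..1}. F (r, 0) = 2 * p - f (1 - r) \<and> F (r, 1) = p + q + f r) \<and>
       (\<forall>t\<in>{0..1}. F (0, t) = g t \<and> F (1, t) = 3 * p + q - g (1 - t)) \<and>
       (\<forall>P Q. \<bar>F P - F Q\<bar> \<le> c * dist P Q)"
proof -
  define B where "B = (\<lambda>r. ((r, 0::real), 2 * p - f (1 - r))) ` {0..1}"
  define L' where "L' = (\<lambda>t. ((0::real, t), g t)) ` {0..1}"
  \<comment> \<open>The squared norm is 3/2; this gradient governs the comparisons of the bottom
    edge with the top and the right edge.\<close>
  have hc: "1\<^sup>2 + h\<^sup>2 \<le> c\<^sup>2" "h\<^sup>2 + 1\<^sup>2 \<le> c\<^sup>2" using h c by auto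
  have "\<exists>F. (\<forall>P v. (P, v) \<in> B \<union> L' \<longrightarrow> F P = v \<and> F ((1, 1) - P) = (3 * p + q) - v) \<and> (\<forall>P Q. \<bar>F P - F Q\<bar> \<le> c * dist P Q)"
  proof (rule symmetric_lipschitz_extension)
    show "B \<union> L' \<noteq> {}" by (auto simp: B_def)
    show "0 \<le> c" using c by simp
    fix P v Q w assume PQ: "(P, v) \<in> B \<union> L'" "(Q, w) \<in> B \<union> L'"
    consider (BB) r r' where "r \<in> {0..1}" "r' \<in> {0..1}" "P = (r, 0)" "v = 2 * p - f (1 - r)" "Q = (r', 0)" "w = 2 * p - f (1 - r')"
      | (BL) r t where "r \<in> {0..1}" "t \<in> {0..1}" "P = (r, 0)" "v = 2 * p - f (1 - r)" "Q = (0, t)" "w = g t"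
      | (LB) t r where "t \<in> {0..1}" "r \<in> {0..1}" "P = (0, t)" "v = g t" "Q = (r, 0)" "w = 2 * p - f (1 - r)"
      | (LL) t t' where "t \<in> {0..1}" "t' \<in> {0..1}" "P = (0, t)" "v = g t" "Q = (0, t')" "w = g t'"
      using PQ unfolding B_def L'_def by auto
    note cases = this
    have BT: "\<bar>3 * p + q - (2 * p - f (1 - r)) - (2 * p - f (1 - r'))\<bar> \<le> c * dist (r, 0::real) (1 - r', 1)"
      if "r \<in> {0..1}" "r' \<in> {0..1}" for r r'
    proof -
      have "3 * p + q - (2 * p - f (1 - r)) - (2 * p - f (1 - r')) \<le> 1 * ((1 - r') - r) + h * (1 - 0)"
        using f_le(1)[of "1 - r"] f_le(1)[of "1 - r'"] that q_bounds by auto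
      also have "\<dots> \<le> c * dist (r, 0::real) (1 - r', 1)" by (rule dist_ge_c[OF hc(1)])
      finally have 1: "3 * p + q - (2 * p - f (1 - r)) - (2 * p - f (1 - r')) \<le> c * dist (r, 0::real) (1 - r', 1)" .
      have "(2 * p - f (1 - r)) + (2 * p - f (1 - r')) - (3 * p + q) \<le> 1"
        using f_le(3)[of "1 - r"] f_le(3)[of "1 - r'"] that q_bounds p by auto
      then have "(2 * p - f (1 - r)) + (2 * p - f (1 - r')) - (3 * p + q) \<le> c * dist (r, 0::real) (1 - r', 1)"
        using coord_le_c_dist(2)[of 1 0 r "1 - r'"] by linarith
      with 1 show ?thesis by linarith
    qed
    have BR: "\<bar>3 * p + q - (2 * p - f (1 - r)) - g t\<bar> \<le> c * dist (r, 0::real) (1, 1 - t)"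
      if "r \<in> {0..1}" "t \<in> {0..1}" for r t
    proof -
      have "3 * p + q - (2 * p - f (1 - r)) - g t \<le> 1 * (1 - r) + h * ((1 - t) - 0)"
        using f_le(1)[of "1 - r"] g_le(3)[of t] that by auto
      also have "\<dots> \<le> c * dist (r, 0::real) (1, 1 - t)" by (rule dist_ge_c[OF hc(1)])
      finally have 1: "3 * p + q - (2 * p - f (1 - r)) - g t \<le> c * dist (r, 0::real) (1, 1 - t)" .
      have "(2 * p - f (1 - r)) + g t - (3 * p + q) \<le> 0"
        using f_le(3)[of "1 - r"] g_le(1)[of t] that by auto
      moreover have "0 \<le> c * dist (r, 0::real) (1, 1 - t)" using c by simp
      ultimately show ?thesis using 1 by linarith
    qed
    have LR: "\<bar>3 * p + q - g t - g t'\<bar> \<le> c * dist (0::real, t) (1, 1 - t')" if "t \<in> {0..1}" "t' \<in> {0..1}" for t t'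
    proof -
      \<comment> \<open>Crossing the dark square from left to right is the middle part of an
        S3-path: by \<open>L\<close>, the two pieces with gradient (k, s) leave exactly the
        increment of gradient (m, s).\<close>
      have "3 * p + q - g t - g t' \<le> m * (1 - 0) + s * ((1 - t') - t)"
        using L g_ge(2)[of t] g_ge(2)[of t'] by (simp add: algebra_simps)
      also have "\<dots> \<le> c * dist (0::real, t) (1, 1 - t')" using ms by (intro dist_ge_c) simp
      finally have 1: "3 * p + q - g t - g t' \<le> c * dist (0::real, t) (1, 1 - t')" .
      have "g t + g t' - (3 * p + q) \<le> 0" using g_le(1)[of t] g_le(1)[of t'] that q_bounds by auto
      moreover have "0 \<le> c * dist (0::real, t) (1, 1 - t')" using c by simp
      ultimately show ?thesis using 1 by linarith
    qed
    show "w - v \<le> c * dist P Q"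
      using cases
    proof cases
      case BB
      then show ?thesis using f_lip[of "1 - r'" "1 - r"] coord_le_c_dist(1)[of r' r 0 0] by auto
    next
      case BL
      have "h * t \<le> 1 * t" using h BL by (intro mult_right_mono) auto
      moreover have "g t \<le> p + h * t" "f (1 - r) \<le> p" using BL g_le(2) f_le(2) by auto
      moreover have "t \<le> c * dist (r, 0::real) (0, t)" using coord_le_c_dist(2)[of t 0 r 0] by linarith
      ultimately show ?thesis using BL by simp
    next
      case LB
      have "p - f (1 - r) \<le> r" using f_ge(2)[of "1 - r"] by simp
      moreover have "r \<le> c * dist (0::real, t) (r, 0)" using coord_le_c_dist(1)[of r 0 t 0] by linarith
      ultimately show ?thesis using LB g_ge(1)[of t] by simp
    next
      case LL
      then show ?thesis using g_lip[of t' t] coord_le_c_dist(2)[of t' t 0 0] by auto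
    qed
    show "\<bar>3 * p + q - v - w\<bar> \<le> c * dist P ((1, 1) - Q)"
      using cases
    proof cases
      case BB
      then show ?thesis using BT[of r r'] by simp
    next
      case BL
      then show ?thesis using BR[of r t] by simp
    next
      case LB
      have "dist (0, t) (1 - r, 1::real) = dist (r, 0::real) (1, 1 - t)"
        by (simp add: dist_Pair_Pair dist_real_def abs_minus_commute)
      moreover have "3 * p + q - v - w = 3 * p + q - (2 * p - f (1 - r)) - g t" using LB by simp
      ultimately show ?thesis using LB BR[of r t] by simp
    next
      case LL
      then show ?thesis using LR[of t t'] by simp
    qed
  qed
  then obtain F where F: "\<forall>P v. (P, v) \<in> B \<union> L' \<longrightarrow> F P = v \<and> F ((1, 1) - P) = (3 * p + q) - v"
    and lip: "\<forall>P Q. \<bar>F P - F Q\<bar> \<le> c * dist P Q" by (elim exE conjE)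
  have 1: "F (r, 0) = 2 * p - f (1 - r) \<and> F (1 - r, 1) = p + q + f (1 - r)" if "r \<in> {0..1}" for r
    using F[rule_format, of "(r, 0)" "2 * p - f (1 - r)"] that by (simp add: B_def)
  have 2: "F (0, t) = g t \<and> F (1, 1 - t) = 3 * p + q - g t" if "t \<in> {0..1}" for t
    using F[rule_format, of "(0, t)" "g t"] that by (simp add: L'_def)
  show ?thesis
  proof (intro exI[of _ F] conjI ballI)
    fix r :: real assume r: "r \<in> {0..1}"
    then have r': "1 - r \<in> {0..1}" by auto
    show "F (r, 0) = 2 * p - f (1 - r)" "F (r, 1) = p + q + f r" "F (0, r) = g r" "F (1, r) = 3 * p + q - g (1 - r)"
      using 1[OF r] 1[OF r'] 2[OF r] 2[OF r'] by simp_all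
  qed (use lip in simp)
qed

theorem optical_length_ge:
  assumes u: "abs_cont u" "u 0 = (0, 0)" "u 1 = (x, y)" and xy: "light_vertex (x, y)" and "c \<le> \<beta>"
  shows "p * x + q * y \<le> optical_length \<beta> u"
proof -
  obtain F where F: "\<forall>r\<in>{0..1}. F (r, 0) = f r \<and> F (r, 1) = p + q - f (1 - r)"
       "\<forall>t\<in>{0..1}. F (1, t) = g t \<and> F (0, t) = p + q - g (1 - t)"
       "\<forall>P Q. \<bar>F P - F Q\<bar> \<le> dist P Q" using light_extension by blast
  obtain G where G: "\<forall>r\<in>{0..1}. G (r, 0) = 2 * p - f (1 - r) \<and> G (r, 1) = p + q + f r"
       "\<forall>t\<in>{0..1}. G (0, t) = g t \<and> G (1, t) = 3 * p + q - g (1 - t)"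
       "\<forall>P Q. \<bar>G P - G Q\<bar> \<le> c * dist P Q" using dark_extension by blast
  \<comment> \<open>A dark cell is anchored at the light vertex (i - 1, j), since
    \<open>dark_extension\<close> gives its lower left corner the value \<open>p\<close>.\<close>
  define C where "C i j P = (if even (i + j) then p * of_int i + q * of_int j + F (P - (of_int i, of_int j))
      else p * of_int (i - 1) + q * of_int j + G (P - (of_int i, of_int j)))" for i j :: int and P :: "real \<times> real"
  define \<Phi> where "\<Phi> P = C \<lfloor>fst P\<rfloor> \<lfloor>snd P\<rfloor> P" for P
  \<comment> \<open>Neighbouring cells prescribe the same values on common edges; hence the choice
    made by \<open>floor\<close> is immaterial and \<Phi> agrees with \<open>C i j\<close> on the
    whole closed cell.\<close>
  have right: "C i j (of_int (i + 1), Y) = C (i + 1) j (of_int (i + 1), Y)" if "of_int j \<le> Y" "Y \<le> of_int (j + 1)" for i j Y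
  proof -
    have Y: "Y - of_int j \<in> {0..1}" using that by auto
    show ?thesis using bspec[OF F(2) Y] bspec[OF G(2) Y] by (simp add: C_def algebra_simps)
  qed
  have top: "C i j (X, of_int (j + 1)) = C i (j + 1) (X, of_int (j + 1))" if "of_int i \<le> X" "X \<le> of_int (i + 1)" for i j X
  proof -
    have X: "X - of_int i \<in> {0..1}" using that by auto
    show ?thesis using bspec[OF F(1) X] bspec[OF G(1) X] by (simp add: C_def algebra_simps)
  qed
  have fl: "\<lfloor>X\<rfloor> = i \<or> X = of_int (i + 1)" if "of_int i \<le> X" "X \<le> of_int (i + 1)" for X and i :: int
  proof (cases "X = of_int (i + 1)")
    case False
    with that have "\<lfloor>X\<rfloor> = i" by (intro floor_unique) auto
    then show ?thesis ..
  qed simp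
  have \<Phi>C: "\<Phi> P = C i j P" if "P \<in> cell i j" for P i j
  proof -
    obtain X Y where [simp]: "P = (X, Y)" by (cases P)
    have X: "of_int i \<le> X" "X \<le> of_int (i + 1)" and Y: "of_int j \<le> Y" "Y \<le> of_int (j + 1)"
      using that by (auto simp: mem_cell)
    have "C i j (X, Y) = C \<lfloor>X\<rfloor> j (X, Y)"
      using fl[OF X]
    proof
      assume "X = of_int (i + 1)"
      then show ?thesis using right[OF Y, of i] by simp
    qed simp
    moreover have "C \<lfloor>X\<rfloor> j (X, Y) = C \<lfloor>X\<rfloor> \<lfloor>Y\<rfloor> (X, Y)"
      using fl[OF Y]
    proof
      assume "Y = of_int (j + 1)"
      moreover have "of_int \<lfloor>X\<rfloor> \<le> X" "X \<le> of_int (\<lfloor>X\<rfloor> + 1)" by linarith+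
      ultimately show ?thesis using top[of "\<lfloor>X\<rfloor>" X j] by simp
    qed simp
    ultimately show ?thesis by (simp add: \<Phi>_def)
  qed
  have tr: "dist (P - R) (Q - R) = dist P Q" for P Q R :: "real \<times> real" by (simp add: dist_norm)
  interpret calibration \<Phi> c
  proof
    fix i j P Q assume "even (i + j)" "P \<in> cell i j" "Q \<in> cell i j"
    then show "\<bar>\<Phi> P - \<Phi> Q\<bar> \<le> dist P Q"
      using F(3)[rule_format, of "P - (of_int i, of_int j)" "Q - (of_int i, of_int j)"] \<Phi>C
      by (simp add: C_def tr)
  next
    fix i j P Q assume "odd (i + j)" "P \<in> cell i j" "Q \<in> cell i j"
    then show "\<bar>\<Phi> P - \<Phi> Q\<bar> \<le> c * dist P Q"
      using G(3)[rule_format, of "P - (of_int i, of_int j)" "Q - (of_int i, of_int j)"] \<Phi>C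
      by (simp add: C_def tr)
  qed (rule c1)
  have v: "\<Phi> (of_int (2 * n + j), of_int j) = p * of_int (2 * n + j) + q * of_int j" for n j :: int
  proof -
    have "F (0, 0) = 0" using F(1) f_ends by simp
    then show ?thesis unfolding \<Phi>_def fst_conv snd_conv floor_of_int C_def by (simp add: zero_prod_def[symmetric])
  qed
  obtain n j :: int where nj: "x = of_int (2 * n + j)" "y = of_int j" using xy unfolding light_vertex_def by blast
  have "\<Phi> (0, 0) = 0" using v[of 0 0] by simp
  moreover have "\<Phi> (x, y) = p * x + q * y" unfolding nj by (rule v)
  ultimately show ?thesis using calibration_le_optical_length[OF u(1) \<open>c \<le> \<beta>\<close>] u(2,3) by simp
qed

end

section \<open>Light vertices\<close>

lemma geodesic_le:
  assumes "is_geodesic \<beta> P Q \<Gamma>" "reach \<beta> P Q c"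
  shows "optical_length \<beta> \<Gamma> \<le> c"
  using assms unfolding is_geodesic_def reach_def abs_cont_01_iff by (meson order_trans)

lemma reach_horizontal:
  assumes "1 \<le> \<beta>" "a \<le> b"
  shows "reach \<beta> (a, of_int j) (b, of_int j) (b - a)"
proof -
  have "reach \<beta> (a, of_int j) (b, of_int j) (1 * dist (a, of_int j :: real) (b, of_int j))"
    by (rule reach_segment) (use assms in \<open>auto simp: chess_a_eq\<close>)
  then show ?thesis using assms by (simp add: dist_Pair_Pair dist_real_def)
qed

lemma reach_diagonal:
  assumes "1 \<le> \<beta>" "a \<le> b"
  shows "reach \<beta> (of_int (2 * n) + a, a) (of_int (2 * n) + b, b) (sqrt 2 * (b - a))"
proof -
  have light: "chess_a \<beta> (of_int (2 * n) + t, t) = 1" for t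
    unfolding chess_a_eq fst_conv snd_conv int_add_floor[of "2 * n" t, symmetric] by simp
  have "chess_a \<beta> ((of_int (2 * n) + a, a) + t *\<^sub>R ((of_int (2 * n) + b, b) - (of_int (2 * n) + a, a))) = 1" for t
    using light[of "a + t * (b - a)"] by (simp add: add.assoc)
  then have "reach \<beta> (of_int (2 * n) + a, a) (of_int (2 * n) + b, b)
      (1 * dist (of_int (2 * n) + a, a) (of_int (2 * n) + b, b))"
    using assms by (intro reach_segment) auto
  moreover have "dist (of_int (2 * n) + a, a) (of_int (2 * n) + b, b) = sqrt 2 * (b - a)"
    using assms by (simp add: dist_Pair_Pair dist_real_def real_sqrt_mult mult_2[symmetric] del: mult_2)
  ultimately show ?thesis by simp
qed

lemma convex_cell: "P \<in> cell i j \<Longrightarrow> Q \<in> cell i j \<Longrightarrow> t \<in> {0..1} \<Longrightarrow> P + t *\<^sub>R (Q - P) \<in> cell i j"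
proof -
  assume "P \<in> cell i j" "Q \<in> cell i j" "t \<in> {0..1}"
  moreover have "convex (cell i j)" unfolding cell_def by (intro convex_Times) auto
  ultimately have "(1 - t) *\<^sub>R P + t *\<^sub>R Q \<in> cell i j" by (auto simp: convex_alt)
  then show ?thesis by (simp add: algebra_simps)
qed

lemma reach_light_cell:
  assumes "1 \<le> \<beta>" "even (i + j)" "P \<in> cell i j" "Q \<in> cell i j"
  shows "reach \<beta> P Q (dist P Q)"
proof -
  have "reach \<beta> P Q (1 * dist P Q)"
    by (rule reach_segment[OF assms(1)])
       (use chess_a_light_cell[OF assms(2) convex_cell[OF assms(3,4)]] in auto)
  then show ?thesis by simp
qed

lemma reach_S3:
  assumes "1 < \<beta>" "even (i + j)"
  shows "reach \<beta> (of_int i, of_int j) (of_int (i + 3), of_int (j + 1)) (Lambda3 \<beta>)"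
proof -
  obtain a b where ab: "0 < a" "0 < b" "2 * a + b = 1" "Lambda3 \<beta> = 2 * sqrt (1 + a\<^sup>2) + \<beta> * sqrt (1 + b\<^sup>2)"
    using Lambda3_attained[OF assms(1)] by blast
  have \<beta>: "1 \<le> \<beta>" using assms by simp
  let ?P = "(of_int i :: real, of_int j :: real)" and ?A = "(of_int i + 1 :: real, of_int j + a)"
    and ?B = "(of_int i + 2 :: real, of_int j + (1 - a))" and ?Q = "(of_int (i + 3) :: real, of_int (j + 1) :: real)"
  have "reach \<beta> ?P ?A (dist ?P ?A)"
    by (rule reach_light_cell[OF \<beta> assms(2)]) (use ab in \<open>auto simp: mem_cell\<close>)
  \<comment> \<open>The middle segment crosses the dark square and is charged \<beta>
    throughout.\<close>
  moreover have "reach \<beta> ?A ?B (\<beta> * dist ?A ?B)"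
    by (rule reach_segment[OF \<beta> chess_a_bounds(2)[OF \<beta>]])
  moreover have "reach \<beta> ?B ?Q (dist ?B ?Q)"
    by (rule reach_light_cell[OF \<beta>, of "i + 2" j]) (use ab assms in \<open>auto simp: mem_cell\<close>)
  ultimately have "reach \<beta> ?P ?Q (dist ?P ?A + (\<beta> * dist ?A ?B + dist ?B ?Q))"
    using reach_trans[OF \<beta>] by blast
  moreover have "dist ?P ?A = sqrt (1 + a\<^sup>2)" "dist ?B ?Q = sqrt (1 + a\<^sup>2)"
    by (simp_all add: dist_Pair_Pair dist_real_def)
  moreover have "dist ?A ?B = sqrt (1 + b\<^sup>2)"
  proof -
    have "b = (1 - a) - a" using ab by simp
    then show ?thesis by (simp add: dist_Pair_Pair dist_real_def abs_minus_commute)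
  qed
  ultimately show ?thesis using ab(4) by (simp add: algebra_simps)
qed

lemma reach_S3_iterate:
  assumes "1 < \<beta>"
  shows "reach \<beta> (0, 0) (3 * real N, real N) (real N * Lambda3 \<beta>)"
proof (induction N)
  case 0
  show ?case using reach_horizontal[of \<beta> 0 0 0] assms by simp
next
  case (Suc N)
  have "reach \<beta> (of_int (3 * int N), of_int (int N)) (of_int (3 * int N + 3), of_int (int N + 1)) (Lambda3 \<beta>)"
    by (rule reach_S3[OF assms]) simp
  then have "reach \<beta> (3 * real N, real N) (3 * real (Suc N), real (Suc N)) (Lambda3 \<beta>)"
    by (simp add: algebra_simps)
  from reach_trans[OF _ Suc this] assms show ?case by (simp add: algebra_simps)
qed

text \<open>Both forms take the value \<open>Lambda3 c\<close> at (3, 1); the first is 1 at (1, 0),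
  the second is sqrt 2 at (1, 1). The bound \<open>Lambda3 c \<le> 2 + sqrt 2\<close> yields
  \<open>p + q \<le> sqrt 2\<close> for the first and \<open>p \<le> 1\<close> for the
  second.\<close>

lemma light_vertex_lower_bounds:
  assumes "3/2 \<le> c\<^sup>2" "c\<^sup>2 \<le> 2" "1 < c" "Lambda3 c \<le> 2 + sqrt 2"
    and u: "abs_cont u" "u 0 = (0, 0)" "u 1 = (x, y)" "light_vertex (x, y)" and "c \<le> \<beta>"
  shows "x + (Lambda3 c - 3) * y \<le> optical_length \<beta> u"
    and "(Lambda3 c - sqrt 2) / 2 * x + (3 * sqrt 2 - Lambda3 c) / 2 * y \<le> optical_length \<beta> u"
proof -
  define s k m where "s = sigma3 c" and "k = sqrt (1 - s\<^sup>2)" and "m = sqrt (c\<^sup>2 - s\<^sup>2)"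
  have s: "3/10 < s" "s < 37/100" using sigma3_bounds[OF assms(1-3)] by (auto simp: s_def)
  have "s\<^sup>2 \<le> (37/100)\<^sup>2" using s by (intro power_mono) auto
  then have s2: "s\<^sup>2 \<le> 1369/10000" by (simp add: power2_eq_square)
  then have km: "k\<^sup>2 = 1 - s\<^sup>2" "m\<^sup>2 = c\<^sup>2 - s\<^sup>2" using assms(1) by (auto simp: k_def m_def)
  have k: "23/25 \<le> k" unfolding k_def by (rule real_le_rsqrt) (use s2 in \<open>simp add: power2_eq_square\<close>)
  have m: "29/25 \<le> m" unfolding m_def by (rule real_le_rsqrt) (use s2 assms(1) in \<open>simp add: power2_eq_square\<close>)
  have k1: "k \<le> 1" unfolding k_def by simp
  have L: "Lambda3 c = s + 2 * k + m" using Lambda3_eq[OF assms(3)] by (simp add: s_def k_def m_def)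
  have ks: "k + s \<le> sqrt 2" using Cauchy_Schwarz_2[of k 1 s 1] km by simp
  have r2: "707/500 < sqrt 2" "sqrt 2 < (14143/10000::real)" using sqrt_two_bounds by auto
  have gen: "p * x + q * y \<le> optical_length \<beta> u"
    if "k \<le> p" "p \<le> 1" "s \<le> q" "k + s \<le> p + q" "p + q \<le> sqrt 2" "3 * p + q = s + 2 * k + m" for p q
  proof -
    interpret chess_corrector c s k m p q
      by unfold_locales (use that km k s assms in auto)
    show ?thesis by (rule optical_length_ge[OF u \<open>c \<le> \<beta>\<close>])
  qed
  have "1 * x + (Lambda3 c - 3) * y \<le> optical_length \<beta> u"
    by (rule gen) (use L k m k1 assms(4) in linarith)+
  then show "x + (Lambda3 c - 3) * y \<le> optical_length \<beta> u" by simp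
  show "(Lambda3 c - sqrt 2) / 2 * x + (3 * sqrt 2 - Lambda3 c) / 2 * y \<le> optical_length \<beta> u"
    by (rule gen) (use L k m k1 assms(4) ks r2 s in \<open>simp_all add: field_simps\<close>)
qed

theorem theorem5p5:
  fixes \<beta> x y :: real and \<Gamma> :: "real \<Rightarrow> real \<times> real"
  assumes "\<beta> > 1"
    and "is_geodesic \<beta> (0, 0) (x, y) \<Gamma>"
    and "light_vertex (x, y)"
    and "0 \<le> y" and "y \<le> x"
  shows "(\<beta> \<ge> beta0c \<longrightarrow> optical_length \<beta> \<Gamma> = x + (sqrt 2 - 1) * y)
    \<and> (sqrt (3/2) \<le> \<beta> \<and> \<beta> \<le> beta0c \<longrightarrow>
         (y \<le> x / 3 \<longrightarrow> optical_length \<beta> \<Gamma> = x + (Lambda3 \<beta> - 3) * y) \<and>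
         (x / 3 \<le> y \<longrightarrow> optical_length \<beta> \<Gamma> =
             (Lambda3 \<beta> - sqrt 2) / 2 * x + (3 * sqrt 2 - Lambda3 \<beta>) / 2 * y))"
proof -
  have \<beta>: "1 \<le> \<beta>" using assms(1) by simp
  have \<Gamma>: "abs_cont \<Gamma>" "\<Gamma> 0 = (0, 0)" "\<Gamma> 1 = (x, y)"
    using assms(2) by (auto simp: is_geodesic_def abs_cont_01_iff)
  note upper = geodesic_le[OF assms(2)]
  obtain n j :: int where nj: "x = of_int (2 * n + j)" "y = of_int j"
    using assms(3) by (auto simp: light_vertex_def)
  have "0 \<le> n" "0 \<le> j" using assms(4,5) nj by auto
  have sq: "3/2 \<le> c\<^sup>2" "c\<^sup>2 \<le> 2" "1 < c" if "sqrt (3/2) \<le> c" "c \<le> sqrt 2" for c :: real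
  proof -
    have "0 \<le> c" using that(1) order_trans[of 0 "sqrt (3/2)" c] by simp
    show "3/2 \<le> c\<^sup>2" using power_mono[OF that(1), of 2] by simp
    show "c\<^sup>2 \<le> 2" using power_mono[OF that(2) \<open>0 \<le> c\<close>, of 2] by simp
    show "1 < c" using sqrt_three_halves_bounds(1) that(1) by linarith
  qed
  have i: "optical_length \<beta> \<Gamma> = x + (sqrt 2 - 1) * y" if "beta0c \<le> \<beta>"
  proof (rule antisym)
    have "reach \<beta> (of_int (2 * 0) + 0, 0) (of_int (2 * 0) + y, y) (sqrt 2 * (y - 0))"
      by (rule reach_diagonal[OF \<beta>]) (use assms in simp)
    then have "reach \<beta> (0, 0) (y, y) (sqrt 2 * y)" by simp
    moreover have "reach \<beta> (y, y) (x, y) (x - y)" using reach_horizontal[OF \<beta> assms(5), of j] nj by simp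
    ultimately have "reach \<beta> (0, 0) (x, y) (sqrt 2 * y + (x - y))" by (rule reach_trans[OF \<beta>])
    from upper[OF this] show "optical_length \<beta> \<Gamma> \<le> x + (sqrt 2 - 1) * y" by (simp add: algebra_simps)
    note b = beta0c_spec
    \<comment> \<open>A calibration for the coefficient \<open>beta0c\<close> remains valid for
      every larger \<beta>, and there \<open>Lambda3\<close> equals 2 + sqrt 2.\<close>
    have "x + (Lambda3 beta0c - 3) * y \<le> optical_length \<beta> \<Gamma>"
      by (rule light_vertex_lower_bounds(1)[OF sq _ \<Gamma> assms(3) that]) (use b in auto)
    then show "x + (sqrt 2 - 1) * y \<le> optical_length \<beta> \<Gamma>" using b(3) by simp
  qed
  have ii: "(y \<le> x / 3 \<longrightarrow> optical_length \<beta> \<Gamma> = x + (Lambda3 \<beta> - 3) * y) \<and>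
         (x / 3 \<le> y \<longrightarrow> optical_length \<beta> \<Gamma> =
             (Lambda3 \<beta> - sqrt 2) / 2 * x + (3 * sqrt 2 - Lambda3 \<beta>) / 2 * y)"
    if "sqrt (3/2) \<le> \<beta>" "\<beta> \<le> beta0c"
  proof -
    have L: "Lambda3 \<beta> \<le> 2 + sqrt 2"
      using Lambda3_strict_mono[OF assms(1), of beta0c] beta0c_spec(3) that(2) by (cases "\<beta> = beta0c") auto
    have "\<beta> \<le> sqrt 2" using that(2) beta0c_spec(2) by simp
    note lower = light_vertex_lower_bounds[OF sq[OF that(1) this] L \<Gamma> assms(3) order_refl]
    have A: "optical_length \<beta> \<Gamma> \<le> x + (Lambda3 \<beta> - 3) * y" if "y \<le> x / 3"
    proof -
      have y: "y = real (nat j)" using nj \<open>0 \<le> j\<close> by simp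
      \<comment> \<open>S3-paths up to height \<open>y\<close>, then a horizontal rest, which is
        nonnegative because \<open>y \<le> x / 3\<close>.\<close>
      have "reach \<beta> (0, 0) (3 * y, y) (y * Lambda3 \<beta>)"
        using reach_S3_iterate[OF assms(1), of "nat j"] unfolding y .
      moreover have "reach \<beta> (3 * y, y) (x, y) (x - 3 * y)"
        using reach_horizontal[OF \<beta>, of "3 * y" x j] that nj by simp
      ultimately have "reach \<beta> (0, 0) (x, y) (y * Lambda3 \<beta> + (x - 3 * y))" by (rule reach_trans[OF \<beta>])
      from upper[OF this] show ?thesis by (simp add: algebra_simps)
    qed
    have B: "optical_length \<beta> \<Gamma> \<le> (Lambda3 \<beta> - sqrt 2) / 2 * x + (3 * sqrt 2 - Lambda3 \<beta>) / 2 * y" if "x / 3 \<le> y"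
    proof -
      have N: "real_of_int n = real (nat n)" using \<open>0 \<le> n\<close> by simp
      \<comment> \<open>Here n = (x - y) / 2: after \<open>n\<close> S3-paths the point (3 n, n)
        lies on the diagonal through (x, y), and \<open>x / 3 \<le> y\<close> means
        \<open>n \<le> j\<close>.\<close>
      have "reach \<beta> (0, 0) (3 * of_int n, of_int n) (of_int n * Lambda3 \<beta>)"
        using reach_S3_iterate[OF assms(1), of "nat n"] unfolding N .
      moreover have "reach \<beta> (of_int (2 * n) + of_int n, of_int n) (of_int (2 * n) + of_int j, of_int j) (sqrt 2 * (of_int j - of_int n))"
        by (rule reach_diagonal[OF \<beta>]) (use that nj in simp)
      then have "reach \<beta> (3 * of_int n, of_int n) (x, y) (sqrt 2 * (of_int j - of_int n))" using nj by simp
      ultimately have "reach \<beta> (0, 0) (x, y) (of_int n * Lambda3 \<beta> + sqrt 2 * (of_int j - of_int n))"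
        by (rule reach_trans[OF \<beta>])
      from upper[OF this] show ?thesis using nj by (simp add: field_simps)
    qed
    show ?thesis using A B lower by (auto intro: antisym)
  qed
  show ?thesis using i ii by blast
qed

end
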